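(* Assume Condition D and that $(H_1,H_2)$ is $U$-controllable. Then there exist constants $c>0$ and $0<q<1$ such that $$|P^n(g,A)-\pi(A)|\le cq^n$$ for all $g\in U(N)$, all Borel $A\subset U(N)$ and all $n\ge1$.
   Context: $H_1,H_2$ are Hermitian $N\times N$ matrices ($N>1$), $U_k^t=e^{-itH_k}$. For $s_1,\dots,s_n\ge0$, $J_n(s_1,\dots,s_n)=U_{k_n}^{s_n}\cdots U_{k_2}^{s_2}U_1^{s_1}$ with $k_j=1$ for odd $j$, $k_j=2$ for even $j$; $(H_1,H_2)$ is $U$-controllable if $\{J_n(s):s_j\ge0\}=U(N)$ for some $n$. Condition D: $\tau_1,\tau_2,\dots$ i.i.d. positive with $\mathbb E\tau_1<\infty$ and a density positive on $[0,\infty)$. $P(g,B)=\Pr(e^{-i\tau_2H_2}e^{-i\tau_1H_1}g\in B)$ is the one-step kernel of the Markov chain $\xi_n=e^{-i\tau_{2n}H_2}e^{-i\tau_{2n-1}H_1}\xi_{n-1}$, $\xi_0=g$, on $U(N)$; $P^n$ is its $n$-th iterate. $\pi$ is normalized Haar measure on $U(N)$. *)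

theory Defs
  imports "HOL-Probability.Probability"
begin

type_synonym 'n cmat = "complex^'n^'n"

definition cmat_adj :: "'n::finite cmat \<Rightarrow> 'n cmat" where
  "cmat_adj A = (\<chi> i j. cnj (A $ j $ i))"

definition cmat_smult :: "complex \<Rightarrow> 'n::finite cmat \<Rightarrow> 'n cmat" where
  "cmat_smult c A = (\<chi> i j. c * A $ i $ j)"

fun cmat_pow :: "'n::finite cmat \<Rightarrow> nat \<Rightarrow> 'n cmat" where
  "cmat_pow A 0 = mat 1"
| "cmat_pow A (Suc k) = A ** cmat_pow A k"

definition cmat_exp :: "'n::finite cmat \<Rightarrow> 'n cmat" where
  "cmat_exp A = (\<Sum>k. cmat_smult (1 / of_nat (fact k)) (cmat_pow A k))"

definition hermitian :: "'n::finite cmat \<Rightarrow> bool" where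
  "hermitian H \<longleftrightarrow> cmat_adj H = H"

definition unitary_group :: "'n::finite cmat set" where
  "unitary_group = {U. U ** cmat_adj U = mat 1}"

definition evol :: "'n::finite cmat \<Rightarrow> real \<Rightarrow> 'n cmat" where
  "evol H t = cmat_exp (cmat_smult (- \<i> * complex_of_real t) H)"

fun Jprod :: "'n::finite cmat \<Rightarrow> 'n cmat \<Rightarrow> nat \<Rightarrow> (nat \<Rightarrow> real) \<Rightarrow> 'n cmat" where
  "Jprod H1 H2 0 s = mat 1"
| "Jprod H1 H2 (Suc m) s =
     evol (if odd (Suc m) then H1 else H2) (s (Suc m)) ** Jprod H1 H2 m s"

definition U_controllable :: "'n::finite cmat \<Rightarrow> 'n cmat \<Rightarrow> bool" where
  "U_controllable H1 H2 \<longleftrightarrow>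
     (\<exists>n. {Jprod H1 H2 n s | s. \<forall>j\<in>{1..n}. s j \<ge> 0} = unitary_group)"

fun chain :: "'n::finite cmat \<Rightarrow> 'n cmat \<Rightarrow> (nat \<Rightarrow> 'a \<Rightarrow> real) \<Rightarrow> 'n cmat \<Rightarrow> nat \<Rightarrow> 'a \<Rightarrow> 'n cmat" where
  "chain H1 H2 \<tau> g 0 \<omega> = g"
| "chain H1 H2 \<tau> g (Suc n) \<omega> =
     evol H2 (\<tau> (2 * Suc n) \<omega>) ** evol H1 (\<tau> (2 * Suc n - 1) \<omega>) ** chain H1 H2 \<tau> g n \<omega>"

definition Pn :: "'a measure \<Rightarrow> 'n::finite cmat \<Rightarrow> 'n cmat \<Rightarrow> (nat \<Rightarrow> 'a \<Rightarrow> real)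
                   \<Rightarrow> nat \<Rightarrow> 'n cmat \<Rightarrow> 'n cmat set \<Rightarrow> real" where
  "Pn M H1 H2 \<tau> n g A = measure M {\<omega> \<in> space M. chain H1 H2 \<tau> g n \<omega> \<in> A}"

definition haar_measure :: "'n::finite cmat measure \<Rightarrow> bool" where
  "haar_measure \<pi> \<longleftrightarrow>
     sets \<pi> = sets (restrict_space borel unitary_group) \<and>
     prob_space \<pi> \<and>
     (\<forall>g\<in>unitary_group. \<forall>A\<in>sets \<pi>. emeasure \<pi> ((\<lambda>x. g ** x) ` A) = emeasure \<pi> A)"

end

(*
The law of the chain after n steps is the n-fold convolution power mu_n of the law of one step, and
P^n(g,A) = mu_n(A g^-1).  It suffices that the Haar measure is absolutely continuous with respect to
some mu_m: then pi(A) >= 1/2 forces mu_m(A) >= delta, and since pi is right invariant,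
P^m(g,A) >= delta for all g.  For every bounded function h one of the sets where h is above or below
its midrange has Haar measure at least 1/2, so the m-step kernel contracts oscillations by the factor
1 - delta/2, and pi is invariant.

Absolute continuity: the conjugates of H1 and H2 under U(N)
span the Hermitian matrices: a Hermitian X orthogonal to all of them commutes with H1 and H2, hence
with all products of evolutions, i.e. with U(N), so it is scalar; if it is not 0, then H1 and H2 have
trace 0 and all products have determinant 1, which contradicts controllability.  As every unitary
matrix is itself a product of evolutions, some long product J(s) has partial derivatives spanning the
whole tangent space.  Freezing all times except a basis of directions, and multiplying J by
1 + P with P Hermitian and small, gives a local chart of the space of all matrices near a unitary
matrix.  Comparing with Lebesgue measure there (which U(N) preserves) shows that mu_n-null sets are
pi-null near some unitary matrix.  Controllability moves this statement to all of U(N).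
*)

theory Submission
  imports Defs
begin

section \<open>Complex matrices\<close>

text \<open>Haar measure enters only through its invariance, so the comparison with the walk needs
  another reference measure: Lebesgue measure on all matrices. Fubini for \<pi> times Lebesgue
  measure shows that, for a Lebesgue null set N, almost every G satisfies u ** G outside N for
  \<pi>-almost every u; uniqueness of the polar factor near the identity carries this back to U(N).
  Charts are used in the forward direction: differentiable maps between spaces of equal dimension
  send null sets to null sets, and a surjective derivative at one point makes the image a
  neighbourhood. The price is a neighbourhood that depends on the null set considered; a walk-null
  set of maximal Haar measure removes this dependence before controllability spreads the result over
  the group. Positivity of the density is known for nonnegative times, so base points are approached
  through boxes lying to their right. A uniform \<delta> is extracted from absolute continuity by
  Borel-Cantelli, and the final rate is the m-th root of the contraction factor of m steps.\<close>

lemma cmat_mult_component: "(A ** B) $ i $ j = (\<Sum>k\<in>UNIV. A $ i $ k * B $ k $ j)"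
  by (simp add: matrix_matrix_mult_def)

lemma cmat_adj_component [simp]: "cmat_adj A $ i $ j = cnj (A $ j $ i)"
  by (simp add: cmat_adj_def)

lemma cmat_smult_component [simp]: "cmat_smult c A $ i $ j = c * A $ i $ j"
  by (simp add: cmat_smult_def)

lemma bounded_bilinear_cmat_mult:
  "bounded_bilinear ((**) :: 'n::finite cmat \<Rightarrow> 'n cmat \<Rightarrow> 'n cmat)"
proof -
  have "bilinear ((**) :: 'n cmat \<Rightarrow> 'n cmat \<Rightarrow> 'n cmat)"
    unfolding bilinear_def
    by (auto intro!: linearI simp: vec_eq_iff cmat_mult_component algebra_simps sum.distrib scaleR_sum_right)
  then show ?thesis
    by (simp add: bilinear_conv_bounded_bilinear)
qed

interpretation cmat_mult: bounded_bilinear "(**) :: 'n::finite cmat \<Rightarrow> 'n cmat \<Rightarrow> 'n cmat"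
  by (rule bounded_bilinear_cmat_mult)

lemma bounded_linear_cmat_adj: "bounded_linear (cmat_adj :: 'n::finite cmat \<Rightarrow> 'n cmat)"
  by (auto intro!: linear_conv_bounded_linear[THEN iffD1] linearI simp: vec_eq_iff)

lemma bounded_linear_cmat_smult: "bounded_linear (cmat_smult c :: 'n::finite cmat \<Rightarrow> 'n cmat)"
  by (auto intro!: linear_conv_bounded_linear[THEN iffD1] linearI simp: vec_eq_iff algebra_simps)

lemmas cmat_adj_simps = linear_simps[OF bounded_linear_cmat_adj]
lemmas cmat_smult_simps = linear_simps[OF bounded_linear_cmat_smult]
lemmas isCont_cmat_adj [continuous_intros] = bounded_linear.isCont[OF bounded_linear_cmat_adj]

lemma cmat_smult_mult_left [simp]: "cmat_smult c A ** B = cmat_smult c (A ** B)"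
  by (simp add: vec_eq_iff cmat_mult_component sum_distrib_left mult.assoc)

lemma cmat_smult_mult_right [simp]: "A ** cmat_smult c B = cmat_smult c (A ** B)"
  by (simp add: vec_eq_iff cmat_mult_component sum_distrib_left mult_ac)

lemma cmat_smult_smult [simp]: "cmat_smult c (cmat_smult d A) = cmat_smult (c * d) A"
  by (simp add: vec_eq_iff)

lemma cmat_smult_1 [simp]: "cmat_smult 1 A = A"
  by (simp add: vec_eq_iff)

lemma cmat_adj_mult: "cmat_adj (A ** B) = cmat_adj B ** cmat_adj A"
  by (simp add: vec_eq_iff cmat_mult_component mult.commute)

lemma cmat_adj_adj [simp]: "cmat_adj (cmat_adj A) = A"
  by (simp add: vec_eq_iff)

lemma cmat_adj_smult: "cmat_adj (cmat_smult c A) = cmat_smult (cnj c) (cmat_adj A)"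
  by (simp add: vec_eq_iff)

lemma cmat_adj_mat_1 [simp]: "cmat_adj (mat 1) = mat 1"
  by (simp add: vec_eq_iff mat_def)

lemma inner_cmat: "(A :: 'n::finite cmat) \<bullet> B = Re (\<Sum>i\<in>UNIV. \<Sum>j\<in>UNIV. A $ i $ j * cnj (B $ i $ j))"
  by (simp add: inner_vec_def inner_complex_def)

lemma inner_cmat_mult_left: "(A ** B) \<bullet> C = B \<bullet> (cmat_adj A ** C)" for A B C :: "'n::finite cmat"
proof -
  have "(\<Sum>i\<in>UNIV. \<Sum>j\<in>UNIV. (A ** B) $ i $ j * cnj (C $ i $ j)) =
        (\<Sum>i\<in>UNIV. \<Sum>j\<in>UNIV. \<Sum>k\<in>UNIV. A $ i $ k * B $ k $ j * cnj (C $ i $ j))"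
    by (simp add: cmat_mult_component sum_distrib_right)
  also have "\<dots> = (\<Sum>i\<in>UNIV. \<Sum>k\<in>UNIV. \<Sum>j\<in>UNIV. A $ i $ k * B $ k $ j * cnj (C $ i $ j))"
    by (rule sum.cong[OF refl], rule sum.swap)
  also have "\<dots> = (\<Sum>k\<in>UNIV. \<Sum>i\<in>UNIV. \<Sum>j\<in>UNIV. A $ i $ k * B $ k $ j * cnj (C $ i $ j))"
    by (rule sum.swap)
  also have "\<dots> = (\<Sum>k\<in>UNIV. \<Sum>j\<in>UNIV. \<Sum>i\<in>UNIV. A $ i $ k * B $ k $ j * cnj (C $ i $ j))"
    by (rule sum.cong[OF refl], rule sum.swap)
  also have "\<dots> = (\<Sum>k\<in>UNIV. \<Sum>j\<in>UNIV. B $ k $ j * cnj ((cmat_adj A ** C) $ k $ j))"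
    by (simp add: cmat_mult_component sum_distrib_left mult_ac)
  finally show ?thesis by (simp add: inner_cmat)
qed

lemma inner_cmat_adj: "cmat_adj A \<bullet> cmat_adj B = A \<bullet> B" for A B :: "'n::finite cmat"
proof -
  have "cmat_adj A \<bullet> cmat_adj B = (\<Sum>i\<in>UNIV. \<Sum>j\<in>UNIV. A $ j $ i \<bullet> B $ j $ i)"
    by (simp add: inner_vec_def inner_complex_def)
  also have "\<dots> = (\<Sum>j\<in>UNIV. \<Sum>i\<in>UNIV. A $ j $ i \<bullet> B $ j $ i)"
    by (rule sum.swap)
  finally show ?thesis by (simp add: inner_vec_def)
qed

lemma inner_cmat_mult_right: "(A ** B) \<bullet> C = A \<bullet> (C ** cmat_adj B)" for A B C :: "'n::finite cmat"
proof -
  have "(A ** B) \<bullet> C = (cmat_adj B ** cmat_adj A) \<bullet> cmat_adj C"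
    by (metis cmat_adj_mult inner_cmat_adj)
  also have "\<dots> = cmat_adj A \<bullet> (B ** cmat_adj C)"
    by (simp add: inner_cmat_mult_left)
  also have "\<dots> = A \<bullet> (C ** cmat_adj B)"
    by (metis cmat_adj_adj cmat_adj_mult inner_cmat_adj)
  finally show ?thesis .
qed

text \<open>Multiplication by i exchanges Hermitian and skew-Hermitian matrices; equations mixing
  the two kinds are later split by taking adjoints.\<close>

lemma hermitian_smult_i: "cmat_adj (cmat_smult \<i> A) = - cmat_smult \<i> A \<longleftrightarrow> hermitian A"
proof -
  have "cmat_adj (cmat_smult \<i> A) = - cmat_smult \<i> (cmat_adj A)"
    by (simp add: vec_eq_iff)
  moreover have "cmat_smult \<i> (cmat_adj A) = cmat_smult \<i> A \<longleftrightarrow> cmat_adj A = A"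
    by (simp add: vec_eq_iff)
  ultimately show ?thesis by (simp add: hermitian_def)
qed

lemma subspace_hermitian: "subspace {A :: 'n::finite cmat. hermitian A}"
  by (auto simp: subspace_def hermitian_def cmat_adj_simps)

subsection \<open>The unitary group\<close>

lemma unitary_iff: "U \<in> unitary_group \<longleftrightarrow> U ** cmat_adj U = mat 1"
  by (simp add: unitary_group_def)

lemma unitary_adj_mult: "U \<in> unitary_group \<Longrightarrow> U ** cmat_adj U = mat 1"
  by (simp add: unitary_group_def)

lemma unitary_mult_adj: "U \<in> unitary_group \<Longrightarrow> cmat_adj U ** U = mat 1"
  using matrix_left_right_inverse[of U "cmat_adj U"] by (simp add: unitary_group_def)

lemmas unitary_inverses [simp] = unitary_adj_mult unitary_mult_adj

lemma unitary_adj [intro]: "U \<in> unitary_group \<Longrightarrow> cmat_adj U \<in> unitary_group"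
  unfolding unitary_iff[of "cmat_adj U"] by simp

lemma unitary_cancel [simp]:
  assumes "U \<in> unitary_group"
  shows "U ** (cmat_adj U ** A) = A" "cmat_adj U ** (U ** A) = A"
    "A ** U ** cmat_adj U = A" "A ** cmat_adj U ** U = A"
proof -
  show "U ** (cmat_adj U ** A) = A" "cmat_adj U ** (U ** A) = A"
    unfolding matrix_mul_assoc using assms by simp_all
  show "A ** U ** cmat_adj U = A" "A ** cmat_adj U ** U = A"
    unfolding matrix_mul_assoc[symmetric] using assms by simp_all
qed

lemma unitary_mult [intro]:
  assumes "U \<in> unitary_group" "V \<in> unitary_group"
  shows "U ** V \<in> unitary_group"
  unfolding unitary_iff[of "U ** V"] cmat_adj_mult matrix_mul_assoc using assms by simp

lemma unitary_mat_1 [simp, intro]: "mat 1 \<in> unitary_group"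
  by (simp only: unitary_iff cmat_adj_mat_1 matrix_mul_lid)

lemma closed_unitary_group: "closed (unitary_group :: 'n::finite cmat set)"
proof -
  have "unitary_group = (\<lambda>U :: 'n cmat. U ** cmat_adj U) -` {mat 1}"
    by (rule set_eqI) (simp only: vimage_eq singleton_iff unitary_iff)
  also have "closed \<dots>"
    by (intro continuous_closed_vimage closed_singleton)
       (auto intro!: continuous_intros cmat_mult.isCont isCont_cmat_adj)
  finally show ?thesis .
qed

lemma unitary_group_borel [measurable]: "unitary_group \<in> sets borel"
  by (simp add: closed_unitary_group borel_closed)

subsection \<open>The unitary evolution\<close>

lemma cmat_pow_smult: "cmat_pow (cmat_smult c A) k = cmat_smult (c ^ k) (cmat_pow A k)"
  by (induction k) (simp_all add: mult.commute)

text \<open>The sum of all entry moduli dominates every row sum, so each further factor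
  \<open>A\<close> costs at most this constant. The bound dominates the exponential series entry by
  entry.\<close>

lemma cmat_pow_bound:
  "norm (cmat_pow A k $ i $ j) \<le> (\<Sum>a\<in>UNIV. \<Sum>b\<in>UNIV. norm (A $ a $ b)) ^ k"
proof (induction k arbitrary: i j)
  case 0
  then show ?case by (simp add: mat_def)
next
  case (Suc k)
  let ?C = "\<Sum>a\<in>UNIV. \<Sum>b\<in>UNIV. norm (A $ a $ b)"
  have "norm (cmat_pow A (Suc k) $ i $ j) \<le> (\<Sum>l\<in>UNIV. norm (A $ i $ l) * norm (cmat_pow A k $ l $ j))"
    unfolding cmat_pow.simps cmat_mult_component by (rule order_trans[OF norm_sum]) (simp add: norm_mult)
  also have "\<dots> \<le> (\<Sum>l\<in>UNIV. norm (A $ i $ l) * ?C ^ k)"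
    by (intro sum_mono mult_left_mono Suc.IH) auto
  also have "\<dots> = (\<Sum>l\<in>UNIV. norm (A $ i $ l)) * ?C ^ k"
    by (simp add: sum_distrib_right)
  also have "\<dots> \<le> ?C * ?C ^ k"
    by (intro mult_right_mono zero_le_power sum_nonneg
        member_le_sum[of i UNIV "\<lambda>a. \<Sum>b\<in>UNIV. norm (A $ a $ b)"]) (auto intro: sum_nonneg)
  finally show ?case by simp
qed

lemma evol_entry_summable:
  "summable (\<lambda>k. cmat_pow A k $ i $ j / fact k * (z :: complex) ^ k)"
proof (rule summable_comparison_test')
  let ?C = "\<Sum>a\<in>UNIV. \<Sum>b\<in>UNIV. norm (A $ a $ b)"
  show "summable (\<lambda>k. (?C * norm z) ^ k /\<^sub>R fact k)"
    using summable_exp_generic[of "?C * norm z"] by simp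
  show "norm (cmat_pow A k $ i $ j / fact k * z ^ k) \<le> (?C * norm z) ^ k /\<^sub>R fact k" for k
    using mult_right_mono[OF cmat_pow_bound[of A k i j], of "norm z ^ k"]
    by (simp add: norm_mult norm_divide norm_power power_mult_distrib field_simps)
qed

text \<open>Read entrywise, the evolution is an everywhere convergent complex power series evaluated
  at a real time, which permits termwise differentiation.\<close>

lemma evol_component:
  "evol H t $ i $ j = (\<Sum>k. cmat_pow (cmat_smult (- \<i>) H) k $ i $ j / fact k * complex_of_real t ^ k)"
proof -
  let ?S = "\<chi> i j. \<Sum>k. cmat_pow (cmat_smult (- \<i>) H) k $ i $ j / fact k * complex_of_real t ^ k"
  have "(\<lambda>k. cmat_smult (1 / of_nat (fact k)) (cmat_pow (cmat_smult (- \<i> * complex_of_real t) H) k)) sums ?S"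
    unfolding sums_def
  proof (intro vec_tendstoI)
    fix i j
    have "cmat_smult (- \<i> * complex_of_real t) H = cmat_smult (complex_of_real t) (cmat_smult (- \<i>) H)"
      by (simp add: mult.commute)
    then have "(\<Sum>k<n. cmat_smult (1 / of_nat (fact k)) (cmat_pow (cmat_smult (- \<i> * complex_of_real t) H) k)) $ i $ j
       = (\<Sum>k<n. cmat_pow (cmat_smult (- \<i>) H) k $ i $ j / fact k * complex_of_real t ^ k)" for n
      by (simp only: cmat_pow_smult) (simp add: field_simps)
    then show "(\<lambda>n. (\<Sum>k<n. cmat_smult (1 / of_nat (fact k)) (cmat_pow (cmat_smult (- \<i> * complex_of_real t) H) k)) $ i $ j)
        \<longlonglongrightarrow> ?S $ i $ j"
      using summable_LIMSEQ[OF evol_entry_summable[of "cmat_smult (- \<i>) H" i j "complex_of_real t"]]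
      by simp
  qed
  then show ?thesis
    unfolding evol_def cmat_exp_def by (simp add: sums_unique[symmetric])
qed

lemma evol_0 [simp]: "evol H 0 = mat 1"
proof -
  have "evol H 0 $ i $ j = (mat 1 :: 'a cmat) $ i $ j" for i j
    unfolding evol_component of_real_0 by (subst powser_zero) simp
  then show ?thesis by (simp add: vec_eq_iff)
qed

text \<open>\<open>A\<close> commutes with every power of \<open>H\<close>, hence with the series.
  The case \<open>A\<close> = \<open>H\<close> serves the differential equation; a general
  \<open>A\<close> is needed for the commutant of both Hamiltonians.\<close>

lemma evol_commute_matrix:
  assumes "A ** H = H ** A"
  shows "A ** evol H t = evol H t ** A"
proof -
  let ?B = "cmat_smult (- \<i>) H"
  have comm: "A ** cmat_pow ?B k = cmat_pow ?B k ** A" for k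
  proof (induction k)
    case (Suc k)
    have "A ** cmat_pow ?B (Suc k) = cmat_smult (- \<i>) ((A ** H) ** cmat_pow ?B k)"
      by (simp add: matrix_mul_assoc)
    also have "\<dots> = cmat_smult (- \<i>) (H ** (A ** cmat_pow ?B k))"
      by (simp add: assms matrix_mul_assoc)
    also have "\<dots> = cmat_pow ?B (Suc k) ** A"
      by (simp add: Suc.IH matrix_mul_assoc)
    finally show ?case .
  qed simp
  have "(A ** evol H t) $ i $ j = (evol H t ** A) $ i $ j" for i j
  proof -
    let ?c = "\<lambda>a b k. cmat_pow ?B k $ a $ b / fact k * complex_of_real t ^ k"
    have "(A ** evol H t) $ i $ j = (\<Sum>l\<in>UNIV. A $ i $ l * (\<Sum>k. ?c l j k))"
      by (simp add: cmat_mult_component evol_component)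
    also have "\<dots> = (\<Sum>l\<in>UNIV. (\<Sum>k. A $ i $ l * ?c l j k))"
      by (intro sum.cong refl suminf_mult[symmetric] evol_entry_summable)
    also have "\<dots> = (\<Sum>k. \<Sum>l\<in>UNIV. A $ i $ l * ?c l j k)"
      by (intro suminf_sum[symmetric] summable_mult evol_entry_summable)
    also have "(\<lambda>k. \<Sum>l\<in>UNIV. A $ i $ l * ?c l j k) = (\<lambda>k. (A ** cmat_pow ?B k) $ i $ j / fact k * complex_of_real t ^ k)"
      by (simp add: cmat_mult_component sum_distrib_left sum_divide_distrib mult_ac)
    also have "\<dots> = (\<lambda>k. \<Sum>l\<in>UNIV. ?c i l k * A $ l $ j)"
      by (simp add: comm cmat_mult_component sum_distrib_left sum_divide_distrib mult_ac)
    also have "(\<Sum>k. \<Sum>l\<in>UNIV. ?c i l k * A $ l $ j) = (\<Sum>l\<in>UNIV. (\<Sum>k. ?c i l k * A $ l $ j))"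
      by (intro suminf_sum summable_mult2 evol_entry_summable)
    also have "\<dots> = (\<Sum>l\<in>UNIV. (\<Sum>k. ?c i l k) * A $ l $ j)"
      by (intro sum.cong refl suminf_mult2[symmetric] evol_entry_summable)
    also have "\<dots> = (evol H t ** A) $ i $ j"
      by (simp add: cmat_mult_component evol_component)
    finally show ?thesis .
  qed
  then show ?thesis by (simp add: vec_eq_iff)
qed

section \<open>Differential equation and group law of the evolution\<close>

lemma has_vector_derivative_vec:
  fixes f :: "real \<Rightarrow> 'a::real_normed_vector ^ 'n::finite"
  assumes "\<And>i. ((\<lambda>x. f x $ i) has_vector_derivative f' $ i) (at x)"
  shows "(f has_vector_derivative f') (at x)"
proof -
  have "((\<lambda>y. (1 / norm (y - x)) *\<^sub>R (f y - (f x + (y - x) *\<^sub>R f'))) \<longlongrightarrow> 0) (at x)"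
  proof (rule vec_tendstoI)
    fix i
    show "((\<lambda>y. ((1 / norm (y - x)) *\<^sub>R (f y - (f x + (y - x) *\<^sub>R f'))) $ i) \<longlongrightarrow> 0 $ i) (at x)"
      using assms[of i] by (simp add: has_vector_derivative_def has_derivative_within)
  qed
  then show ?thesis
    by (simp add: has_vector_derivative_def has_derivative_within bounded_linear_scaleR_left)
qed

lemma evol_has_vector_derivative:
  "(evol H has_vector_derivative cmat_smult (- \<i>) (H ** evol H t)) (at t)"
proof (intro has_vector_derivative_vec)
  fix i j
  let ?B = "cmat_smult (- \<i>) H"
  let ?c = "\<lambda>i j k. cmat_pow ?B k $ i $ j / fact k"
  have "((\<lambda>z. \<Sum>k. ?c i j k * z ^ k) has_field_derivative (\<Sum>k. diffs (?c i j) k * complex_of_real t ^ k)) (at (complex_of_real t))"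
    by (intro termdiffs_strong_converges_everywhere evol_entry_summable)
  moreover have "diffs (?c i j) k * complex_of_real t ^ k = (\<Sum>l\<in>UNIV. ?B $ i $ l * (?c l j k * complex_of_real t ^ k))" for k
    by (simp add: diffs_def cmat_mult_component sum_distrib_right sum_distrib_left sum_divide_distrib mult_ac sum_negf
        del: of_nat_Suc)
  moreover have "(\<Sum>k. \<Sum>l\<in>UNIV. ?B $ i $ l * (?c l j k * complex_of_real t ^ k)) = (?B ** evol H t) $ i $ j"
  proof -
    have "(\<Sum>k. \<Sum>l\<in>UNIV. ?B $ i $ l * (?c l j k * complex_of_real t ^ k)) = (\<Sum>l\<in>UNIV. \<Sum>k. ?B $ i $ l * (?c l j k * complex_of_real t ^ k))"
      by (intro suminf_sum summable_mult evol_entry_summable)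
    also have "\<dots> = (\<Sum>l\<in>UNIV. ?B $ i $ l * (\<Sum>k. ?c l j k * complex_of_real t ^ k))"
      by (intro sum.cong refl suminf_mult evol_entry_summable)
    finally show ?thesis by (simp only: cmat_mult_component evol_component)
  qed
  ultimately have "((\<lambda>z. \<Sum>k. ?c i j k * z ^ k) has_field_derivative (?B ** evol H t) $ i $ j) (at (complex_of_real t))"
    by simp
  from has_vector_derivative_real_field[OF this]
  show "((\<lambda>t. evol H t $ i $ j) has_vector_derivative cmat_smult (- \<i>) (H ** evol H t) $ i $ j) (at t)"
    by (simp add: evol_component o_def)
qed

lemma evol_has_vector_derivative':
  "(evol H has_vector_derivative cmat_smult (- \<i>) (evol H t ** H)) (at t)"
  using evol_has_vector_derivative[of H t] by (simp add: evol_commute_matrix[of H H])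

lemma const_of_vector_derivative_0:
  fixes g :: "real \<Rightarrow> 'a::real_normed_vector"
  assumes "\<And>t. (g has_vector_derivative 0) (at t)"
  shows "g s = g t"
  using has_derivative_zero_unique[of UNIV g] assms
  by (auto simp: has_vector_derivative_def)

text \<open>Both \<open>evol H t ** evol H (- t)\<close> and
  \<open>evol H (s + t) ** evol H (- s)\<close> have derivative 0, because \<open>H\<close> commutes
  with its evolution. The first is therefore the identity and the second equals
  \<open>evol H t\<close>; combining them gives the group law.\<close>

lemma evol_add: "evol H (s + t) = evol H s ** evol H t"
proof -
  have inv: "evol H t ** evol H (- t) = mat 1" for t
  proof -
    have "((\<lambda>t. evol H t ** evol H (- t)) has_vector_derivative 0) (at t)" for t
    proof -
      have "((\<lambda>t. evol H (- t)) has_vector_derivative (- cmat_smult (- \<i>) (evol H (- t) ** H))) (at t)"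
        using vector_diff_chain_at[of uminus "-1" t "evol H" "cmat_smult (- \<i>) (evol H (- t) ** H)"]
          evol_has_vector_derivative'[of H "- t"]
        by (simp add: o_def has_vector_derivative_minus)
      from cmat_mult.has_vector_derivative[OF evol_has_vector_derivative'[of H t] this]
      show ?thesis
        by (simp add: cmat_mult.minus_right evol_commute_matrix[of H H] flip: matrix_mul_assoc)
    qed
    from const_of_vector_derivative_0[OF this, of t 0] show ?thesis by simp
  qed
  have "((\<lambda>s. evol H (s + t) ** evol H (- s)) has_vector_derivative 0) (at s)" for s
  proof -
    have 1: "((\<lambda>s. evol H (- s)) has_vector_derivative (- cmat_smult (- \<i>) (evol H (- s) ** H))) (at s)"
      using vector_diff_chain_at[of uminus "-1" s "evol H" "cmat_smult (- \<i>) (evol H (- s) ** H)"]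
        evol_has_vector_derivative'[of H "- s"]
      by (simp add: o_def has_vector_derivative_minus)
    have 2: "((\<lambda>s. evol H (s + t)) has_vector_derivative cmat_smult (- \<i>) (evol H (s + t) ** H)) (at s)"
      using vector_diff_chain_at[of "\<lambda>s. s + t" 1 s "evol H" "cmat_smult (- \<i>) (evol H (s + t) ** H)"]
        evol_has_vector_derivative'[of H "s + t"]
      by (simp add: o_def has_vector_derivative_add_const)
    from cmat_mult.has_vector_derivative[OF 2 1]
    show ?thesis
      by (simp add: cmat_mult.minus_right evol_commute_matrix[of H H] flip: matrix_mul_assoc)
  qed
  from const_of_vector_derivative_0[OF this, of s 0]
  have "evol H (s + t) ** evol H (- s) ** evol H s = evol H t ** evol H s" by simp
  moreover have "evol H (- s) ** evol H s = mat 1" using inv[of "- s"] by simp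
  ultimately have "evol H (s + t) = evol H t ** evol H s"
    by (simp flip: matrix_mul_assoc)
  moreover have "evol H t ** evol H s = evol H s ** evol H t"
    by (intro evol_commute_matrix[symmetric] evol_commute_matrix) simp
  ultimately show ?thesis by simp
qed

lemma isCont_evol [continuous_intros]: "isCont (evol H) t"
  using evol_has_vector_derivative has_vector_derivative_continuous by blast

lemma tendsto_evol [tendsto_intros]: "(f \<longlongrightarrow> t) F \<Longrightarrow> ((\<lambda>x. evol H (f x)) \<longlongrightarrow> evol H t) F"
  using isCont_tendsto_compose[OF isCont_evol] by blast

text \<open>For Hermitian \<open>H\<close> the two terms in the derivative of E E* cancel, so E E*
  keeps its value at time 0.\<close>

lemma evol_unitary [simp, intro]:
  assumes "hermitian H"
  shows "evol H t \<in> unitary_group"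
proof -
  have "((\<lambda>t. evol H t ** cmat_adj (evol H t)) has_vector_derivative 0) (at t)" for t
  proof -
    have "((\<lambda>t. cmat_adj (evol H t)) has_vector_derivative cmat_adj (cmat_smult (- \<i>) (evol H t ** H))) (at t)"
      by (intro bounded_linear.has_vector_derivative[OF bounded_linear_cmat_adj] evol_has_vector_derivative')
    also have "cmat_adj (cmat_smult (- \<i>) (evol H t ** H)) = - cmat_smult (- \<i>) (H ** cmat_adj (evol H t))"
    proof -
      have "cmat_smult (cnj (- \<i>)) A = - cmat_smult (- \<i>) A" for A :: "'a cmat"
        by (simp add: vec_eq_iff)
      then show ?thesis
        using assms by (simp only: cmat_adj_smult cmat_adj_mult hermitian_def)
    qed
    finally show ?thesis
      using cmat_mult.has_vector_derivative[OF evol_has_vector_derivative'[of H t]]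
      by (fastforce simp: cmat_mult.minus_right matrix_mul_assoc)
  qed
  from const_of_vector_derivative_0[OF this, of t 0] show ?thesis
    by (simp add: unitary_iff)
qed

section \<open>Products of evolutions\<close>

definition ham :: "'n::finite cmat \<Rightarrow> 'n cmat \<Rightarrow> nat \<Rightarrow> 'n cmat" where
  "ham H1 H2 j = (if odd j then H1 else H2)"

text \<open>Up to the factor -i, the partial derivative of \<open>Jprod\<close> in slot j is this
  matrix times \<open>Jprod\<close>: the Hamiltonian of slot j conjugated by all evolutions in later
  slots. The adjoint stands for the inverse.\<close>

fun generator :: "'n::finite cmat \<Rightarrow> 'n cmat \<Rightarrow> nat \<Rightarrow> (nat \<Rightarrow> real) \<Rightarrow> nat \<Rightarrow> 'n cmat" where
  "generator H1 H2 0 s j = 0"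
| "generator H1 H2 (Suc m) s j =
     (if j = Suc m then ham H1 H2 j
      else evol (ham H1 H2 (Suc m)) (s (Suc m)) ** generator H1 H2 m s j **
           cmat_adj (evol (ham H1 H2 (Suc m)) (s (Suc m))))"

lemma Jprod_Suc: "Jprod H1 H2 (Suc m) s = evol (ham H1 H2 (Suc m)) (s (Suc m)) ** Jprod H1 H2 m s"
  by (simp add: ham_def)

declare Jprod.simps(2) [simp del] Jprod_Suc [simp]

lemma Jprod_cong: "(\<And>j. j \<in> {1..L} \<Longrightarrow> s j = t j) \<Longrightarrow> Jprod H1 H2 L s = Jprod H1 H2 L t"
  by (induction L) auto

lemma generator_cong:
  "(\<And>j. j \<in> {1..L} \<Longrightarrow> s j = t j) \<Longrightarrow> generator H1 H2 L s i = generator H1 H2 L t i"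
  by (induction L) auto

lemma hermitian_ham: "hermitian H1 \<Longrightarrow> hermitian H2 \<Longrightarrow> hermitian (ham H1 H2 j)"
  by (simp add: ham_def)

lemma Jprod_unitary [simp, intro]:
  "hermitian H1 \<Longrightarrow> hermitian H2 \<Longrightarrow> Jprod H1 H2 L s \<in> unitary_group"
  by (induction L) (auto simp: hermitian_ham)

lemma hermitian_conj: "hermitian A \<Longrightarrow> hermitian (U ** A ** cmat_adj U)"
  by (simp add: hermitian_def cmat_adj_mult matrix_mul_assoc)

lemma hermitian_0 [simp]: "hermitian 0"
  by (simp add: hermitian_def cmat_adj_simps)

lemma hermitian_generator: "hermitian H1 \<Longrightarrow> hermitian H2 \<Longrightarrow> hermitian (generator H1 H2 L s j)"
  by (induction L) (auto simp: hermitian_ham intro: hermitian_conj)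

lemma tendsto_Jprod:
  assumes "\<And>j. j \<in> {1..L} \<Longrightarrow> ((\<lambda>x. s x j) \<longlongrightarrow> t j) F"
  shows "((\<lambda>x. Jprod H1 H2 L (s x)) \<longlongrightarrow> Jprod H1 H2 L t) F"
  using assms by (induction L) (auto intro!: tendsto_intros cmat_mult.tendsto)

lemma tendsto_generator:
  assumes "\<And>j. j \<in> {1..L} \<Longrightarrow> ((\<lambda>x. s x j) \<longlongrightarrow> t j) F"
  shows "((\<lambda>x. generator H1 H2 L (s x) i) \<longlongrightarrow> generator H1 H2 L t i) F"
  using assms
  by (induction L) (auto intro!: tendsto_intros cmat_mult.tendsto bounded_linear.tendsto[OF bounded_linear_cmat_adj])

text \<open>By the product rule, -i times the Hamiltonian of slot j appears between the later and
  the earlier factors; since the later factors are unitary, it can be moved to the far left as a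
  conjugate. The times may depend on a point of any normed space, so that a chart can be
  substituted.\<close>

lemma has_derivative_Jprod:
  fixes s :: "'x::real_normed_vector \<Rightarrow> nat \<Rightarrow> real"
  assumes herm: "hermitian H1" "hermitian H2"
    and "\<And>j. j \<in> {1..L} \<Longrightarrow> ((\<lambda>x. s x j) has_derivative s' j) (at x)"
  shows "((\<lambda>x. Jprod H1 H2 L (s x)) has_derivative
     (\<lambda>h. cmat_smult (- \<i>) (\<Sum>j=1..L. s' j h *\<^sub>R generator H1 H2 L (s x) j) ** Jprod H1 H2 L (s x))) (at x)"
  using assms(3)
proof (induction L)
  case 0
  then show ?case by (simp add: cmat_smult_simps cmat_mult.zero_left)
next
  case (Suc m)
  let ?H = "ham H1 H2 (Suc m)" and ?E = "evol (ham H1 H2 (Suc m)) (s x (Suc m))"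
  let ?J = "Jprod H1 H2 m (s x)" and ?S = "\<lambda>h. \<Sum>j=1..m. s' j h *\<^sub>R generator H1 H2 m (s x) j"
  have IH: "((\<lambda>x. Jprod H1 H2 m (s x)) has_derivative (\<lambda>h. cmat_smult (- \<i>) (?S h) ** ?J)) (at x)"
    by (rule Suc.IH) (auto intro: Suc.prems)
  have U: "?E \<in> unitary_group" by (simp add: herm hermitian_ham)
  have "((\<lambda>x. evol ?H (s x (Suc m))) has_derivative (\<lambda>h. s' (Suc m) h *\<^sub>R cmat_smult (- \<i>) (?H ** ?E))) (at x)"
    using has_derivative_compose[OF Suc.prems[of "Suc m"], of "evol ?H" "\<lambda>h. h *\<^sub>R cmat_smult (- \<i>) (?H ** ?E)"]
      evol_has_vector_derivative[of ?H "s x (Suc m)"]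
    by (simp add: has_vector_derivative_def)
  from cmat_mult.FDERIV[OF this IH]
  have D: "((\<lambda>x. Jprod H1 H2 (Suc m) (s x)) has_derivative
      (\<lambda>h. ?E ** (cmat_smult (- \<i>) (?S h) ** ?J) + (s' (Suc m) h *\<^sub>R cmat_smult (- \<i>) (?H ** ?E)) ** ?J)) (at x)"
    by simp
  have "(\<Sum>j=1..Suc m. s' j h *\<^sub>R generator H1 H2 (Suc m) (s x) j) = ?E ** ?S h ** cmat_adj ?E + s' (Suc m) h *\<^sub>R ?H" for h
  proof -
    have "(\<Sum>j=1..m. s' j h *\<^sub>R generator H1 H2 (Suc m) (s x) j) = ?E ** ?S h ** cmat_adj ?E"
      by (simp add: cmat_mult.sum_left cmat_mult.sum_right cmat_mult.scaleR_left cmat_mult.scaleR_right)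
    then show ?thesis by simp
  qed
  then have "cmat_smult (- \<i>) (\<Sum>j=1..Suc m. s' j h *\<^sub>R generator H1 H2 (Suc m) (s x) j) ** Jprod H1 H2 (Suc m) (s x)
     = ?E ** (cmat_smult (- \<i>) (?S h) ** ?J) + (s' (Suc m) h *\<^sub>R cmat_smult (- \<i>) (?H ** ?E)) ** ?J" for h
    using U
    by (simp add: cmat_smult_simps cmat_mult.add_left cmat_mult.scaleR_left matrix_mul_assoc)
  then show ?case using D by simp
qed

text \<open>Evenness of \<open>a\<close> makes slot \<open>a + j\<close> carry the same Hamiltonian
  as slot j.\<close>

lemma Jprod_append:
  assumes "even a"
  shows "Jprod H1 H2 (a + b) s = Jprod H1 H2 b (\<lambda>j. s (a + j)) ** Jprod H1 H2 a s"
  using assms by (induction b) (auto simp: ham_def matrix_mul_assoc)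

lemma generator_eq_0: "j > L \<Longrightarrow> generator H1 H2 L s j = 0"
  by (induction L) (auto simp: cmat_mult.zero_left cmat_mult.zero_right)

text \<open>Appending a block conjugates the earlier generators by the product over that block,
  while the generators inside the block are those of the block alone. This is how a prescribed
  conjugate is produced.\<close>

lemma generator_append:
  assumes "even a" "hermitian H1" "hermitian H2"
  shows "j \<le> a \<Longrightarrow> generator H1 H2 (a + b) s j =
      Jprod H1 H2 b (\<lambda>j. s (a + j)) ** generator H1 H2 a s j ** cmat_adj (Jprod H1 H2 b (\<lambda>j. s (a + j)))"
    and "j > a \<Longrightarrow> generator H1 H2 (a + b) s j = generator H1 H2 b (\<lambda>j. s (a + j)) (j - a)"
  using assms by (induction b) (auto simp: ham_def matrix_mul_assoc cmat_adj_mult generator_eq_0)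

lemma Jprod_pad:
  assumes "\<And>j. j > n \<Longrightarrow> s j = 0"
  shows "Jprod H1 H2 (n + k) s = Jprod H1 H2 n s"
  using assms by (induction k) auto

lemma U_controllable_even:
  assumes "U_controllable H1 H2"
  obtains m where "m > 0" "\<And>U. U \<in> unitary_group \<Longrightarrow> \<exists>s. (\<forall>j. s j \<ge> 0) \<and> Jprod H1 H2 (2 * m) s = U"
proof -
  obtain n where n: "{Jprod H1 H2 n s | s. \<forall>j\<in>{1..n}. s j \<ge> 0} = unitary_group"
    using assms by (auto simp: U_controllable_def)
  have "\<exists>s. (\<forall>j. s j \<ge> 0) \<and> Jprod H1 H2 (2 * Suc n) s = U" if U: "U \<in> unitary_group" for U
  proof -
    obtain s where s: "U = Jprod H1 H2 n s" "\<forall>j\<in>{1..n}. s j \<ge> 0"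
      using U unfolding n[symmetric] by blast
    let ?s = "\<lambda>j. if j \<in> {1..n} then s j else 0"
    \<comment> \<open>Zero times contribute the identity; the length n + (n + 2) is even, and
      positive also for n = 0.\<close>
    have "Jprod H1 H2 (n + (n + 2)) ?s = Jprod H1 H2 n ?s" by (rule Jprod_pad) auto
    also have "\<dots> = U" unfolding s by (rule Jprod_cong) auto
    finally show ?thesis using s by (intro exI[of _ ?s]) (auto simp: mult_2)
  qed
  then show ?thesis using that by blast
qed

section \<open>Conjugates of the Hamiltonians span the Hermitian matrices\<close>

text \<open>Jacobi's formula at the identity. A permutation other than \<open>id\<close> moves at
  least two points, so after differentiating one factor an off-diagonal zero of the identity
  remains; only the diagonal term survives.\<close>

lemma det_has_vector_derivative_mat_1:
  fixes f :: "real \<Rightarrow> 'n::finite cmat"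
  assumes "(f has_vector_derivative f') (at 0)" "f 0 = mat 1"
  shows "((\<lambda>t. det (f t)) has_vector_derivative trace f') (at 0)"
proof -
  let ?P = "{p. p permutes (UNIV :: 'n set)}"
  have ent: "((\<lambda>t. f t $ i $ j) has_derivative (\<lambda>h. h *\<^sub>R f' $ i $ j)) (at 0)" for i j
    using bounded_linear.has_vector_derivative[OF bounded_linear_vec_nth
        bounded_linear.has_vector_derivative[OF bounded_linear_vec_nth assms(1), of i], of j]
    by (simp add: has_vector_derivative_def)
  let ?D = "\<lambda>h. \<Sum>p\<in>?P. of_int (sign p) * (\<Sum>i\<in>UNIV. h *\<^sub>R f' $ i $ p i * (\<Prod>j\<in>UNIV - {i}. f 0 $ j $ p j))"
  have "((\<lambda>t. det (f t)) has_derivative ?D) (at 0)"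
    unfolding det_def
    by (intro has_derivative_sum has_derivative_mult_right has_derivative_prod ent)
  also have "?D = (\<lambda>h. h *\<^sub>R trace f')"
  proof
    fix h
    have other: "(\<Sum>i\<in>UNIV. h *\<^sub>R f' $ i $ p i * (\<Prod>j\<in>UNIV - {i}. f 0 $ j $ p j)) = 0"
      if p: "p \<in> ?P" "p \<noteq> id" for p
    proof (intro sum.neutral ballI)
      fix i
      obtain k where k: "p k \<noteq> k" using p by (auto simp: fun_eq_iff)
      have inj: "inj p" using p permutes_inj by auto
      have "\<exists>j. j \<noteq> i \<and> p j \<noteq> j"
      proof (cases "k = i")
        case True
        then show ?thesis using k inj by (intro exI[of _ "p k"]) (auto dest: injD)
      qed (use k in auto)
      then obtain j where "j \<noteq> i" "p j \<noteq> j" by blast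
      then have "(\<Prod>j\<in>UNIV - {i}. f 0 $ j $ p j) = 0"
        by (intro prod_zero bexI[of _ j]) (auto simp: assms(2) mat_def)
      then show "h *\<^sub>R f' $ i $ p i * (\<Prod>j\<in>UNIV - {i}. f 0 $ j $ p j) = 0" by simp
    qed
    have "?D h = (\<Sum>p\<in>{id}. of_int (sign p) * (\<Sum>i\<in>UNIV. h *\<^sub>R f' $ i $ p i * (\<Prod>j\<in>UNIV - {i}. f 0 $ j $ p j)))"
      by (rule sum.mono_neutral_right) (simp, simp add: permutes_id, use other in simp)
    also have "\<dots> = h *\<^sub>R trace f'"
      by (simp add: assms(2) mat_def trace_def scaleR_sum_right sign_id)
    finally show "?D h = h *\<^sub>R trace f'" .
  qed
  finally show ?thesis by (simp add: has_vector_derivative_def)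
qed

text \<open>The derivative of the determinant vanishes at time 0; the group law and multiplicativity
  of \<open>det\<close> transport this to every time.\<close>

lemma det_evol_traceless:
  fixes H :: "'n::finite cmat"
  assumes "trace H = 0"
  shows "det (evol H t) = 1"
proof -
  have tr: "trace (cmat_smult (- \<i>) (H ** evol H 0)) = 0"
    using assms by (simp add: trace_def sum_negf flip: sum_distrib_left)
  have 0: "((\<lambda>t. det (evol H t)) has_vector_derivative 0) (at 0)"
    using det_has_vector_derivative_mat_1[OF evol_has_vector_derivative[of H 0]] unfolding tr by simp
  have "((\<lambda>t. det (evol H t)) has_vector_derivative 0) (at t)" for t
  proof -
    have "((\<lambda>s. det (evol H (s - t))) has_vector_derivative 0) (at t)"
      using vector_diff_chain_at[of "\<lambda>s. s - t" 1 t "\<lambda>t. det (evol H t)" 0] 0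
      by (simp add: o_def has_vector_derivative_diff_const)
    then have "((\<lambda>s. det (evol H (s - t)) * det (evol H t)) has_vector_derivative 0 * det (evol H t)) (at t)"
      by (intro has_vector_derivative_mult_left)
    moreover have "det (evol H (s - t)) * det (evol H t) = det (evol H s)" for s
      using evol_add[of H "s - t" t] by (simp add: det_mul)
    ultimately show ?thesis by simp
  qed
  from const_of_vector_derivative_0[OF this, of t 0] show ?thesis by simp
qed

section \<open>Commutants\<close>

lemma hermitian_decomposition:
  fixes A :: "'n::finite cmat"
  obtains X Y where "hermitian X" "hermitian Y" "A = X + cmat_smult \<i> Y"
proof
  show "hermitian (cmat_smult (1/2) (A + cmat_adj A))" "hermitian (cmat_smult (- \<i>/2) (A - cmat_adj A))"
    by (simp_all add: hermitian_def vec_eq_iff field_simps)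
  show "A = cmat_smult (1/2) (A + cmat_adj A) + cmat_smult \<i> (cmat_smult (- \<i>/2) (A - cmat_adj A))"
    by (simp add: vec_eq_iff field_simps)
qed

text \<open>Commutation with the matrix units ?E forces the off-diagonal entries to vanish and the
  diagonal entries to agree.\<close>

lemma commute_all_imp_scalar:
  fixes X :: "'n::finite cmat"
  assumes "\<And>A. A ** X = X ** A"
  obtains c where "X = mat c"
proof -
  have comm: "(if a = i then X $ j $ b else 0) = (if b = j then X $ a $ i else 0)" for i j a b
  proof -
    let ?E = "(\<chi> k l. if k = i \<and> l = j then 1 else 0) :: 'n cmat"
    have "(?E ** X) $ a $ b = (if a = i then X $ j $ b else 0)"
      by (simp add: cmat_mult_component if_distrib[of "\<lambda>x. x * _"] if_distribR cong: if_cong)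
    moreover have "(X ** ?E) $ a $ b = (if b = j then X $ a $ i else 0)"
      by (simp add: cmat_mult_component if_distrib[of "\<lambda>x. _ * x"] cong: if_cong)
    ultimately show ?thesis using assms[of ?E] by simp
  qed
  obtain i0 :: 'n where True by simp
  have "X = mat (X $ i0 $ i0)"
    unfolding vec_eq_iff
  proof (intro allI)
    fix i j
    show "X $ i $ j = mat (X $ i0 $ i0) $ i $ j"
      using comm[of i i i0 i0] comm[of i i i j] comm[of i i0 i i0] comm[of i0 i i0 i] comm[of i0 i0 i j] comm[of i0 i0 i i]
        comm[of i i0 i0 i] comm[of i0 i i i0] comm[of j i j i]  comm[of i i j i] comm[of j j i j]
      by (auto simp: mat_def split: if_splits)
  qed
  then show ?thesis using that by blast
qed

text \<open>Differentiating the commutation with \<open>evol Y t\<close> at 0 gives commutation with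
  every Hermitian \<open>Y\<close>, hence with all matrices, which are combinations Y + i Z of
  Hermitian ones.\<close>

lemma commute_unitary_imp_scalar:
  fixes X :: "'n::finite cmat"
  assumes "\<And>U. U \<in> unitary_group \<Longrightarrow> U ** X = X ** U"
  obtains c where "X = mat c"
proof -
  have herm: "Y ** X = X ** Y" if "hermitian Y" for Y
  proof -
    have "((\<lambda>t. evol Y t ** X) has_vector_derivative cmat_smult (- \<i>) (Y ** evol Y 0) ** X) (at 0)"
      by (intro bounded_linear.has_vector_derivative[OF cmat_mult.bounded_linear_left] evol_has_vector_derivative)
    moreover have "((\<lambda>t. X ** evol Y t) has_vector_derivative X ** cmat_smult (- \<i>) (Y ** evol Y 0)) (at 0)"
      by (intro bounded_linear.has_vector_derivative[OF cmat_mult.bounded_linear_right] evol_has_vector_derivative)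
    moreover have "(\<lambda>t. evol Y t ** X) = (\<lambda>t. X ** evol Y t)"
      using that assms by auto
    ultimately have "cmat_smult (- \<i>) (Y ** evol Y 0) ** X = X ** cmat_smult (- \<i>) (Y ** evol Y 0)"
      using vector_derivative_unique_at by metis
    then show ?thesis by (simp add: vec_eq_iff)
  qed
  have "A ** X = X ** A" for A
  proof -
    obtain Y Z where "hermitian Y" "hermitian Z" "A = Y + cmat_smult \<i> Z"
      by (rule hermitian_decomposition)
    then show ?thesis by (simp add: herm cmat_mult.add_left cmat_mult.add_right)
  qed
  then show ?thesis using that commute_all_imp_scalar by blast
qed

text \<open>The commutator W = HX - XH is skew-Hermitian, so Y = iW is Hermitian and its evolution
  is exp(tW). Orthogonality along these conjugates of H, differentiated at 0, gives X \<bullet> (WH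
  - HW) = 0; the left side equals -(W \<bullet> W), so W = 0.\<close>

lemma orthogonal_conjugates_commute:
  fixes X H :: "'n::finite cmat"
  assumes X: "hermitian X" and H: "hermitian H"
    and orth: "\<And>U. U \<in> unitary_group \<Longrightarrow> X \<bullet> (U ** H ** cmat_adj U) = 0"
  shows "X ** H = H ** X"
proof -
  define W where "W = H ** X - X ** H"
  define Y where "Y = cmat_smult \<i> W"
  have adjW: "cmat_adj W = - W"
    using X H by (simp add: W_def hermitian_def cmat_adj_simps cmat_adj_mult)
  have Y: "hermitian Y"
    by (simp add: hermitian_def Y_def cmat_adj_smult adjW) (simp add: vec_eq_iff)
  have E: "((\<lambda>t. evol Y t) has_vector_derivative W) (at 0)"
    using evol_has_vector_derivative[of Y 0] by (simp add: Y_def)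
  have "((\<lambda>t. evol Y t ** H ** cmat_adj (evol Y t)) has_vector_derivative
      evol Y 0 ** H ** cmat_adj W + W ** H ** cmat_adj (evol Y 0)) (at 0)"
    by (intro cmat_mult.has_vector_derivative bounded_linear.has_vector_derivative[OF bounded_linear_cmat_adj] E
        bounded_linear.has_vector_derivative[OF cmat_mult.bounded_linear_left])
  then have "((\<lambda>t. X \<bullet> (evol Y t ** H ** cmat_adj (evol Y t))) has_vector_derivative X \<bullet> (W ** H - H ** W)) (at 0)"
    using bounded_linear.has_vector_derivative[OF bounded_linear_inner_right, of _ _ _ X]
    by (fastforce simp: adjW cmat_mult.minus_right)
  moreover have "(\<lambda>t. X \<bullet> (evol Y t ** H ** cmat_adj (evol Y t))) = (\<lambda>t. 0)"
    using Y by (auto intro: orth)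
  ultimately have "X \<bullet> (W ** H - H ** W) = 0"
    using vector_derivative_unique_at[OF has_vector_derivative_const] by metis
  moreover have "(W ** H) \<bullet> X = W \<bullet> (X ** H)" "(H ** W) \<bullet> X = W \<bullet> (H ** X)"
    using inner_cmat_mult_right[of W H X] inner_cmat_mult_left[of H W X] H by (simp_all add: hermitian_def)
  ultimately have "W \<bullet> W = 0"
    by (simp add: W_def inner_commute[of X] inner_diff_left inner_diff_right)
  then show ?thesis by (simp add: W_def)
qed

lemma span_conjugates:
  fixes H1 H2 :: "'n::finite cmat"
  assumes herm: "hermitian H1" "hermitian H2" and ctrl: "U_controllable H1 H2"
  shows "span {U ** H ** cmat_adj U | U H. U \<in> unitary_group \<and> H \<in> {H1, H2}} = {X. hermitian X}"
    (is "span ?S = _")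
proof
  have "?S \<subseteq> {X. hermitian X}" using herm by (auto intro: hermitian_conj)
  then show sub: "span ?S \<subseteq> {X. hermitian X}" by (rule span_minimal) (rule subspace_hermitian)
  obtain m where m: "\<And>U. U \<in> unitary_group \<Longrightarrow> \<exists>s. (\<forall>j. s j \<ge> 0) \<and> Jprod H1 H2 (2 * m) s = U"
    using U_controllable_even[OF ctrl] by metis
  show "{X. hermitian X} \<subseteq> span ?S"
  proof
    fix X0 :: "'n cmat" assume "X0 \<in> {X. hermitian X}"
    then have X0: "hermitian X0" by simp
    \<comment> \<open>It remains to show that the component X orthogonal to the span
      vanishes.\<close>
    obtain y X where y: "y \<in> span ?S" and X: "\<And>w. w \<in> span ?S \<Longrightarrow> orthogonal X w" and eq: "X0 = y + X"
      by (rule orthogonal_subspace_decomp_exists[of ?S X0]) blast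
    have "X = X0 - y" by (simp add: eq)
    then have hX: "hermitian X"
      using X0 sub y subspace_diff[OF subspace_hermitian] by blast
    have orth: "X \<bullet> (U ** H ** cmat_adj U) = 0" if "U \<in> unitary_group" "H \<in> {H1, H2}" for U H
      using X[of "U ** H ** cmat_adj U"] that by (auto simp: orthogonal_def intro!: span_base)
    have "X ** H = H ** X" if "H \<in> {H1, H2}" for H
      using that herm by (intro orthogonal_conjugates_commute hX orth) auto
    then have "X ** Jprod H1 H2 k s = Jprod H1 H2 k s ** X" for k s
    proof (induction k)
      case (Suc k)
      have "X ** evol (ham H1 H2 (Suc k)) (s (Suc k)) = evol (ham H1 H2 (Suc k)) (s (Suc k)) ** X"
        by (rule evol_commute_matrix) (auto simp: ham_def Suc.prems)
      then show ?case using Suc.IH[OF Suc.prems]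
        by (simp add: matrix_mul_assoc) (simp flip: matrix_mul_assoc)
    qed simp
    then have "U ** X = X ** U" if "U \<in> unitary_group" for U
      using m[OF that] by metis
    then obtain c where c: "X = mat c"
      using commute_unitary_imp_scalar by blast
    have "X = 0"
    proof (rule ccontr)
      assume "X \<noteq> 0"
      then have c0: "c \<noteq> 0" by (auto simp: c vec_eq_iff mat_def)
      have cr: "cnj c = c" using hX by (auto simp: hermitian_def c vec_eq_iff mat_def split: if_splits)
      \<comment> \<open>X is c times the identity with c real, so orthogonality to H itself says Re
        c * Re (trace H) = 0, and a Hermitian matrix has a real trace.\<close>
      have tr: "trace H = 0" if "H \<in> {H1, H2}" for H
      proof -
        have "hermitian H" using that herm by auto
        then have real: "cnj (H $ i $ i) = H $ i $ i" for i
          by (metis cmat_adj_component hermitian_def)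
        have "0 = X \<bullet> H" using orth[of "mat 1" H] that by simp
        also have "\<dots> = Re (c * trace H)"
          by (simp add: inner_cmat c mat_def if_distrib[of "\<lambda>x. x * _"] sum.delta real trace_def sum_distrib_left
              del: Re_sum cong: if_cong)
        also have "\<dots> = Re c * Re (trace H)" using cr by (simp add: complex_eq_iff)
        finally have "Re (trace H) = 0" using c0 cr by (auto simp: complex_eq_iff)
        moreover have "cnj (trace H) = trace H" by (simp add: trace_def real)
        ultimately show ?thesis by (simp add: complex_eq_iff)
      qed
      have det1: "det (Jprod H1 H2 k s) = 1" for k s
        by (induction k) (auto simp: det_mul ham_def det_evol_traceless tr)
      obtain i0 :: 'n where True by simp
      \<comment> \<open>A diagonal sign matrix with a single entry -1 is unitary with determinant
        -1, so it is no product of factors of determinant 1.\<close>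
      let ?D = "(\<chi> i j. if i = j then if i = i0 then - 1 else 1 else 0) :: 'n cmat"
      have "?D \<in> unitary_group"
        unfolding unitary_iff[of ?D] by (auto simp: vec_eq_iff cmat_mult_component mat_def if_distrib[of "\<lambda>x. x * _"] sum.delta cong: if_cong)
      from m[OF this] obtain s where "?D = Jprod H1 H2 (2 * m) s" by metis
      then have "det ?D = 1" by (simp only: det1)
      moreover have "det ?D = (\<Prod>i\<in>UNIV. ?D $ i $ i)" by (rule det_diagonal) simp
      ultimately show False by (simp add: prod.delta)
    qed
    then show "X0 \<in> span ?S" using y eq by simp
  qed
qed

section \<open>A regular point of the product map\<close>

text \<open>All generators must occur in one sequence, but any block appended for a new one
  conjugates the old ones. The induction therefore prescribes the targets up to a common left factor
  V in U(N), chosen beforehand so as to cancel that conjugation.\<close>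

lemma realize_generators:
  fixes H1 H2 :: "'n::finite cmat"
  assumes herm: "hermitian H1" "hermitian H2" and ctrl: "U_controllable H1 H2"
    and "finite F" "F \<subseteq> unitary_group \<times> {H1, H2}"
  shows "\<exists>L s. even L \<and> (\<forall>j. s j \<ge> 0) \<and>
    (\<forall>(U, H)\<in>F. U ** H ** cmat_adj U \<in> generator H1 H2 L s ` {1..L})"
proof -
  obtain m where m: "\<And>U. U \<in> unitary_group \<Longrightarrow> \<exists>s. (\<forall>j. s j \<ge> 0) \<and> Jprod H1 H2 (2 * m) s = U"
    using U_controllable_even[OF ctrl] by metis
  have "\<forall>V\<in>unitary_group. \<exists>L s. even L \<and> (\<forall>j. s j \<ge> 0) \<and>
    (\<forall>(U, H)\<in>F. (V ** U) ** H ** cmat_adj (V ** U) \<in> generator H1 H2 L s ` {1..L})"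
    using assms(4,5)
  proof (induction F rule: finite_induct)
    case empty
    then show ?case by (auto intro!: exI[of _ 0] exI[of _ "\<lambda>_. 0"])
  next
    case (insert UH F)
    obtain U0 H0 where UH: "UH = (U0, H0)" "U0 \<in> unitary_group" "H0 \<in> {H1, H2}"
      using insert.prems by auto
    show ?case
    proof
      fix V :: "'n cmat" assume V: "V \<in> unitary_group"
      let ?W = "V ** U0"
      have W: "?W \<in> unitary_group" using V UH by blast
      have "cmat_adj ?W ** V \<in> unitary_group" using V W by blast
      then obtain L s where L: "even L" "\<forall>j. s j \<ge> 0"
        "\<forall>(U, H)\<in>F. (cmat_adj ?W ** V ** U) ** H ** cmat_adj (cmat_adj ?W ** V ** U) \<in> generator H1 H2 L s ` {1..L}"
        using insert.IH insert.prems by (meson insert_subset)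
      obtain t where t: "\<forall>j. t j \<ge> 0" "Jprod H1 H2 (2 * m) t = ?W" using m[OF W] by blast
      \<comment> \<open>The old sequence realizes the targets premultiplied by ?W* V. Two slots with
        time 0 follow, whose generators are H1 and H2 themselves; then a control sequence with
        product ?W. This tail turns H0 into its conjugate by ?W = V U0 and the old factors ?W* V U
        into V U.\<close>
      define s' where "s' j = (if j \<le> L then s j else if j \<le> L + 2 then 0 else t (j - (L + 2)))" for j
      have J: "Jprod H1 H2 (2 * m) (\<lambda>j. s' (L + 2 + j)) = ?W"
        unfolding t(2)[symmetric] by (rule Jprod_cong) (auto simp: s'_def)
      have conj: "generator H1 H2 (L + 2 + 2 * m) s' j = ?W ** generator H1 H2 (L + 2) s' j ** cmat_adj ?W"
        if "j \<le> L + 2" for j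
        using generator_append(1)[of "L + 2" H1 H2 j "2 * m" s'] that L(1) herm unfolding J by simp
      have old: "generator H1 H2 (L + 2) s' j = generator H1 H2 L s j" if "j \<le> L" for j
      proof -
        have "Jprod H1 H2 2 (\<lambda>j. s' (L + j)) = mat 1"
          by (simp add: numeral_2_eq_2 s'_def)
        moreover have "generator H1 H2 L s' j = generator H1 H2 L s j"
          by (rule generator_cong) (auto simp: s'_def)
        ultimately show ?thesis
          using generator_append(1)[of L H1 H2 j 2 s'] that L(1) herm by simp
      qed
      have new: "generator H1 H2 (L + 2) s' (L + 1) = H1" "generator H1 H2 (L + 2) s' (L + 2) = H2"
        using generator_append(2)[of L H1 H2 "L + 1" 2 s'] generator_append(2)[of L H1 H2 "L + 2" 2 s'] L(1) herm
        by (simp_all add: numeral_2_eq_2 ham_def s'_def)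
      have "(V ** U) ** H ** cmat_adj (V ** U) \<in> generator H1 H2 (L + 2 + 2 * m) s' ` {1..L + 2 + 2 * m}"
        if "(U, H) \<in> insert UH F" for U H
      proof (cases "(U, H) = UH")
        case True
        then have "(U, H) = (U0, H0)" using UH by simp
        moreover obtain i where i: "i \<in> {1, 2}" "generator H1 H2 (L + 2) s' (L + i) = H0"
          using new UH(3) by blast
        moreover have "generator H1 H2 (L + 2 + 2 * m) s' (L + i) = ?W ** H0 ** cmat_adj ?W"
          using conj[of "L + i"] i by fastforce
        moreover have "L + i \<in> {1..L + 2 + 2 * m}" using i(1) by auto
        ultimately show ?thesis by (metis Pair_inject rev_image_eqI)
      next
        case False
        then have "(U, H) \<in> F" using that by simp
        then obtain j where j: "j \<in> {1..L}"
          "(cmat_adj ?W ** V ** U) ** H ** cmat_adj (cmat_adj ?W ** V ** U) = generator H1 H2 L s j"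
          using L(3) by fast
        have "generator H1 H2 (L + 2 + 2 * m) s' j =
            ?W ** (cmat_adj ?W ** V ** U ** H ** cmat_adj (cmat_adj ?W ** V ** U)) ** cmat_adj ?W"
          using conj[of j] old[of j] j by auto
        also have "\<dots> = (?W ** (cmat_adj ?W ** V ** U)) ** H ** cmat_adj (?W ** (cmat_adj ?W ** V ** U))"
          by (simp only: cmat_adj_mult matrix_mul_assoc)
        also have "?W ** (cmat_adj ?W ** V ** U) = V ** U"
          using unitary_cancel(1)[OF W, of "V ** U"] by (simp add: matrix_mul_assoc)
        finally show ?thesis using j(1) by (intro rev_image_eqI[of j]) auto
      qed
      then show "\<exists>L s. even L \<and> (\<forall>j. s j \<ge> 0) \<and>
          (\<forall>(U, H)\<in>insert UH F. (V ** U) ** H ** cmat_adj (V ** U) \<in> generator H1 H2 L s ` {1..L})"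
        using L(1,2) t(1)
        by (intro exI[of _ "L + 2 + 2 * m"] exI[of _ s'] conjI) (simp, simp add: s'_def, blast)
    qed
  qed
  from bspec[OF this unitary_mat_1] show ?thesis by simp
qed

text \<open>Families rather than sets: generators in different slots could coincide, and over a
  finite index set this notion excludes such repetitions. The formulation by coefficients suits
  perturbation.\<close>

definition lin_indep_family :: "'i set \<Rightarrow> ('i \<Rightarrow> 'a::real_vector) \<Rightarrow> bool" where
  "lin_indep_family I g \<longleftrightarrow> (\<forall>a :: 'i \<Rightarrow> real. (\<Sum>i\<in>I. a i *\<^sub>R g i) = 0 \<longrightarrow> (\<forall>i\<in>I. a i = 0))"

lemma hermitian_sum_scaleR:
  assumes "\<And>i. i \<in> I \<Longrightarrow> hermitian (g i)"
  shows "hermitian (\<Sum>i\<in>I. a i *\<^sub>R g i)"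
proof -
  have "(\<Sum>i\<in>I. a i *\<^sub>R g i) \<in> {A. hermitian A}"
    by (intro subspace_sum subspace_scale subspace_hermitian) (use assms in auto)
  then show ?thesis by simp
qed

text \<open>With A and B Hermitian, the adjoint of iA + B = 0 is -iA + B = 0, so both vanish. Thus
  the family together with its multiples by i is independent over the reals.\<close>

lemma lin_indep_family_complexify:
  fixes g :: "'i \<Rightarrow> 'n::finite cmat"
  assumes ind: "lin_indep_family I g" and herm: "\<And>i. i \<in> I \<Longrightarrow> hermitian (g i)"
    and "(\<Sum>i\<in>I. a i *\<^sub>R cmat_smult \<i> (g i)) + (\<Sum>i\<in>I. b i *\<^sub>R g i) = 0" and "i \<in> I"
  shows "a i = 0 \<and> b i = 0"
proof -
  let ?A = "\<Sum>i\<in>I. a i *\<^sub>R g i" and ?B = "\<Sum>i\<in>I. b i *\<^sub>R g i"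
  have hA: "hermitian ?A" and hB: "hermitian ?B"
    using herm by (auto intro: hermitian_sum_scaleR)
  have eq: "cmat_smult \<i> ?A + ?B = 0"
    using assms(3) by (simp add: linear_sum[OF bounded_linear.linear[OF bounded_linear_cmat_smult]] cmat_smult_simps)
  then have "cmat_adj (cmat_smult \<i> ?A) + cmat_adj ?B = 0"
    by (metis cmat_adj_simps(1) cmat_adj_simps(3))
  then have "- cmat_smult \<i> ?A + ?B = 0"
    using hA[THEN hermitian_smult_i[THEN iffD2]] hB[unfolded hermitian_def] by (simp only:)
  with eq have "?B = 0" "cmat_smult \<i> ?A = 0"
    by (auto simp: vec_eq_iff add_eq_0_iff2)
  then have "?A = 0" by (simp add: vec_eq_iff)
  with \<open>?B = 0\<close> show ?thesis using ind \<open>i \<in> I\<close> by (auto simp: lin_indep_family_def)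
qed

text \<open>A basis of the Hermitian matrices consisting of conjugates is realized by generators of
  one sequence. Adjoining its multiples by i gives a real basis of all matrices;
  \<open>\<beta>\<close> records the resulting count, assigning two matrix coordinates to each
  selected slot.\<close>

lemma regular_point:
  fixes H1 H2 :: "'n::finite cmat"
  assumes herm: "hermitian H1" "hermitian H2" and ctrl: "U_controllable H1 H2"
  obtains L s I and \<beta> :: "nat \<times> bool \<Rightarrow> 'n cmat"
    where "even L" "\<And>j. s j \<ge> 0" "I \<subseteq> {1..L}" "lin_indep_family I (generator H1 H2 L s)"
      "bij_betw \<beta> (I \<times> UNIV) Basis"
proof -
  let ?S = "{U ** H ** cmat_adj U | U H. U \<in> unitary_group \<and> H \<in> {H1, H2}}"
  obtain B where B: "B \<subseteq> ?S" "independent B" "?S \<subseteq> span B"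
    using maximal_independent_subset[of ?S] by blast
  have spanB: "span B = {X. hermitian X}"
    using span_conjugates[OF assms] B by (metis (no_types, lifting) span_mono span_span subset_antisym)
  have finB: "finite B" using B(2) by (rule finiteI_independent)
  have "\<forall>b\<in>B. \<exists>UH\<in>unitary_group \<times> {H1, H2}. b = fst UH ** snd UH ** cmat_adj (fst UH)"
    using B(1) by fastforce
  then obtain uh where uh: "\<And>b. b \<in> B \<Longrightarrow> uh b \<in> unitary_group \<times> {H1, H2}"
    "\<And>b. b \<in> B \<Longrightarrow> b = fst (uh b) ** snd (uh b) ** cmat_adj (fst (uh b))" by metis
  obtain L s where L: "even L" "\<forall>j. s j \<ge> 0"
    "\<forall>(U, H)\<in>uh ` B. U ** H ** cmat_adj U \<in> generator H1 H2 L s ` {1..L}"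
    using realize_generators[OF assms, of "uh ` B"] finB uh(1) by blast
  let ?g = "generator H1 H2 L s"
  have "\<forall>b\<in>B. \<exists>j\<in>{1..L}. ?g j = b"
  proof
    fix b assume b: "b \<in> B"
    then have "fst (uh b) ** snd (uh b) ** cmat_adj (fst (uh b)) \<in> ?g ` {1..L}"
      using L(3) by (auto simp: case_prod_beta)
    then show "\<exists>j\<in>{1..L}. ?g j = b" using uh(2)[OF b] by auto
  qed
  then obtain \<phi> where \<phi>: "\<And>b. b \<in> B \<Longrightarrow> \<phi> b \<in> {1..L}" "\<And>b. b \<in> B \<Longrightarrow> ?g (\<phi> b) = b" by metis
  \<comment> \<open>One slot is chosen for each basis vector, so the generators are injective on
    \<open>I\<close>.\<close>
  define I where "I = \<phi> ` B"
  have inj: "inj_on ?g I" using \<phi>(2) by (auto simp: I_def inj_on_def)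
  have img: "?g ` I = B" using \<phi>(2) by (auto simp: I_def image_image)
  have finI: "finite I" using finB by (simp add: I_def)
  have fam: "lin_indep_family I ?g"
    unfolding lin_indep_family_def
  proof (intro allI impI ballI)
    fix a :: "nat \<Rightarrow> real" and i assume 0: "(\<Sum>i\<in>I. a i *\<^sub>R ?g i) = 0" and i: "i \<in> I"
    have "(\<Sum>b\<in>B. a (the_inv_into I ?g b) *\<^sub>R b) = (\<Sum>i\<in>I. a i *\<^sub>R ?g i)"
      unfolding img[symmetric] by (subst sum.reindex[OF inj]) (auto simp: the_inv_into_f_f[OF inj] intro!: sum.cong)
    then have "(\<Sum>b\<in>B. a (the_inv_into I ?g b) *\<^sub>R b) = 0" using 0 by simp
    from independentD[OF B(2) finB order_refl this, of "?g i"]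
    have "a (the_inv_into I ?g (?g i)) = 0" using i img by blast
    then show "a i = 0" by (simp add: the_inv_into_f_f[OF inj] i)
  qed
  let ?c = "\<lambda>(j, x). if x then cmat_smult \<i> (?g j) else ?g j"
  have key: "a (j, x) = 0" if "(\<Sum>jx\<in>I \<times> UNIV. a jx *\<^sub>R ?c jx) = 0" "j \<in> I" for a :: "nat \<times> bool \<Rightarrow> real" and j x
  proof -
    have "(\<Sum>jx\<in>I \<times> UNIV. a jx *\<^sub>R ?c jx) = (\<Sum>j\<in>I. \<Sum>x\<in>UNIV. a (j, x) *\<^sub>R ?c (j, x))"
      by (subst sum.cartesian_product) (auto intro!: sum.cong)
    also have "\<dots> = (\<Sum>j\<in>I. a (j, True) *\<^sub>R cmat_smult \<i> (?g j)) + (\<Sum>j\<in>I. a (j, False) *\<^sub>R ?g j)"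
      by (simp add: UNIV_bool sum.distrib add.commute)
    finally show ?thesis
      using lin_indep_family_complexify[OF fam hermitian_generator[OF herm], of "\<lambda>j. a (j, True)" "\<lambda>j. a (j, False)" j] that
      by (cases x) auto
  qed
  have injc: "inj_on ?c (I \<times> UNIV)"
  proof (rule inj_onI, rule ccontr)
    fix p q assume pq: "p \<in> I \<times> UNIV" "q \<in> I \<times> UNIV" "?c p = ?c q" "p \<noteq> q"
    let ?a = "\<lambda>r. if r = p then 1 else if r = q then - 1 else 0 :: real"
    have "(\<Sum>jx\<in>I \<times> UNIV. ?a jx *\<^sub>R ?c jx) = (\<Sum>jx\<in>{p, q}. ?a jx *\<^sub>R ?c jx)"
      using pq(1,2) finI by (intro sum.mono_neutral_right) auto
    also have "\<dots> = 0" using pq(3,4) by simp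
    finally have "?a p = 0" using key[of ?a "fst p" "snd p"] pq(1) by (simp add: mem_Times_iff)
    then show False by simp
  qed
  have indc: "independent (?c ` (I \<times> UNIV))"
  proof (rule independent_if_scalars_zero)
    show "finite (?c ` (I \<times> UNIV))" using finI by simp
    fix f x assume f: "(\<Sum>x\<in>?c ` (I \<times> UNIV). f x *\<^sub>R x) = 0" and "x \<in> ?c ` (I \<times> UNIV)"
    then obtain j y where x: "x = ?c (j, y)" "j \<in> I" by blast
    have "(\<Sum>jx\<in>I \<times> UNIV. f (?c jx) *\<^sub>R ?c jx) = 0"
      using f by (subst (asm) sum.reindex[OF injc]) (simp add: o_def)
    from key[OF this x(2), of y] show "f x = 0" unfolding x(1) by simp
  qed
  have "span (?c ` (I \<times> UNIV)) = UNIV"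
  proof -
    have "A \<in> span (?c ` (I \<times> UNIV))" for A :: "'n cmat"
    proof -
      obtain X Y where XY: "hermitian X" "hermitian Y" "A = X + cmat_smult \<i> Y"
        by (rule hermitian_decomposition)
      have lin: "linear (cmat_smult \<i> :: 'n cmat \<Rightarrow> 'n cmat)"
        by (rule bounded_linear.linear[OF bounded_linear_cmat_smult])
      have "X \<in> span B" "Y \<in> span B" using XY spanB by auto
      moreover have "B \<subseteq> ?c ` (I \<times> UNIV)"
        unfolding img[symmetric] by (auto intro!: rev_image_eqI[of "(_, False)"])
      moreover have "cmat_smult \<i> ` B \<subseteq> ?c ` (I \<times> UNIV)"
        unfolding img[symmetric] by (auto intro!: rev_image_eqI[of "(_, True)"])
      moreover have "cmat_smult \<i> Y \<in> span (cmat_smult \<i> ` B)"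
        using \<open>Y \<in> span B\<close> by (simp add: linear_span_image[OF lin])
      ultimately have "X \<in> span (?c ` (I \<times> UNIV))" "cmat_smult \<i> Y \<in> span (?c ` (I \<times> UNIV))"
        using span_mono by blast+
      then show ?thesis unfolding XY(3) by (rule span_add)
    qed
    then show ?thesis by auto
  qed
  then have "card (?c ` (I \<times> UNIV)) = card (Basis :: 'n cmat set)"
    using dim_eq_card[OF _ indc, of UNIV] by (simp add: dim_UNIV)
  then have "card (I \<times> (UNIV :: bool set)) = card (Basis :: 'n cmat set)"
    using card_image[OF injc] by simp
  then obtain \<beta> :: "nat \<times> bool \<Rightarrow> 'n cmat" where "bij_betw \<beta> (I \<times> UNIV) Basis"
    using finite_same_card_bij[of "I \<times> (UNIV :: bool set)" "Basis :: 'n cmat set"] finI by auto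
  moreover have "I \<subseteq> {1..L}" using \<phi>(1) by (auto simp: I_def simp del: atLeastAtMost_iff)
  ultimately show ?thesis using that L(1,2) fam by blast
qed

lemma inner_sum_Basis_reindex:
  fixes \<beta> :: "'i \<Rightarrow> 'a::euclidean_space"
  assumes \<beta>: "bij_betw \<beta> J Basis" and q: "q \<in> J"
  shows "(\<Sum>p\<in>J. a p *\<^sub>R \<beta> p) \<bullet> \<beta> q = a q"
proof -
  have fin: "finite J" using bij_betw_finite[OF \<beta>] by simp
  have "\<beta> p \<bullet> \<beta> q = (if p = q then 1 else 0)" if "p \<in> J" for p
    using bij_betw_apply[OF \<beta> that] bij_betw_apply[OF \<beta> q] inj_onD[OF bij_betw_imp_inj_on[OF \<beta>] _ that q]
    by (auto simp: inner_Basis)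
  then have "(\<Sum>p\<in>J. a p *\<^sub>R \<beta> p) \<bullet> \<beta> q = (\<Sum>p\<in>J. if p = q then a p else 0)"
    unfolding inner_sum_left by (intro sum.cong) auto
  then show ?thesis using q fin by simp
qed

text \<open>The map T below is an injective linear map on a finite-dimensional space, hence bounded
  below by some \<epsilon>; a perturbation of total size less than \<epsilon> cannot create a
  relation.\<close>

lemma lin_indep_family_open:
  fixes g :: "nat \<Rightarrow> 'n::finite cmat" and \<beta> :: "nat \<times> bool \<Rightarrow> 'n cmat"
  assumes ind: "lin_indep_family I g" and herm: "\<And>i. i \<in> I \<Longrightarrow> hermitian (g i)"
    and \<beta>: "bij_betw \<beta> (I \<times> UNIV) Basis" and "finite I"
  obtains \<epsilon> where "\<epsilon> > 0" "\<And>g'. (\<Sum>i\<in>I. norm (g' i - g i)) < \<epsilon> \<Longrightarrow> lin_indep_family I g'"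
proof -
  define T where "T Z = (\<Sum>i\<in>I. (Z \<bullet> \<beta> (i, False)) *\<^sub>R cmat_smult \<i> (g i)) + (\<Sum>i\<in>I. (Z \<bullet> \<beta> (i, True)) *\<^sub>R g i)" for Z
  have lin: "linear T"
    unfolding T_def by (auto intro!: linearI simp: inner_add_left algebra_simps sum.distrib scaleR_sum_right)
  have "Z = 0" if "T Z = 0" for Z
  proof -
    have "Z \<bullet> \<beta> (i, x) = 0" if "i \<in> I" for i x
      using lin_indep_family_complexify[OF ind herm _ that, of "\<lambda>i. Z \<bullet> \<beta> (i, False)" "\<lambda>i. Z \<bullet> \<beta> (i, True)"] \<open>T Z = 0\<close>
      by (cases x) (auto simp: T_def)
    then have "Z \<bullet> b = 0" if "b \<in> Basis" for b
      using that unfolding bij_betw_imp_surj_on[OF \<beta>, symmetric] by blast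
    then show ?thesis using euclidean_all_zero_iff[of Z] by blast
  qed
  then have "inj T" using linear_injective_0[OF lin] by blast
  then obtain \<epsilon> where \<epsilon>: "\<epsilon> > 0" "\<And>Z. \<epsilon> * norm Z \<le> norm (T Z)"
    using linear_inj_bounded_below_pos[OF lin] by blast
  show ?thesis
  proof (rule that[OF \<epsilon>(1)])
    fix g' assume small: "(\<Sum>i\<in>I. norm (g' i - g i)) < \<epsilon>"
    show "lin_indep_family I g'"
      unfolding lin_indep_family_def
    proof (intro allI impI)
      fix a :: "nat \<Rightarrow> real" assume 0: "(\<Sum>i\<in>I. a i *\<^sub>R g' i) = 0"
      \<comment> \<open>The coefficients of the supposed relation are put in the \<open>True\<close>
        coordinates and 0 in the others, so that T Z is the same combination of the unperturbed
        family.\<close>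
      define Z where "Z = (\<Sum>p\<in>I \<times> UNIV. (if snd p then a (fst p) else 0) *\<^sub>R \<beta> p)"
      have Zc: "Z \<bullet> \<beta> (j, x) = (if x then a j else 0)" if "j \<in> I" for j x
        using inner_sum_Basis_reindex[OF \<beta>, of "(j, x)" "\<lambda>p. if snd p then a (fst p) else 0"] that
        by (simp add: Z_def)
      have le: "\<bar>a j\<bar> \<le> norm Z" if "j \<in> I" for j
        using Basis_le_norm[of "\<beta> (j, True)" Z] \<beta> that Zc[OF that, of True] by (auto simp: bij_betw_def)
      have "T Z = (\<Sum>i\<in>I. a i *\<^sub>R g i)" using Zc by (simp add: T_def)
      also have "\<dots> = (\<Sum>i\<in>I. a i *\<^sub>R (g i - g' i))"
        using 0 by (simp add: scaleR_diff_right sum_subtractf)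
      finally have "norm (T Z) \<le> (\<Sum>i\<in>I. norm Z * norm (g' i - g i))"
        using le by (auto intro!: order_trans[OF norm_sum] sum_mono mult_right_mono simp: norm_minus_commute)
      also have "\<dots> = norm Z * (\<Sum>i\<in>I. norm (g' i - g i))"
        by (simp add: sum_distrib_left)
      finally have "norm Z * \<epsilon> \<le> norm Z * (\<Sum>i\<in>I. norm (g' i - g i))"
        using \<epsilon>(2)[of Z] by (simp add: mult.commute)
      then have "Z = 0" using small by (simp add: mult_le_cancel_left)
      then show "\<forall>i\<in>I. a i = 0" using le by force
    qed
  qed
qed

section \<open>Charts\<close>

text \<open>
  Half of the coordinates of the matrix space are used as times, the other half (based at 1, so that
  all coordinates can be taken positive) parametrize Hermitian matrices close to 0. The chart thus
  maps between spaces of equal dimension, and its unitary polar factor is the product of evolutions.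
\<close>

definition chart_times :: "nat set \<Rightarrow> (nat \<times> bool \<Rightarrow> 'n::finite cmat) \<Rightarrow> (nat \<Rightarrow> real) \<Rightarrow> 'n cmat \<Rightarrow> nat \<Rightarrow> real" where
  "chart_times I \<beta> y Z j = (if j \<in> I then Z \<bullet> \<beta> (j, True) else y j)"

definition chart_herm :: "nat set \<Rightarrow> (nat \<times> bool \<Rightarrow> 'n::finite cmat) \<Rightarrow> (nat \<Rightarrow> 'n cmat) \<Rightarrow> 'n cmat \<Rightarrow> 'n cmat" where
  "chart_herm I \<beta> k Z = (\<Sum>j\<in>I. (Z \<bullet> \<beta> (j, False) - 1) *\<^sub>R k j)"

definition chart where
  "chart H1 H2 L I \<beta> y k Z = Jprod H1 H2 L (chart_times I \<beta> y Z) ** (mat 1 + chart_herm I \<beta> k Z)"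

lemma chart_has_derivative:
  fixes H1 H2 :: "'n::finite cmat"
  assumes herm: "hermitian H1" "hermitian H2" and I: "I \<subseteq> {1..L}"
  shows "(chart H1 H2 L I \<beta> y k has_derivative
     (\<lambda>h. Jprod H1 H2 L (chart_times I \<beta> y Z) ** (\<Sum>j\<in>I. (h \<bullet> \<beta> (j, False)) *\<^sub>R k j) +
        cmat_smult (- \<i>) (\<Sum>j\<in>I. (h \<bullet> \<beta> (j, True)) *\<^sub>R generator H1 H2 L (chart_times I \<beta> y Z) j) **
          Jprod H1 H2 L (chart_times I \<beta> y Z) ** (mat 1 + chart_herm I \<beta> k Z))) (at Z)"
proof -
  let ?\<sigma>' = "\<lambda>j h. if j \<in> I then h \<bullet> \<beta> (j, True) else 0"
  have "((\<lambda>Z. chart_times I \<beta> y Z j) has_derivative ?\<sigma>' j) (at Z)" for j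
    unfolding chart_times_def by (cases "j \<in> I") (auto intro!: derivative_eq_intros)
  from has_derivative_Jprod[OF herm this, of L]
  have "((\<lambda>Z. Jprod H1 H2 L (chart_times I \<beta> y Z)) has_derivative
      (\<lambda>h. cmat_smult (- \<i>) (\<Sum>j=1..L. ?\<sigma>' j h *\<^sub>R generator H1 H2 L (chart_times I \<beta> y Z) j) **
        Jprod H1 H2 L (chart_times I \<beta> y Z))) (at Z)" by simp
  moreover have "(\<Sum>j=1..L. ?\<sigma>' j h *\<^sub>R generator H1 H2 L (chart_times I \<beta> y Z) j) =
      (\<Sum>j\<in>I. (h \<bullet> \<beta> (j, True)) *\<^sub>R generator H1 H2 L (chart_times I \<beta> y Z) j)" for h
    using I by (intro sum.mono_neutral_cong_right) auto
  ultimately have J: "((\<lambda>Z. Jprod H1 H2 L (chart_times I \<beta> y Z)) has_derivative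
      (\<lambda>h. cmat_smult (- \<i>) (\<Sum>j\<in>I. (h \<bullet> \<beta> (j, True)) *\<^sub>R generator H1 H2 L (chart_times I \<beta> y Z) j) **
        Jprod H1 H2 L (chart_times I \<beta> y Z))) (at Z)" by simp
  have "((\<lambda>Z. mat 1 + chart_herm I \<beta> k Z) has_derivative (\<lambda>h. \<Sum>j\<in>I. (h \<bullet> \<beta> (j, False)) *\<^sub>R k j)) (at Z)"
    unfolding chart_herm_def by (auto intro!: derivative_eq_intros)
  from cmat_mult.FDERIV[OF J this] show ?thesis
    unfolding chart_def[abs_def] by simp
qed

text \<open>At Z the Hermitian factor is the identity. A kernel vector of the derivative gives J P
  J* = iA with P and A Hermitian: one side is Hermitian, the other skew-Hermitian, so both vanish,
  and independence kills all coordinates. Injectivity implies surjectivity in equal dimensions, and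
  the open mapping theorem applies at this one point.\<close>

lemma chart_open_at:
  fixes H1 H2 :: "'n::finite cmat"
  assumes herm: "hermitian H1" "hermitian H2" and I: "I \<subseteq> {1..L}"
    and \<beta>: "bij_betw \<beta> (I \<times> UNIV) Basis"
    and regular: "lin_indep_family I (generator H1 H2 L (chart_times I \<beta> y Z))"
    and k: "lin_indep_family I k" "\<And>j. j \<in> I \<Longrightarrow> hermitian (k j)"
    and Z: "\<And>j. j \<in> I \<Longrightarrow> Z \<bullet> \<beta> (j, False) = 1"
    and W: "open W" "Z \<in> W"
  shows "chart H1 H2 L I \<beta> y k Z \<in> interior (chart H1 H2 L I \<beta> y k ` W)"
proof -
  let ?J = "Jprod H1 H2 L (chart_times I \<beta> y Z)" and ?g = "generator H1 H2 L (chart_times I \<beta> y Z)"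
  have U: "?J \<in> unitary_group" using herm by blast
  define D where "D h = ?J ** (\<Sum>j\<in>I. (h \<bullet> \<beta> (j, False)) *\<^sub>R k j) +
      cmat_smult (- \<i>) (\<Sum>j\<in>I. (h \<bullet> \<beta> (j, True)) *\<^sub>R ?g j) ** ?J" for h
  have "chart_herm I \<beta> k Z = 0" using Z by (simp add: chart_herm_def)
  then have D: "(chart H1 H2 L I \<beta> y k has_derivative D) (at Z)"
    using chart_has_derivative[OF herm I, of \<beta> y k Z] by (simp add: D_def[abs_def])
  then have lin: "linear D" using has_derivative_linear by blast
  have "h = 0" if "D h = 0" for h
  proof -
    let ?A = "\<Sum>j\<in>I. (h \<bullet> \<beta> (j, True)) *\<^sub>R ?g j" and ?P = "\<Sum>j\<in>I. (h \<bullet> \<beta> (j, False)) *\<^sub>R k j"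
    have "hermitian ?A" by (intro hermitian_sum_scaleR hermitian_generator herm)
    have "hermitian ?P" by (intro hermitian_sum_scaleR k)
    have "0 = D h ** cmat_adj ?J" using that by (simp add: cmat_mult.zero_left)
    also have "\<dots> = ?J ** ?P ** cmat_adj ?J + cmat_smult (- \<i>) ?A"
      using U by (simp add: D_def cmat_mult.add_left)
    finally have eq: "?J ** ?P ** cmat_adj ?J = cmat_smult \<i> ?A"
      by (simp add: vec_eq_iff eq_neg_iff_add_eq_0)
    then have "cmat_adj (?J ** ?P ** cmat_adj ?J) = cmat_adj (cmat_smult \<i> ?A)" by simp
    moreover have "cmat_adj (?J ** ?P ** cmat_adj ?J) = ?J ** ?P ** cmat_adj ?J"
      using hermitian_conj[OF \<open>hermitian ?P\<close>] by (simp only: hermitian_def)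
    moreover have "cmat_adj (cmat_smult \<i> ?A) = - cmat_smult \<i> ?A"
      using \<open>hermitian ?A\<close> by (simp only: hermitian_smult_i)
    ultimately have "cmat_smult \<i> ?A = - cmat_smult \<i> ?A" using eq by simp
    then have "2 *\<^sub>R cmat_smult \<i> ?A = 0" by (simp only: scaleR_2 eq_neg_iff_add_eq_0)
    then have A0: "cmat_smult \<i> ?A = 0" by (simp only: scaleR_eq_0_iff) simp
    then have "?A = 0" by (simp add: vec_eq_iff)
    then have "h \<bullet> \<beta> (j, True) = 0" if "j \<in> I" for j
      using regular that by (auto simp: lin_indep_family_def)
    have "?J ** ?P ** cmat_adj ?J = 0" using eq A0 by simp
    then have "cmat_adj ?J ** (?J ** ?P ** cmat_adj ?J) ** ?J = 0"
      by (simp add: cmat_mult.zero_left cmat_mult.zero_right)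
    then have "?P = 0" using U by (simp add: matrix_mul_assoc)
    then have "h \<bullet> \<beta> (j, False) = 0" if "j \<in> I" for j
      using k(1) that by (auto simp: lin_indep_family_def)
    have "h \<bullet> b = 0" if "b \<in> Basis" for b
    proof -
      obtain j x where "b = \<beta> (j, x)" "j \<in> I"
        using \<open>b \<in> Basis\<close> unfolding bij_betw_imp_surj_on[OF \<beta>, symmetric] by blast
      then show ?thesis
        using \<open>\<And>j. j \<in> I \<Longrightarrow> h \<bullet> \<beta> (j, True) = 0\<close> \<open>\<And>j. j \<in> I \<Longrightarrow> h \<bullet> \<beta> (j, False) = 0\<close>
        by (cases x) auto
    qed
    then show "h = 0" using euclidean_all_zero_iff[of h] by blast
  qed
  then have "inj D" using linear_injective_0[OF lin] by blast
  then have "surj D" using linear_injective_imp_surjective[OF lin] by blast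
  then obtain D' where D': "linear D'" "D \<circ> D' = id"
    using linear_surjective_right_inverse[OF lin] by blast
  show ?thesis
  proof (rule sussmann_open_mapping[OF open_UNIV _ UNIV_I D _ D'(2) subset_UNIV])
    show "continuous_on UNIV (chart H1 H2 L I \<beta> y k)"
      using chart_has_derivative[OF herm I] has_derivative_continuous
      by (blast intro: continuous_at_imp_continuous_on)
    show "bounded_linear D'" using D'(1) linear_conv_bounded_linear by blast
    show "Z \<in> interior W" using W by (simp add: interior_open)
  qed
qed

text \<open>X* X removes the unitary factor and leaves (1 + P)^2 = (1 + Q)^2, that is 2(P - Q) = (Q
  - P)Q + P(Q - P). For P, Q small against the constant C of the product this forces P = Q; then U -
  V = -(U - V)P forces U = V in the same way. It allows the product of evolutions to be read off
  from a chart value.\<close>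

lemma polar_factor_unique:
  obtains \<epsilon> :: real where "\<epsilon> > 0"
    "\<And>U V P Q :: 'n::finite cmat. U \<in> unitary_group \<Longrightarrow> V \<in> unitary_group \<Longrightarrow> hermitian P \<Longrightarrow> hermitian Q \<Longrightarrow>
      norm P < \<epsilon> \<Longrightarrow> norm Q < \<epsilon> \<Longrightarrow> U ** (mat 1 + P) = V ** (mat 1 + Q) \<Longrightarrow> U = V"
proof -
  obtain C where C: "C > 0" "\<And>A B. norm ((A :: 'n cmat) ** (B :: 'n cmat)) \<le> norm A * norm B * C"
    using cmat_mult.pos_bounded[where ?'n = 'n] by blast
  show ?thesis
  proof (rule that[of "1 / C"])
    fix U V P Q :: "'n cmat"
    assume U: "U \<in> unitary_group" "V \<in> unitary_group" and PQ: "hermitian P" "hermitian Q"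
      and small: "norm P < 1 / C" "norm Q < 1 / C" and eq: "U ** (mat 1 + P) = V ** (mat 1 + Q)"
    have sq: "cmat_adj (X ** (mat 1 + R)) ** (X ** (mat 1 + R)) = (mat 1 + R) ** (mat 1 + R)"
      if "X \<in> unitary_group" "hermitian R" for X R :: "'n cmat"
    proof -
      have "cmat_adj (X ** (mat 1 + R)) ** (X ** (mat 1 + R)) = (mat 1 + R) ** (cmat_adj X ** (X ** (mat 1 + R)))"
        using that by (simp add: cmat_adj_mult cmat_adj_simps hermitian_def matrix_mul_assoc)
      then show ?thesis using that by simp
    qed
    have "(mat 1 + P) ** (mat 1 + P) = (mat 1 + Q) ** (mat 1 + Q)"
      using sq[OF U(1) PQ(1)] sq[OF U(2) PQ(2)] eq by simp
    then have "P + P + P ** P = Q + Q + Q ** Q"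
      by (simp add: cmat_mult.add_left cmat_mult.add_right)
    then have "2 *\<^sub>R (P - Q) = (Q - P) ** Q + P ** (Q - P)"
      by (simp add: cmat_mult.diff_left cmat_mult.diff_right algebra_simps scaleR_2)
    then have "2 * norm (P - Q) = norm ((Q - P) ** Q + P ** (Q - P))"
      by (metis abs_numeral norm_scaleR)
    also have "\<dots> \<le> norm (Q - P) * norm Q * C + norm P * norm (Q - P) * C"
      by (intro order_trans[OF norm_triangle_ineq] add_mono C)
    also have "\<dots> = norm (P - Q) * (C * norm Q + C * norm P)"
      by (simp add: norm_minus_commute algebra_simps)
    finally have le: "2 * norm (P - Q) \<le> norm (P - Q) * (C * norm Q + C * norm P)" .
    have "C * norm Q + C * norm P < 2"
      using small C(1) by (simp add: field_simps)
    have "P = Q"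
    proof (rule ccontr)
      assume "P \<noteq> Q"
      then have "norm (P - Q) * (C * norm Q + C * norm P) < norm (P - Q) * 2"
        using \<open>C * norm Q + C * norm P < 2\<close> by (intro mult_strict_left_mono) auto
      then show False using le by simp
    qed
    have "(U - V) = - ((U - V) ** P)"
      using eq \<open>P = Q\<close> by (simp add: cmat_mult.add_right cmat_mult.diff_left algebra_simps)
    then have "norm (U - V) = norm ((U - V) ** P)" by (metis norm_minus_cancel)
    also have "\<dots> \<le> norm (U - V) * (C * norm P)" using C(2)[of "U - V" P] by (simp add: mult_ac)
    finally have le: "norm (U - V) \<le> norm (U - V) * (C * norm P)" .
    show "U = V"
    proof (rule ccontr)
      assume "U \<noteq> V"
      then have "norm (U - V) * (C * norm P) < norm (U - V) * 1"
        using small C(1) by (intro mult_strict_left_mono) (auto simp: field_simps)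
      then show False using le by simp
    qed
  qed (use C in simp)
qed

section \<open>Haar measure\<close>

lemma cmat_mult_measurable [measurable]:
  fixes f g :: "'a \<Rightarrow> 'n::finite cmat"
  assumes "f \<in> borel_measurable M" "g \<in> borel_measurable M"
  shows "(\<lambda>x. f x ** g x) \<in> borel_measurable M"
  using assms by (rule borel_measurable_continuous_Pair)
    (intro cmat_mult.continuous_on continuous_on_fst continuous_on_snd continuous_on_id)

lemma cmat_adj_measurable [measurable]: "(cmat_adj :: 'n::finite cmat \<Rightarrow> 'n cmat) \<in> borel_measurable borel"
  by (intro borel_measurable_continuous_onI linear_continuous_on bounded_linear_cmat_adj)

text \<open>Haar measure is placed on the whole matrix space, with U(N) of full measure, so that it
  can be paired with Lebesgue measure and evaluated on any Borel set of matrices.\<close>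

locale left_haar = prob_space \<pi> for \<pi> :: "'n::finite cmat measure" +
  assumes sets_haar [measurable_cong]: "sets \<pi> = sets borel"
    and haar_unitary: "AE u in \<pi>. u \<in> unitary_group"
    and haar_left: "g \<in> unitary_group \<Longrightarrow> distr \<pi> borel (\<lambda>u. g ** u) = \<pi>"
begin

lemma space_haar [simp]: "space \<pi> = UNIV"
  using sets_eq_imp_space_eq[OF sets_haar] by simp

text \<open>Inversion invariance by Fubini for the set of pairs (x, y) with x* y in A. For fixed x,
  left invariance gives \<pi>(A); for fixed y, since x* y = (y* x)*, it gives the measure of the set
  of inverses of A.\<close>

lemma haar_adj: "distr \<pi> borel cmat_adj = \<pi>"
proof (rule measure_eqI)
  fix A assume "A \<in> sets (distr \<pi> borel cmat_adj)"
  then have A [measurable]: "A \<in> sets borel" by simp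
  interpret P: pair_prob_space \<pi> \<pi> ..
  let ?X = "{p \<in> space (\<pi> \<Otimes>\<^sub>M \<pi>). cmat_adj (fst p) ** snd p \<in> A}"
  have X [measurable]: "?X \<in> sets (\<pi> \<Otimes>\<^sub>M \<pi>)" by measurable
  have "emeasure (\<pi> \<Otimes>\<^sub>M \<pi>) ?X = (\<integral>\<^sup>+ x. emeasure \<pi> (Pair x -` ?X) \<partial>\<pi>)"
    by (rule emeasure_pair_measure_alt) simp
  also have "\<dots> = (\<integral>\<^sup>+ x. emeasure \<pi> A \<partial>\<pi>)"
  proof (rule nn_integral_cong_AE, use haar_unitary in eventually_elim)
    fix x :: "'n cmat" assume x: "x \<in> unitary_group"
    have "emeasure \<pi> (Pair x -` ?X) = emeasure (distr \<pi> borel (\<lambda>u. cmat_adj x ** u)) A"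
      by (subst emeasure_distr) (auto simp: space_pair_measure intro!: arg_cong[where f = "emeasure \<pi>"])
    also have "\<dots> = emeasure \<pi> A" using x by (subst haar_left) auto
    finally show "emeasure \<pi> (Pair x -` ?X) = emeasure \<pi> A" .
  qed
  finally have 1: "emeasure (\<pi> \<Otimes>\<^sub>M \<pi>) ?X = emeasure \<pi> A" by (simp add: emeasure_space_1[unfolded space_haar])
  have "emeasure (\<pi> \<Otimes>\<^sub>M \<pi>) ?X = (\<integral>\<^sup>+ y. emeasure \<pi> ((\<lambda>x. (x, y)) -` ?X) \<partial>\<pi>)"
    by (rule P.emeasure_pair_measure_alt2) simp
  also have "\<dots> = (\<integral>\<^sup>+ y. emeasure (distr \<pi> borel cmat_adj) A \<partial>\<pi>)"
  proof (rule nn_integral_cong_AE, use haar_unitary in eventually_elim)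
    fix y :: "'n cmat" assume y: "y \<in> unitary_group"
    have "emeasure \<pi> ((\<lambda>x. (x, y)) -` ?X) = emeasure \<pi> ((\<lambda>u. cmat_adj y ** u) -` (cmat_adj -` A) \<inter> space \<pi>)"
      by (auto simp: space_pair_measure cmat_adj_mult intro!: arg_cong[where f = "emeasure \<pi>"])
    also have "\<dots> = emeasure (distr \<pi> borel (\<lambda>u. cmat_adj y ** u)) (cmat_adj -` A)"
      by (subst emeasure_distr) (use measurable_sets_borel[OF cmat_adj_measurable A] in auto)
    also have "\<dots> = emeasure \<pi> (cmat_adj -` A)" using y by (subst haar_left) auto
    also have "\<dots> = emeasure (distr \<pi> borel cmat_adj) A"
      by (subst emeasure_distr) auto
    finally show "emeasure \<pi> ((\<lambda>x. (x, y)) -` ?X) = emeasure (distr \<pi> borel cmat_adj) A" .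
  qed
  also have "\<dots> = emeasure (distr \<pi> borel cmat_adj) A" by (simp add: emeasure_space_1[unfolded space_haar])
  finally show "emeasure (distr \<pi> borel cmat_adj) A = emeasure \<pi> A" using 1 by simp
qed (simp add: sets_haar)

text \<open>Right multiplication by g is left multiplication by g*, conjugated by the
  adjoint.\<close>

lemma haar_right:
  assumes g: "g \<in> unitary_group"
  shows "distr \<pi> borel (\<lambda>u. u ** g) = \<pi>"
proof -
  have "distr \<pi> borel (\<lambda>u. u ** g) = distr (distr \<pi> borel cmat_adj) borel (\<lambda>u. u ** g)"
    by (simp add: haar_adj)
  also have "\<dots> = distr \<pi> borel (\<lambda>u. cmat_adj (cmat_adj g ** u))"
    by (subst distr_distr) (auto simp: o_def cmat_adj_mult)
  also have "\<dots> = distr (distr \<pi> borel (\<lambda>u. cmat_adj g ** u)) borel cmat_adj"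
    by (subst distr_distr) (auto simp: o_def)
  also have "\<dots> = \<pi>" using g by (subst haar_left) (auto simp: haar_adj)
  finally show ?thesis .
qed

end

section \<open>Laws with positive densities\<close>

text \<open>If every box of radius 1/(k+1) contained a bad point, these points would form a sequence
  converging to \<open>s\<close> in the coordinates \<open>J\<close> with images outside
  \<open>O'\<close>.\<close>

lemma sequential_box_neighbourhood:
  fixes s :: "nat \<Rightarrow> real"
  assumes "\<And>\<sigma>. (\<And>j. j \<in> J \<Longrightarrow> (\<lambda>k. \<sigma> k j) \<longlonglongrightarrow> s j) \<Longrightarrow> (\<lambda>k :: nat. G (\<sigma> k)) \<longlonglongrightarrow> G s"
    and "open O'" "G s \<in> O'"
  obtains \<delta> where "\<delta> > 0" "\<And>t. (\<And>j. j \<in> J \<Longrightarrow> \<bar>t j - s j\<bar> < \<delta>) \<Longrightarrow> G t \<in> O'"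
proof (rule ccontr)
  assume "\<not> thesis"
  then have "\<forall>\<delta>>0. \<exists>t. (\<forall>j\<in>J. \<bar>t j - s j\<bar> < \<delta>) \<and> G t \<notin> O'"
    using that by meson
  then have "\<forall>k. \<exists>t. (\<forall>j\<in>J. \<bar>t j - s j\<bar> < inverse (real (Suc k))) \<and> G t \<notin> O'"
    by (intro allI) (auto elim!: allE)
  then obtain \<sigma> where \<sigma>: "\<And>k j. j \<in> J \<Longrightarrow> \<bar>\<sigma> k j - s j\<bar> < inverse (real (Suc k))" "\<And>k. G (\<sigma> k) \<notin> O'"
    by metis
  have "(\<lambda>k. \<sigma> k j) \<longlonglongrightarrow> s j" if "j \<in> J" for j
  proof (rule LIM_zero_cancel, rule Lim_null_comparison[OF always_eventually LIMSEQ_inverse_real_of_nat], rule allI)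
    show "norm (\<sigma> k j - s j) \<le> inverse (real (Suc k))" for k
      using \<sigma>(1)[OF that, of k] by simp
  qed
  then have "(\<lambda>k. G (\<sigma> k)) \<longlonglongrightarrow> G s" by (rule assms(1))
  then have "\<forall>\<^sub>F k in sequentially. G (\<sigma> k) \<in> O'"
    using assms(2,3) topological_tendstoD by blast
  then show False using \<sigma>(2) by simp
qed

lemma PiM_density_lborel:
  assumes fin: "finite I" and F [measurable]: "F \<in> borel_measurable borel"
    and prob: "prob_space (density lborel F)"
  shows "Pi\<^sub>M I (\<lambda>_. density lborel F) = density (Pi\<^sub>M I (\<lambda>_. lborel :: real measure)) (\<lambda>x. \<Prod>i\<in>I. F (x i))"
proof (rule sym)
  interpret prob_space "density lborel F" by fact
  interpret D: product_sigma_finite "\<lambda>_. density lborel F" ..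
  interpret L: product_sigma_finite "\<lambda>_. lborel :: real measure" ..
  show "density (Pi\<^sub>M I (\<lambda>_. lborel :: real measure)) (\<lambda>x. \<Prod>i\<in>I. F (x i)) = Pi\<^sub>M I (\<lambda>_. density lborel F)"
  proof (rule D.PiM_eqI[OF fin])
    show "sets (density (Pi\<^sub>M I (\<lambda>_. lborel)) (\<lambda>x. \<Prod>i\<in>I. F (x i))) = sets (Pi\<^sub>M I (\<lambda>_. density lborel F))"
      unfolding sets_density by (rule sets_PiM_cong) auto
    fix A assume A: "\<And>i. i \<in> I \<Longrightarrow> A i \<in> sets (density lborel F)"
    then have A' [measurable]: "i \<in> I \<Longrightarrow> A i \<in> sets borel" for i by auto
    have "emeasure (density (Pi\<^sub>M I (\<lambda>_. lborel)) (\<lambda>x. \<Prod>i\<in>I. F (x i))) (Pi\<^sub>E I A)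
        = (\<integral>\<^sup>+ x. (\<Prod>i\<in>I. F (x i)) * indicator (Pi\<^sub>E I A) x \<partial>Pi\<^sub>M I (\<lambda>_. lborel))"
      using A fin by (intro emeasure_density sets_PiM_I_finite) auto
    also have "\<dots> = (\<integral>\<^sup>+ x. (\<Prod>i\<in>I. F (x i) * indicator (A i) (x i)) \<partial>Pi\<^sub>M I (\<lambda>_. lborel))"
    proof (rule nn_integral_cong)
      fix x assume x: "x \<in> space (Pi\<^sub>M I (\<lambda>_. lborel :: real measure))"
      show "(\<Prod>i\<in>I. F (x i)) * indicator (Pi\<^sub>E I A) x = (\<Prod>i\<in>I. F (x i) * indicator (A i) (x i))"
      proof (cases "x \<in> Pi\<^sub>E I A")
        case True
        then show ?thesis by (auto intro!: prod.cong dest: PiE_mem)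
      next
        case False
        then obtain i where "i \<in> I" "x i \<notin> A i"
          using x by (auto simp: space_PiM PiE_iff)
        then show ?thesis
          using False fin by (auto intro!: prod_zero[symmetric] bexI[of _ i])
      qed
    qed
    also have "\<dots> = (\<Prod>i\<in>I. \<integral>\<^sup>+ x. F x * indicator (A i) x \<partial>lborel)"
      using fin by (intro L.product_nn_integral_prod) auto
    also have "\<dots> = (\<Prod>i\<in>I. emeasure (density lborel F) (A i))"
      by (intro prod.cong refl emeasure_density[symmetric]) auto
    finally show "emeasure (density (Pi\<^sub>M I (\<lambda>_. lborel)) (\<lambda>x. \<Prod>i\<in>I. F (x i))) (Pi\<^sub>E I A) = (\<Prod>i\<in>I. emeasure (density lborel F) (A i))" .
  qed
qed

text \<open>The law on \<open>I\<close> is a marginal of the product law over all matrix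
  coordinates, the \<open>False\<close> coordinates being auxiliary times with the same law. That
  product has a density positive on the nonnegative orthant, so its null sets are Lebesgue null
  there.\<close>

lemma AE_lborel_positive_coordinates:
  fixes \<beta> :: "'i \<times> bool \<Rightarrow> 'b::euclidean_space"
  assumes F [measurable]: "F \<in> borel_measurable borel" and pos: "\<And>x. x \<ge> 0 \<Longrightarrow> F x > 0"
    and prob: "prob_space (density lborel F)"
    and \<beta>: "bij_betw \<beta> (I \<times> UNIV) Basis"
    and P: "{x \<in> space (Pi\<^sub>M I (\<lambda>_. density lborel F)). P x} \<in> sets (Pi\<^sub>M I (\<lambda>_. density lborel F))"
    and AE: "AE x in Pi\<^sub>M I (\<lambda>_. density lborel F). P x"
  shows "AE Z in lborel. (\<forall>b\<in>Basis. Z \<bullet> b \<ge> 0) \<longrightarrow> P (\<lambda>j\<in>I. Z \<bullet> \<beta> (j, True))"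
proof -
  let ?PB = "Pi\<^sub>M (Basis :: 'b set) (\<lambda>_. density lborel F)"
  let ?r = "\<lambda>\<omega>. \<lambda>j\<in>I. \<omega> (\<beta> (j, True))"
  have \<beta>B: "\<beta> (j, True) \<in> Basis" if "j \<in> I" for j using bij_betw_apply[OF \<beta>] that by auto
  have inj: "inj_on (\<lambda>j. \<beta> (j, True)) I"
    using bij_betw_imp_inj_on[OF \<beta>] by (auto simp: inj_on_def)
  have "distr ?PB (Pi\<^sub>M I (\<lambda>_. density lborel F)) ?r = Pi\<^sub>M I (\<lambda>_. density lborel F)"
    using distr_PiM_reindex[of Basis "\<lambda>_. density lborel F" "\<lambda>j. \<beta> (j, True)" I] prob inj \<beta>B by auto
  then have "AE x in distr ?PB (Pi\<^sub>M I (\<lambda>_. density lborel F)) ?r. P x" using AE by (simp only:)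
  moreover have "?r \<in> measurable ?PB (Pi\<^sub>M I (\<lambda>_. density lborel F))"
    using \<beta>B by (intro measurable_restrict measurable_component_singleton) auto
  ultimately have "AE \<omega> in ?PB. P (?r \<omega>)"
    using P by (simp add: AE_distr_iff)
  then have "AE \<omega> in density (Pi\<^sub>M (Basis :: 'b set) (\<lambda>_. lborel :: real measure)) (\<lambda>x. \<Prod>b\<in>Basis. F (x b)). P (?r \<omega>)"
    unfolding PiM_density_lborel[OF finite_Basis F prob] .
  then have AE: "AE \<omega> in Pi\<^sub>M (Basis :: 'b set) (\<lambda>_. lborel :: real measure). 0 < (\<Prod>b\<in>Basis. F (\<omega> b)) \<longrightarrow> P (?r \<omega>)"
    by (subst (asm) AE_density) auto
  let ?S = "\<lambda>\<omega>. \<Sum>b\<in>(Basis :: 'b set). \<omega> b *\<^sub>R b"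
  let ?Q = "\<lambda>Z :: 'b. (\<forall>b\<in>Basis. Z \<bullet> b \<ge> 0) \<longrightarrow> P (\<lambda>j\<in>I. Z \<bullet> \<beta> (j, True))"
  have coord: "?S \<omega> \<bullet> b = \<omega> b" if "b \<in> Basis" for \<omega> :: "'b \<Rightarrow> real" and b
    using that by (simp add: inner_sum_left inner_Basis if_distrib[of "(*) _"] sum.delta cong: if_cong)
  have "(\<lambda>Z :: 'b. \<lambda>j\<in>I. Z \<bullet> \<beta> (j, True)) \<in> measurable borel (Pi\<^sub>M I (\<lambda>_. density lborel F))"
    by (intro measurable_restrict) auto
  from measurable_sets[OF this P] have "{Z. P (\<lambda>j\<in>I. Z \<bullet> \<beta> (j, True))} \<in> sets borel"
    by (simp add: space_PiM vimage_def)
  then have [measurable]: "Measurable.pred borel (\<lambda>Z. P (\<lambda>j\<in>I. Z \<bullet> \<beta> (j, True)))"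
    by (simp add: pred_def)
  have Q: "{Z \<in> space borel. ?Q Z} \<in> sets borel" by measurable
  have "AE \<omega> in Pi\<^sub>M (Basis :: 'b set) (\<lambda>_. lborel :: real measure). ?Q (?S \<omega>)"
    using AE
  proof eventually_elim
    case (elim \<omega>)
    show ?case
    proof
      assume "\<forall>b\<in>Basis. 0 \<le> ?S \<omega> \<bullet> b"
      then have "0 < (\<Prod>b\<in>Basis. F (\<omega> b))"
        using pos by (auto simp: coord zero_less_iff_neq_zero)
      moreover have "(\<lambda>j\<in>I. ?S \<omega> \<bullet> \<beta> (j, True)) = ?r \<omega>"
        using \<beta>B by (auto simp: coord restrict_def)
      ultimately show "P (\<lambda>j\<in>I. ?S \<omega> \<bullet> \<beta> (j, True))" using elim by simp
    qed
  qed
  then have "AE Z in distr (Pi\<^sub>M (Basis :: 'b set) (\<lambda>_. lborel :: real measure)) borel ?S. ?Q Z"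
    using Q by (subst AE_distr_iff) auto
  then show ?thesis by (subst lborel_eq)
qed

lemma positive_open_interval:
  fixes F :: "real \<Rightarrow> ennreal"
  assumes F [measurable]: "F \<in> borel_measurable borel" and pos: "\<And>x. x \<ge> 0 \<Longrightarrow> F x > 0"
    and "0 \<le> a" "a < b"
  shows "emeasure (density lborel F) {a<..<b} > 0"
proof (rule ccontr)
  assume "\<not> ?thesis"
  then have "(\<integral>\<^sup>+ x. F x * indicator {a<..<b} x \<partial>lborel) = 0"
    by (subst (asm) emeasure_density) auto
  then have "AE x in lborel. F x * indicator {a<..<b} x = 0"
    by (subst (asm) nn_integral_0_iff_AE) auto
  then have "AE x in lborel. x \<notin> {a<..<b}"
  proof eventually_elim
    case (elim x)
    then show ?case using pos[of x] \<open>0 \<le> a\<close> by (auto simp: indicator_def split: if_splits)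
  qed
  moreover have "{x. a < x \<and> x < b} = {a<..<b}" by auto
  ultimately have "emeasure lborel {a<..<b} = 0"
    by (subst (asm) AE_iff_measurable[OF _ refl]) auto
  then show False using \<open>a < b\<close> by simp
qed

locale controllable_walk =
  fixes H1 H2 :: "'n::finite cmat" and F :: "real \<Rightarrow> ennreal"
  assumes herm: "hermitian H1" "hermitian H2" and ctrl: "U_controllable H1 H2"
    and density_measurable [measurable]: "F \<in> borel_measurable borel"
    and density_pos: "\<And>x. x \<ge> 0 \<Longrightarrow> F x > 0"
    and density_prob: "prob_space (density lborel F)"
begin

abbreviation "time_law I \<equiv> Pi\<^sub>M I (\<lambda>_ :: nat. density lborel F)"

lemma product_sigma: "product_sigma_finite (\<lambda>_ :: nat. density lborel F)"
proof -
  interpret prob_space "density lborel F" by (rule density_prob)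
  show ?thesis ..
qed

lemma Jprod_measurable [measurable]:
  assumes "{1..L} \<subseteq> K"
  shows "Jprod H1 H2 L \<in> borel_measurable (time_law K)"
  using assms
proof (induction L)
  case (Suc L)
  have "evol H \<in> borel_measurable borel" for H :: "'n cmat"
    by (intro borel_measurable_continuous_onI continuous_at_imp_continuous_on ballI isCont_evol)
  moreover have "(\<lambda>s. s (Suc L)) \<in> borel_measurable (time_law K)"
  proof -
    have "Suc L \<in> K" using Suc.prems by auto
    then have "(\<lambda>s. s (Suc L)) \<in> measurable (time_law K) (density lborel F)"
      by (rule measurable_component_singleton)
    then show ?thesis by simp
  qed
  ultimately have "(\<lambda>s. evol (ham H1 H2 (Suc L)) (s (Suc L))) \<in> borel_measurable (time_law K)"
    by (rule measurable_compose[rotated])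
  moreover have "Jprod H1 H2 L \<in> borel_measurable (time_law K)"
    by (rule Suc.IH[OF order_trans[OF _ Suc.prems]]) auto
  ultimately show ?case by simp
next
  case 0
  have "Jprod H1 H2 0 = (\<lambda>s. mat 1)" by auto
  then show ?case by simp
qed

text \<open>The box lies to the right of \<open>s\<close>, so its intervals stay where the density
  is positive even if some \<open>s j\<close> is 0.\<close>

lemma box_pos:
  assumes "finite J" "\<And>j. j \<in> J \<Longrightarrow> 0 \<le> s j" "\<delta> > 0"
  shows "emeasure (time_law J) (Pi\<^sub>E J (\<lambda>j. {s j<..<s j + \<delta>})) > 0"
  using assms positive_open_interval[OF density_measurable density_pos]
  by (subst product_sigma_finite.emeasure_PiM[OF product_sigma]) (auto simp: zero_less_iff_neq_zero)

lemma AE_box_witness: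
  assumes "finite J" "\<And>j. j \<in> J \<Longrightarrow> 0 \<le> s j" "\<delta> > 0" and AE: "AE x in time_law J. P x"
  obtains x where "x \<in> Pi\<^sub>E J (\<lambda>j. {s j<..<s j + \<delta>})" "P x"
proof (rule ccontr)
  assume "\<not> thesis"
  then have "P x \<Longrightarrow> x \<notin> Pi\<^sub>E J (\<lambda>j. {s j<..<s j + \<delta>})" for x using that by blast
  then have "AE x in time_law J. P x \<longrightarrow> x \<notin> Pi\<^sub>E J (\<lambda>j. {s j<..<s j + \<delta>})" by simp
  with AE have "AE x in time_law J. x \<notin> Pi\<^sub>E J (\<lambda>j. {s j<..<s j + \<delta>})" by (rule AE_mp)
  moreover have "Pi\<^sub>E J (\<lambda>j. {s j<..<s j + \<delta>}) \<in> sets (time_law J)"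
    using \<open>finite J\<close> by (intro sets_PiM_I_finite) auto
  ultimately have "emeasure (time_law J) (Pi\<^sub>E J (\<lambda>j. {s j<..<s j + \<delta>})) = 0"
    using AE_iff_measurable[of "Pi\<^sub>E J (\<lambda>j. {s j<..<s j + \<delta>})" "time_law J" "\<lambda>x. x \<notin> Pi\<^sub>E J (\<lambda>j. {s j<..<s j + \<delta>})"]
    by (auto dest: sets.sets_into_space)
  then show False using box_pos[of J s \<delta>] assms by simp
qed

end

section \<open>Absolute continuity of Haar measure with respect to the walk\<close>

locale controllable_walk_haar = controllable_walk H1 H2 F + left_haar \<pi>
  for H1 H2 :: "'n::finite cmat" and F and \<pi> :: "'n cmat measure"
begin

text \<open>By Fubini, almost every choice y of the times outside \<open>I\<close> leaves a null
  section in the times of \<open>I\<close>. Since the box next to \<open>s\<close> has positive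
  probability, such a y exists arbitrarily close to \<open>s\<close>; it depends on
  \<open>A\<close>.\<close>

lemma frozen_chart_AE:
  assumes I: "I \<subseteq> {1..L}" and \<beta>: "bij_betw \<beta> (I \<times> UNIV) Basis"
    and A [measurable]: "A \<in> sets borel" and null: "AE s in time_law {1..L}. Jprod H1 H2 L s \<notin> A"
    and s: "\<And>j. s j \<ge> 0" and "\<delta> > 0"
  obtains y where "\<And>j. j \<in> {1..L} - I \<Longrightarrow> s j < y j \<and> y j < s j + \<delta>"
    "AE Z in lborel. (\<forall>b\<in>Basis. Z \<bullet> b \<ge> 0) \<longrightarrow> Jprod H1 H2 L (chart_times I \<beta> y Z) \<notin> A"
proof -
  interpret P: product_sigma_finite "\<lambda>_ :: nat. density lborel F" by (rule product_sigma)
  let ?R = "{1..L} - I"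
  have RI: "?R \<inter> I = {}" "?R \<union> I = {1..L}" "finite ?R" "finite I"
    using I finite_subset[OF I] by auto
  interpret PR: prob_space "time_law ?R" by (intro prob_space_PiM density_prob)
  interpret PI: prob_space "time_law I" by (intro prob_space_PiM density_prob)
  interpret PP: pair_sigma_finite "time_law ?R" "time_law I" ..
  have distr: "distr (time_law ?R \<Otimes>\<^sub>M time_law I) (time_law {1..L}) (merge ?R I) = time_law {1..L}"
    using P.distr_merge[OF RI(1,3,4)] unfolding RI(2) .
  have merge: "merge ?R I \<in> measurable (time_law ?R \<Otimes>\<^sub>M time_law I) (time_law {1..L})"
    using measurable_merge[of ?R I "\<lambda>_. density lborel F"] unfolding RI(2) .
  have J [measurable]: "Jprod H1 H2 L \<in> borel_measurable (time_law {1..L})" by simp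
  have set: "{s \<in> space (time_law {1..L}). Jprod H1 H2 L s \<notin> A} \<in> sets (time_law {1..L})" by measurable
  have "AE s in distr (time_law ?R \<Otimes>\<^sub>M time_law I) (time_law {1..L}) (merge ?R I). Jprod H1 H2 L s \<notin> A"
    using null by (simp only: distr)
  then have "AE p in time_law ?R \<Otimes>\<^sub>M time_law I. Jprod H1 H2 L (merge ?R I p) \<notin> A"
    by (subst (asm) AE_distr_iff[OF merge set])
  then have AEy: "AE y in time_law ?R. AE x in time_law I. Jprod H1 H2 L (merge ?R I (y, x)) \<notin> A"
    by (rule PP.AE_pair)
  obtain y where y: "y \<in> Pi\<^sub>E ?R (\<lambda>j. {s j<..<s j + \<delta>})"
    and AE: "AE x in time_law I. Jprod H1 H2 L (merge ?R I (y, x)) \<notin> A"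
    by (rule AE_box_witness[OF RI(3) _ \<open>\<delta> > 0\<close> AEy, of s]) (use s in blast)+
  have ysp: "y \<in> space (time_law ?R)" using y by (auto simp: space_PiM PiE_iff)
  have "(\<lambda>x. Jprod H1 H2 L (merge ?R I (y, x))) \<in> borel_measurable (time_law I)"
    by (rule measurable_compose[OF measurable_compose[OF measurable_Pair1'[OF ysp] merge] J])
  then have "{x \<in> space (time_law I). Jprod H1 H2 L (merge ?R I (y, x)) \<notin> A} \<in> sets (time_law I)" by measurable
  from AE_lborel_positive_coordinates[OF density_measurable density_pos density_prob \<beta> this AE]
  have "AE Z in lborel. (\<forall>b\<in>Basis. Z \<bullet> b \<ge> 0) \<longrightarrow> Jprod H1 H2 L (merge ?R I (y, \<lambda>j\<in>I. Z \<bullet> \<beta> (j, True))) \<notin> A" .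
  moreover have "Jprod H1 H2 L (merge ?R I (y, \<lambda>j\<in>I. Z \<bullet> \<beta> (j, True))) = Jprod H1 H2 L (chart_times I \<beta> y Z)" for Z
    by (rule Jprod_cong) (auto simp: merge_def chart_times_def)
  ultimately show ?thesis
    using that[of y] y by (auto simp: PiE_iff)
qed

lemma negligible_left_mult:
  assumes "U \<in> unitary_group" "N \<in> null_sets (lborel :: 'n cmat measure)"
  shows "AE G in lborel. U ** G \<notin> N"
proof -
  have "negligible N" using assms(2) null_sets_completionI by (auto simp: negligible_iff_null_sets)
  then have "negligible ((\<lambda>G. cmat_adj U ** G) ` N)"
    by (intro negligible_differentiable_image_negligible[OF order_refl] linear_imp_differentiable_on
        bounded_linear.linear[OF cmat_mult.bounded_linear_right])
  moreover have "{G. U ** G \<in> N} \<subseteq> (\<lambda>G. cmat_adj U ** G) ` N"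
    using assms(1) by (auto intro!: rev_image_eqI)
  ultimately have "{G. U ** G \<in> N} \<in> null_sets lebesgue"
    using negligible_subset by (auto simp: negligible_iff_null_sets)
  then have "AE G in lebesgue. U ** G \<notin> N"
    by (intro AE_I'[of "{G. U ** G \<in> N}"]) auto
  then show ?thesis by (simp add: AE_completion_iff)
qed

text \<open>
  Null sets of matrices are null along almost every coset of the unitary group, since left
  multiplication by a unitary matrix preserves Lebesgue null sets.
\<close>

lemma AE_coset_not_null:
  assumes N: "N \<in> null_sets (lborel :: 'n cmat measure)"
  shows "AE G in lborel. AE u in \<pi>. u ** G \<notin> N"
proof -
  interpret Q: pair_sigma_finite \<pi> "lborel :: 'n cmat measure" ..
  have [measurable]: "N \<in> sets borel" using N by (auto simp: null_sets_def)
  have "AE u in \<pi>. AE G in lborel. u ** G \<notin> N"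
    using haar_unitary by eventually_elim (rule negligible_left_mult[OF _ N])
  then show ?thesis
    by (subst (asm) Q.AE_commute) measurable
qed

lemma local_absolute_continuity:
  obtains n where "\<And>A. A \<in> sets borel \<Longrightarrow> AE s in time_law {1..2 * n}. Jprod H1 H2 (2 * n) s \<notin> A \<Longrightarrow>
    \<exists>O' u. open O' \<and> u \<in> O' \<and> u \<in> unitary_group \<and> emeasure \<pi> (A \<inter> O') = 0"
proof -
  obtain L s I and \<beta> :: "nat \<times> bool \<Rightarrow> 'n cmat" where L: "even L" and s: "\<And>j. s j \<ge> 0"
    and I: "I \<subseteq> {1..L}" and ind: "lin_indep_family I (generator H1 H2 L s)"
    and \<beta>: "bij_betw \<beta> (I \<times> UNIV) Basis"
    using regular_point[OF herm ctrl] by metis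
  have finI: "finite I" using I finite_subset by blast
  \<comment> \<open>The generators at the regular point also serve as directions of the Hermitian
    factor; they stay fixed while the times move.\<close>
  let ?k = "generator H1 H2 L s"
  have hk: "hermitian (generator H1 H2 L t j)" for t j using herm by (rule hermitian_generator)
  obtain n where n: "L = 2 * n" using L by blast
  show ?thesis
  proof (rule that[of n], fold n)
    fix A :: "'n cmat set" assume A: "A \<in> sets borel" and null: "AE s in time_law {1..L}. Jprod H1 H2 L s \<notin> A"
    obtain \<epsilon> where \<epsilon>: "\<epsilon> > 0" "\<And>g'. (\<Sum>i\<in>I. norm (g' i - ?k i)) < \<epsilon> \<Longrightarrow> lin_indep_family I g'"
      using lin_indep_family_open[OF ind hk \<beta> finI] by metis
    obtain \<delta> where \<delta>: "\<delta> > 0"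
      "\<And>t. (\<And>j. j \<in> {1..L} \<Longrightarrow> \<bar>t j - s j\<bar> < \<delta>) \<Longrightarrow> (\<Sum>i\<in>I. norm (generator H1 H2 L t i - ?k i)) \<in> {..<\<epsilon>}"
    proof (rule sequential_box_neighbourhood[of "{1..L}" s "\<lambda>t. \<Sum>i\<in>I. norm (generator H1 H2 L t i - ?k i)" "{..<\<epsilon>}"])
      fix \<sigma> :: "nat \<Rightarrow> nat \<Rightarrow> real" assume "\<And>j. j \<in> {1..L} \<Longrightarrow> (\<lambda>k. \<sigma> k j) \<longlonglongrightarrow> s j"
      then show "(\<lambda>k. \<Sum>i\<in>I. norm (generator H1 H2 L (\<sigma> k) i - ?k i)) \<longlonglongrightarrow> (\<Sum>i\<in>I. norm (?k i - ?k i))"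
        by (intro tendsto_intros tendsto_generator)
    qed (use \<epsilon> in auto)
    obtain y where y: "\<And>j. j \<in> {1..L} - I \<Longrightarrow> s j < y j \<and> y j < s j + \<delta>"
      and AEZ: "AE Z in lborel. (\<forall>b\<in>Basis. Z \<bullet> b \<ge> 0) \<longrightarrow> Jprod H1 H2 L (chart_times I \<beta> y Z) \<notin> A"
      by (rule frozen_chart_AE[OF I \<beta> A null _ \<delta>(1), of s]) (use s in blast)+
    obtain \<eta> :: real where \<eta>: "\<eta> > 0"
      "\<And>U V P Q :: 'n cmat. U \<in> unitary_group \<Longrightarrow> V \<in> unitary_group \<Longrightarrow> hermitian P \<Longrightarrow> hermitian Q \<Longrightarrow>
        norm P < \<eta> \<Longrightarrow> norm Q < \<eta> \<Longrightarrow> U ** (mat 1 + P) = V ** (mat 1 + Q) \<Longrightarrow> U = V"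
      by (rule polar_factor_unique[where ?'n = 'n]) blast
    \<comment> \<open>The shift by \<delta>/2 makes the selected times positive and keeps them in
      the box where the generators are independent; the value 1 makes the Hermitian part
      vanish.\<close>
    define Z0 where "Z0 = (\<Sum>p\<in>I \<times> UNIV. (if snd p then s (fst p) + \<delta> / 2 else 1) *\<^sub>R \<beta> p)"
    have Z0: "Z0 \<bullet> \<beta> (j, x) = (if x then s j + \<delta> / 2 else 1)" if "j \<in> I" for j x
      using inner_sum_Basis_reindex[OF \<beta>, of "(j, x)" "\<lambda>p. if snd p then s (fst p) + \<delta> / 2 else 1"] that
      by (simp add: Z0_def)
    define T where "T = chart_times I \<beta> y"
    define P where "P = chart_herm I \<beta> ?k"
    define \<Psi> where "\<Psi> = chart H1 H2 L I \<beta> y ?k"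
    have \<Psi>: "\<Psi> Z = Jprod H1 H2 L (T Z) ** (mat 1 + P Z)" for Z
      by (simp add: \<Psi>_def chart_def T_def P_def)
    have hP: "hermitian (P Z)" for Z unfolding P_def chart_herm_def by (intro hermitian_sum_scaleR hk)
    have JU: "Jprod H1 H2 L t \<in> unitary_group" for t using herm by blast
    \<comment> \<open>Small Hermitian parts allow recovery of the unitary factor; positive
      coordinates make the almost-everywhere statement on the orthant applicable.\<close>
    define W where "W = {Z. norm (P Z) < \<eta>} \<inter> (\<Inter>b\<in>Basis. {Z :: 'n cmat. 0 < Z \<bullet> b})"
    have "open W" unfolding W_def P_def chart_herm_def
      by (intro open_Int open_INT finite_Basis ballI open_Collect_less continuous_intros)
    have Z0b: "0 < Z0 \<bullet> b" if b: "b \<in> Basis" for b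
    proof -
      obtain j x where "b = \<beta> (j, x)" "j \<in> I"
        using b unfolding bij_betw_imp_surj_on[OF \<beta>, symmetric] by blast
      then show ?thesis using Z0[of j x] s[of j] \<delta>(1) by auto
    qed
    have "Z0 \<in> W" using Z0 Z0b \<eta>(1) by (auto simp: W_def P_def chart_herm_def)
    have close: "\<bar>T Z0 j - s j\<bar> < \<delta>" if "j \<in> {1..L}" for j
      using y[of j] Z0[of j True] \<delta>(1) that by (auto simp: T_def chart_times_def)
    have "\<Psi> Z0 \<in> interior (\<Psi> ` W)"
      unfolding \<Psi>_def
    proof (rule chart_open_at[OF herm I \<beta> _ ind hk _ \<open>open W\<close> \<open>Z0 \<in> W\<close>])
      show "lin_indep_family I (generator H1 H2 L (chart_times I \<beta> y Z0))"
        using \<delta>(2)[of "T Z0"] close by (intro \<epsilon>(2)) (simp add: T_def)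
      show "Z0 \<bullet> \<beta> (j, False) = 1" if "j \<in> I" for j using Z0[OF that] by simp
    qed
    define \<Omega> where "\<Omega> = interior (\<Psi> ` W)"
    have \<Omega>: "open \<Omega>" "\<Psi> Z0 \<in> \<Omega>" "\<Omega> \<subseteq> \<Psi> ` W"
      using \<open>\<Psi> Z0 \<in> interior (\<Psi> ` W)\<close> interior_subset by (auto simp: \<Omega>_def)
    define S where "S = {Z \<in> W. Jprod H1 H2 L (T Z) \<in> A}"
    have "AE Z in lborel. Z \<notin> S"
      using AEZ by eventually_elim (force simp: S_def T_def W_def)
    then obtain S' where "S' \<in> null_sets lborel" "S \<subseteq> S'"
      unfolding eventually_ae_filter by auto
    then have "negligible S"
      unfolding negligible_iff_null_sets by (auto simp: null_sets_completion_iff2)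
    moreover have "\<Psi> differentiable_on S"
      unfolding \<Psi>_def differentiable_on_def differentiable_def
      using chart_has_derivative[OF herm I] has_derivative_at_withinI by blast
    ultimately have "negligible (\<Psi> ` S)"
      by (rule negligible_differentiable_image_negligible[OF order_refl])
    then obtain N where N: "N \<in> null_sets lborel" "\<Psi> ` S \<subseteq> N"
      unfolding negligible_iff_null_sets by (auto simp: null_sets_completion_iff2)
    \<comment> \<open>The nonempty open set \<Omega> is not Lebesgue null, so it contains a point
      with the almost sure property.\<close>
    obtain G where G: "G \<in> \<Omega>" "AE u in \<pi>. u ** G \<notin> N"
    proof (rule ccontr)
      assume "\<not> thesis"
      then have *: "(AE u in \<pi>. u ** G \<notin> N) \<Longrightarrow> G \<notin> \<Omega>" for G using that by blast
      have "AE G in lborel. G \<notin> \<Omega>"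
        using AE_coset_not_null[OF N(1)] by eventually_elim (rule *)
      then have "emeasure lborel \<Omega> = 0"
        using \<Omega>(1) by (subst (asm) AE_iff_measurable[OF _ refl]) auto
      then have "negligible \<Omega>"
        using \<Omega>(1) by (auto simp: negligible_iff_null_sets null_sets_def intro!: null_sets_completionI)
      then show False using open_not_negligible[OF \<Omega>(1)] \<Omega>(2) by auto
    qed
    obtain Z1 where Z1: "Z1 \<in> W" "G = \<Psi> Z1" using G(1) \<Omega>(3) by auto
    let ?u0 = "Jprod H1 H2 L (T Z1)"
    \<comment> \<open>For w in \<open>O'\<close> the matrix w(1 + P Z1) is again a chart value, and
      its unitary factor is w.\<close>
    define O' where "O' = {w. w ** (mat 1 + P Z1) \<in> \<Omega>}"
    have "open O'"
      using open_vimage[OF \<Omega>(1) linear_continuous_on[OF cmat_mult.bounded_linear_left]]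
      by (simp add: O'_def vimage_def)
    have "?u0 \<in> O'" using G(1) Z1 by (simp add: O'_def \<Psi>)
    have "AE u in \<pi>. u ** ?u0 \<notin> A \<inter> O'"
      using haar_unitary G(2)
    proof eventually_elim
      case (elim u)
      show ?case
      proof
        assume u: "u ** ?u0 \<in> A \<inter> O'"
        have uG: "u ** ?u0 ** (mat 1 + P Z1) = u ** G" by (simp add: Z1 \<Psi> matrix_mul_assoc)
        then have "u ** G \<in> \<Omega>" using u by (simp add: O'_def)
        then obtain Z where Z: "Z \<in> W" "u ** G = \<Psi> Z" using \<Omega>(3) by auto
        have "Z \<notin> S" using Z elim(2) N(2) by auto
        have "u ** ?u0 = Jprod H1 H2 L (T Z)"
        proof (rule \<eta>(2)[OF _ JU hP hP])
          show "u ** ?u0 \<in> unitary_group" using elim(1) JU by blast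
          show "norm (P Z1) < \<eta>" "norm (P Z) < \<eta>" using Z Z1 by (auto simp: W_def)
          show "u ** ?u0 ** (mat 1 + P Z1) = Jprod H1 H2 L (T Z) ** (mat 1 + P Z)"
            using uG Z(2) by (simp add: \<Psi>)
        qed
        then show False using \<open>Z \<notin> S\<close> Z(1) u by (simp add: S_def)
      qed
    qed
    then have AE0: "AE u in \<pi>. u \<notin> (\<lambda>u. u ** ?u0) -` (A \<inter> O')" by simp
    have AO: "A \<inter> O' \<in> sets borel" using sets.Int[OF A borel_open[OF \<open>open O'\<close>]] .
    have right: "(\<lambda>u. u ** ?u0) \<in> measurable \<pi> borel" by simp
    have "emeasure \<pi> (A \<inter> O') = emeasure (distr \<pi> borel (\<lambda>u. u ** ?u0)) (A \<inter> O')"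
      by (simp only: haar_right[OF JU])
    also have "\<dots> = emeasure \<pi> ((\<lambda>u. u ** ?u0) -` (A \<inter> O'))"
      using emeasure_distr[OF right AO] by simp
    also have "\<dots> = 0"
      using AE_iff_null_sets[of "(\<lambda>u. u ** ?u0) -` (A \<inter> O')" \<pi>] AE0 measurable_sets[OF right AO]
      by (auto simp: null_sets_def)
    finally have "emeasure \<pi> (A \<inter> O') = 0" .
    then show "\<exists>O' u. open O' \<and> u \<in> O' \<and> u \<in> unitary_group \<and> emeasure \<pi> (A \<inter> O') = 0"
      using \<open>open O'\<close> \<open>?u0 \<in> O'\<close> JU by blast
  qed
qed

end

text \<open>Otherwise there are sets with M-measure below 2^-n and N-measure at least \<epsilon>. By
  Borel-Cantelli their limsup is M-null, yet by continuity from above its N-measure is at least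
  \<epsilon>.\<close>

lemma absolutely_continuous_epsilon_delta:
  assumes "finite_measure M" "finite_measure N" and sets: "sets N = sets M"
    and ac: "\<And>A. A \<in> sets M \<Longrightarrow> emeasure M A = 0 \<Longrightarrow> emeasure N A = 0" and "\<epsilon> > 0"
  obtains \<delta> where "\<delta> > 0" "\<And>A. A \<in> sets M \<Longrightarrow> measure N A \<ge> \<epsilon> \<Longrightarrow> measure M A \<ge> \<delta>"
proof (rule ccontr)
  assume contr: "\<not> thesis"
  interpret M: finite_measure M by fact
  interpret N: finite_measure N by fact
  have "\<exists>A\<in>sets M. measure N A \<ge> \<epsilon> \<and> measure M A < (1 / 2) ^ n" for n :: nat
  proof (rule ccontr)
    assume "\<not> ?thesis"
    then have "\<And>A. A \<in> sets M \<Longrightarrow> measure N A \<ge> \<epsilon> \<Longrightarrow> measure M A \<ge> (1 / 2) ^ n" by force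
    then show False using contr that[of "(1 / 2) ^ n"] by simp
  qed
  then obtain A where A: "\<And>n. A n \<in> sets M" "\<And>n. measure N (A n) \<ge> \<epsilon>" "\<And>n. measure M (A n) < (1 / 2) ^ n"
    by metis
  have sumA: "summable (\<lambda>n. measure M (A n))"
    using A(3) less_imp_le by (intro summable_comparison_test'[OF summable_geometric[of "1 / 2 :: real"]]) auto
  define B where "B n = (\<Union>k\<in>{n..}. A k)" for n
  have B: "B n \<in> sets N" for n using A(1) sets by (auto simp: B_def)
  have "decseq B" by (force simp: decseq_def B_def)
  have "AE x in M. eventually (\<lambda>n. x \<in> space M - A n) sequentially"
    using A(1) sumA by (intro borel_cantelli_AE1) (auto simp: less_top[symmetric])
  then have "AE x in M. x \<notin> (\<Inter>n. B n)"
  proof eventually_elim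
    case (elim x)
    then obtain n where "\<And>k. k \<ge> n \<Longrightarrow> x \<notin> A k" by (auto simp: eventually_sequentially)
    then have "x \<notin> B n" by (auto simp: B_def)
    then show ?case by blast
  qed
  moreover have IB: "(\<Inter>n. B n) \<in> sets M" using B sets by auto
  ultimately have "emeasure M (\<Inter>n. B n) = 0"
    using AE_iff_null_sets[OF IB] by auto
  then have "measure N (\<Inter>n. B n) = 0" using ac[OF IB] by (simp add: measure_def)
  moreover have "(\<lambda>n. measure N (B n)) \<longlonglongrightarrow> measure N (\<Inter>n. B n)"
    using B \<open>decseq B\<close> by (intro N.finite_Lim_measure_decseq) auto
  moreover have "\<epsilon> \<le> measure N (B n)" for n
  proof -
    have "measure N (A n) \<le> measure N (B n)" using B by (intro N.finite_measure_mono) (auto simp: B_def)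
    then show ?thesis using A(2)[of n] by linarith
  qed
  ultimately have "\<epsilon> \<le> 0" by (metis LIMSEQ_le_const)
  then show False using \<open>\<epsilon> > 0\<close> by simp
qed

section \<open>Convolution powers of the one-step law\<close>

context controllable_walk
begin

definition walk :: "nat \<Rightarrow> 'n cmat measure" where
  "walk n = distr (time_law {1..2 * n}) borel (Jprod H1 H2 (2 * n))"

lemma sets_walk [simp, measurable_cong]: "sets (walk n) = sets borel"
  by (simp add: walk_def)

lemma space_walk [simp]: "space (walk n) = UNIV"
  by (simp add: walk_def)

lemma prob_space_time_law: "prob_space (time_law K)"
  by (intro prob_space_PiM density_prob)

lemma prob_space_walk: "prob_space (walk n)"
  unfolding walk_def by (intro prob_space.prob_space_distr prob_space_time_law) simp

lemma AE_walk:
  assumes "Measurable.pred borel P"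
  shows "(AE u in walk n. P u) \<longleftrightarrow> (AE s in time_law {1..2 * n}. P (Jprod H1 H2 (2 * n) s))"
  unfolding walk_def using assms by (intro AE_distr_iff) (auto simp: pred_def)

lemma walk_unitary: "AE u in walk n. u \<in> unitary_group"
  by (subst AE_walk) (auto simp: herm)

text \<open>Continuity maps a small box to the right of \<open>s\<close> into \<open>O'\<close>, and
  this box has positive probability. It provides the group elements used for translating local
  statements.\<close>

lemma walk_open_pos:
  assumes "\<And>j. s j \<ge> 0" "open O'" "Jprod H1 H2 (2 * n) s \<in> O'"
  shows "emeasure (walk n) O' > 0"
proof -
  let ?J = "{1..2 * n}"
  obtain \<delta> where \<delta>: "\<delta> > 0" "\<And>t. (\<And>j. j \<in> ?J \<Longrightarrow> \<bar>t j - s j\<bar> < \<delta>) \<Longrightarrow> Jprod H1 H2 (2 * n) t \<in> O'"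
    by (rule sequential_box_neighbourhood[of ?J s "Jprod H1 H2 (2 * n)" O'])
       (use assms in \<open>auto intro: tendsto_Jprod\<close>)
  have J: "Jprod H1 H2 (2 * n) \<in> measurable (time_law ?J) borel" by simp
  have "0 < emeasure (time_law ?J) (Pi\<^sub>E ?J (\<lambda>j. {s j<..<s j + \<delta>}))"
    using assms(1) \<delta>(1) by (intro box_pos) auto
  also have "\<dots> \<le> emeasure (time_law ?J) (Jprod H1 H2 (2 * n) -` O' \<inter> space (time_law ?J))"
  proof (rule emeasure_mono)
    show "Pi\<^sub>E ?J (\<lambda>j. {s j<..<s j + \<delta>}) \<subseteq> Jprod H1 H2 (2 * n) -` O' \<inter> space (time_law ?J)"
    proof
      fix t assume t: "t \<in> Pi\<^sub>E ?J (\<lambda>j. {s j<..<s j + \<delta>})"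
      have "\<bar>t j - s j\<bar> < \<delta>" if "j \<in> ?J" for j
        using PiE_mem[OF t that] by auto
      then have "Jprod H1 H2 (2 * n) t \<in> O'" by (rule \<delta>(2))
      then show "t \<in> Jprod H1 H2 (2 * n) -` O' \<inter> space (time_law ?J)"
        using t by (auto simp: space_PiM PiE_iff)
    qed
    show "Jprod H1 H2 (2 * n) -` O' \<inter> space (time_law ?J) \<in> sets (time_law ?J)"
      using measurable_sets[OF J borel_open[OF assms(2)]] .
  qed
  also have "\<dots> = emeasure (walk n) O'"
    unfolding walk_def using assms(2) by (intro emeasure_distr[symmetric] J) auto
  finally show ?thesis .
qed

text \<open>The first 2a times and the following 2b are independent, and a shift by the even number
  2a respects the alternation of Hamiltonians. The later block multiplies from the left.\<close>

lemma walk_add: "walk (a + b) = distr (walk b \<Otimes>\<^sub>M walk a) borel (\<lambda>(v, u). v ** u)"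
proof -
  let ?Ka = "{1..2 * a}" and ?Kb = "{1..2 * b}" and ?K = "{2 * a + 1..2 * a + 2 * b}"
  interpret P: product_sigma_finite "\<lambda>_ :: nat. density lborel F" by (rule product_sigma)
  interpret Wb: prob_space "walk b" by (rule prob_space_walk)
  interpret Wa: prob_space "walk a" by (rule prob_space_walk)
  have shift: "distr (time_law ?K) (time_law ?Kb) (\<lambda>\<omega>. \<lambda>j\<in>?Kb. \<omega> (2 * a + j)) = time_law ?Kb"
    using distr_PiM_reindex[of ?K "\<lambda>_. density lborel F" "\<lambda>j. 2 * a + j" ?Kb] density_prob
    by (auto simp: inj_on_def)
  have shift_m: "(\<lambda>\<omega>. \<lambda>j\<in>?Kb. \<omega> (2 * a + j)) \<in> measurable (time_law ?K) (time_law ?Kb)"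
    by (intro measurable_restrict measurable_component_singleton) auto
  have Jb [measurable]: "Jprod H1 H2 (2 * b) \<in> measurable (time_law ?Kb) borel" by simp
  have Ja [measurable]: "Jprod H1 H2 (2 * a) \<in> measurable (time_law ?Ka) borel" by simp
  have Jab [measurable]: "Jprod H1 H2 (2 * (a + b)) \<in> measurable (time_law {1..2 * (a + b)}) borel" by simp
  have shifted: "(\<lambda>\<omega>. Jprod H1 H2 (2 * b) (\<lambda>j\<in>?Kb. \<omega> (2 * a + j))) \<in> measurable (time_law ?K) borel"
    by (rule measurable_compose[OF shift_m Jb])
  have walkb: "walk b = distr (time_law ?K) borel (\<lambda>\<omega>. Jprod H1 H2 (2 * b) (\<lambda>j\<in>?Kb. \<omega> (2 * a + j)))"
    unfolding walk_def by (subst shift[symmetric], subst distr_distr[OF Jb shift_m]) (simp add: o_def)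
  let ?q = "\<lambda>(x, y). (Jprod H1 H2 (2 * b) (\<lambda>j\<in>?Kb. x (2 * a + j)), Jprod H1 H2 (2 * a) y)"
  have pair: "walk b \<Otimes>\<^sub>M walk a = distr (time_law ?K \<Otimes>\<^sub>M time_law ?Ka) (borel \<Otimes>\<^sub>M borel) ?q"
    using Wa.sigma_finite_measure_axioms unfolding walkb walk_def[of a]
    by (intro pair_measure_distr shifted Ja)
  have q: "?q \<in> measurable (time_law ?K \<Otimes>\<^sub>M time_law ?Ka) (borel \<Otimes>\<^sub>M borel)"
    unfolding case_prod_beta
    by (intro measurable_Pair measurable_compose[OF measurable_fst shifted] measurable_compose[OF measurable_snd Ja])
  have mult: "(\<lambda>(v :: 'n cmat, u :: 'n cmat). v ** u) \<in> measurable (borel \<Otimes>\<^sub>M borel) borel"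
    unfolding case_prod_beta by measurable
  have 1: "distr (walk b \<Otimes>\<^sub>M walk a) borel (\<lambda>(v, u). v ** u) =
     distr (time_law ?K \<Otimes>\<^sub>M time_law ?Ka) borel
      (\<lambda>(x, y). Jprod H1 H2 (2 * b) (\<lambda>j\<in>?Kb. x (2 * a + j)) ** Jprod H1 H2 (2 * a) y)"
    unfolding pair distr_distr[OF mult q] by (simp only: o_def case_prod_beta' fst_conv snd_conv)
  have union: "?K \<union> ?Ka = {1..2 * (a + b)}" "?K \<inter> ?Ka = {}" by auto
  have distr: "distr (time_law ?K \<Otimes>\<^sub>M time_law ?Ka) (time_law {1..2 * (a + b)}) (merge ?K ?Ka) = time_law {1..2 * (a + b)}"
    using P.distr_merge[of ?K ?Ka] union by simp
  have merge: "merge ?K ?Ka \<in> measurable (time_law ?K \<Otimes>\<^sub>M time_law ?Ka) (time_law {1..2 * (a + b)})"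
    using measurable_merge[of ?K ?Ka "\<lambda>_. density lborel F"] unfolding union .
  have "walk (a + b) = distr (time_law ?K \<Otimes>\<^sub>M time_law ?Ka) borel (\<lambda>p. Jprod H1 H2 (2 * (a + b)) (merge ?K ?Ka p))"
    unfolding walk_def by (subst distr[symmetric], subst distr_distr[OF Jab merge]) (simp add: o_def)
  also have "(\<lambda>p. Jprod H1 H2 (2 * (a + b)) (merge ?K ?Ka p)) =
      (\<lambda>(x, y). Jprod H1 H2 (2 * b) (\<lambda>j\<in>?Kb. x (2 * a + j)) ** Jprod H1 H2 (2 * a) y)"
  proof
    fix p :: "(nat \<Rightarrow> real) \<times> (nat \<Rightarrow> real)"
    obtain x y where p: "p = (x, y)" by (cases p)
    have "Jprod H1 H2 (2 * a + 2 * b) (merge ?K ?Ka (x, y)) =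
        Jprod H1 H2 (2 * b) (\<lambda>j. merge ?K ?Ka (x, y) (2 * a + j)) ** Jprod H1 H2 (2 * a) (merge ?K ?Ka (x, y))"
      by (rule Jprod_append) simp
    also have "Jprod H1 H2 (2 * b) (\<lambda>j. merge ?K ?Ka (x, y) (2 * a + j)) = Jprod H1 H2 (2 * b) (\<lambda>j\<in>?Kb. x (2 * a + j))"
      by (rule Jprod_cong) (auto simp: merge_def)
    also have "Jprod H1 H2 (2 * a) (merge ?K ?Ka (x, y)) = Jprod H1 H2 (2 * a) y"
      by (rule Jprod_cong) (auto simp: merge_def)
    finally show "Jprod H1 H2 (2 * (a + b)) (merge ?K ?Ka p) =
        (case p of (x, y) \<Rightarrow> Jprod H1 H2 (2 * b) (\<lambda>j\<in>?Kb. x (2 * a + j)) ** Jprod H1 H2 (2 * a) y)"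
      unfolding p distrib_left prod.case .
  qed
  finally show ?thesis unfolding 1 .
qed

end

context controllable_walk_haar
begin

text \<open>Exhaustion: some walk-null set A0 has maximal Haar measure, so every other walk-null set
  exceeds it by a \<pi>-null set only. The neighbourhood found for A0 then serves all of
  them.\<close>

lemma uniform_local_absolute_continuity:
  obtains n O' u where "open O'" "u \<in> O'" "u \<in> unitary_group"
    "\<And>A. A \<in> sets borel \<Longrightarrow> emeasure (walk n) A = 0 \<Longrightarrow> emeasure \<pi> (A \<inter> O') = 0"
proof -
  obtain n where n: "\<And>A. A \<in> sets borel \<Longrightarrow> AE s in time_law {1..2 * n}. Jprod H1 H2 (2 * n) s \<notin> A \<Longrightarrow>
    \<exists>O' u. open O' \<and> u \<in> O' \<and> u \<in> unitary_group \<and> emeasure \<pi> (A \<inter> O') = 0"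
    using local_absolute_continuity by blast
  define \<N> where "\<N> = {A \<in> sets borel. emeasure (walk n) A = 0}"
  have \<N>_null: "\<N> = null_sets (walk n)" by (auto simp: \<N>_def null_sets_def)
  define c where "c = Sup (measure \<pi> ` \<N>)"
  have bdd: "bdd_above (measure \<pi> ` \<N>)" by (intro bdd_aboveI[of _ 1]) auto
  have ne: "{} \<in> \<N>" by (simp add: \<N>_def)
  \<comment> \<open>Null sets come within 1/(i+1) of the supremum; their countable union is again
    null and attains it.\<close>
  have "\<exists>A\<in>\<N>. c - inverse (real (Suc i)) < measure \<pi> A" for i
    using less_cSup_iff[OF _ bdd, of "c - inverse (real (Suc i))"] ne by (auto simp: c_def)
  then obtain B where B: "\<And>i. B i \<in> \<N>" "\<And>i. c - inverse (real (Suc i)) < measure \<pi> (B i)" by metis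
  define A0 where "A0 = (\<Union>i. B i)"
  have A0: "A0 \<in> \<N>" unfolding A0_def using B(1) unfolding \<N>_null by (rule null_sets_UN)
  have \<N>_borel: "A \<in> \<N> \<Longrightarrow> A \<in> sets \<pi>" for A by (simp add: \<N>_def sets_haar)
  have "c - inverse (real (Suc i)) \<le> measure \<pi> A0" for i
  proof -
    have "measure \<pi> (B i) \<le> measure \<pi> A0"
      using A0 \<N>_borel by (intro finite_measure_mono) (auto simp: A0_def)
    then show ?thesis using B(2)[of i] by simp
  qed
  moreover have "(\<lambda>i. c - inverse (real (Suc i))) \<longlonglongrightarrow> c - 0"
    by (intro tendsto_intros LIMSEQ_inverse_real_of_nat)
  ultimately have "c - 0 \<le> measure \<pi> A0" by (intro LIMSEQ_le_const2) auto
  then have c: "c \<le> measure \<pi> A0" by simp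
  have max: "measure \<pi> (A - A0) = 0" if "A \<in> \<N>" for A
  proof -
    have "A \<union> A0 \<in> \<N>" using that A0 unfolding \<N>_null by (rule null_sets.Un)
    then have "measure \<pi> (A \<union> A0) \<le> c" unfolding c_def using bdd by (intro cSup_upper) auto
    moreover have "measure \<pi> (A \<union> A0) = measure \<pi> A0 + measure \<pi> (A - A0)"
      using \<N>_borel[OF that] \<N>_borel[OF A0] finite_measure_Union'[of A0 A] by (simp add: Un_commute)
    ultimately have "measure \<pi> (A - A0) \<le> 0" using c by simp
    then show ?thesis by (simp add: measure_le_0_iff)
  qed
  have "AE u in walk n. u \<notin> A0"
    using A0 by (intro AE_I[of _ _ A0]) (auto simp: \<N>_def)
  then have "AE s in time_law {1..2 * n}. Jprod H1 H2 (2 * n) s \<notin> A0"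
    using A0 by (subst (asm) AE_walk) (auto simp: \<N>_def pred_def)
  then obtain O' u where O': "open O'" "u \<in> O'" "u \<in> unitary_group" "emeasure \<pi> (A0 \<inter> O') = 0"
    using n[of A0] A0 by (auto simp: \<N>_def)
  show ?thesis
  proof (rule that[OF O'(1-3)])
    fix A :: "'n cmat set" assume A: "A \<in> sets borel" "emeasure (walk n) A = 0"
    then have "A \<in> \<N>" by (simp add: \<N>_def)
    have "emeasure \<pi> (A \<inter> O') \<le> emeasure \<pi> ((A0 \<inter> O') \<union> (A - A0))"
      using A(1) \<N>_borel[OF A0] O'(1) by (intro emeasure_mono) (auto simp: sets_haar)
    also have "\<dots> \<le> emeasure \<pi> (A0 \<inter> O') + emeasure \<pi> (A - A0)"
      using A(1) \<N>_borel[OF A0] O'(1) by (intro emeasure_subadditive) (auto simp: sets_haar)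
    also have "\<dots> = 0" using O'(4) max[OF \<open>A \<in> \<N>\<close>] by (simp add: emeasure_eq_measure)
    finally show "emeasure \<pi> (A \<inter> O') = 0" by simp
  qed
qed

text \<open>If \<open>A\<close> is null for n + m steps, then for almost every product v of the last
  m steps the set v^-1 A is null for n steps, hence \<pi>-null in \<open>O'\<close>; by left
  invariance \<open>A\<close> is \<pi>-null in v O'. Every unitary g lies in such a
  translate.\<close>

lemma haar_absolutely_continuous:
  obtains m where "m > 0" "\<And>A. A \<in> sets borel \<Longrightarrow> emeasure (walk m) A = 0 \<Longrightarrow> emeasure \<pi> A = 0"
proof -
  obtain n O' u0 where O': "open O'" "u0 \<in> O'" "u0 \<in> unitary_group"
    "\<And>A. A \<in> sets borel \<Longrightarrow> emeasure (walk n) A = 0 \<Longrightarrow> emeasure \<pi> (A \<inter> O') = 0"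
    by (rule uniform_local_absolute_continuity) blast
  obtain m where m: "m > 0" "\<And>U. U \<in> unitary_group \<Longrightarrow> \<exists>s. (\<forall>j. s j \<ge> 0) \<and> Jprod H1 H2 (2 * m) s = U"
    using U_controllable_even[OF ctrl] by blast
  interpret Wn: prob_space "walk n" by (rule prob_space_walk)
  interpret Wm: prob_space "walk m" by (rule prob_space_walk)
  show ?thesis
  proof (rule that[of "n + m"])
    show "n + m > 0" using m(1) by simp
    fix A :: "'n cmat set" assume A [measurable]: "A \<in> sets borel" and null: "emeasure (walk (n + m)) A = 0"
    interpret PW: pair_sigma_finite "walk m" "walk n" ..
    have "AE p in walk m \<Otimes>\<^sub>M walk n. fst p ** snd p \<notin> A"
    proof -
      have "AE w in walk (n + m). w \<notin> A"
        using null by (intro AE_I[of _ _ A]) auto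
      then show ?thesis
        unfolding walk_add[of n m] by (subst (asm) AE_distr_iff) (auto simp: case_prod_beta)
    qed
    then have "AE v in walk m. AE u in walk n. v ** u \<notin> A"
      using PW.AE_pair by fastforce
    then have good: "AE v in walk m. emeasure \<pi> ({u. v ** u \<in> A} \<inter> O') = 0"
    proof eventually_elim
      case (elim v)
      have set: "{u. v ** u \<in> A} \<in> sets borel"
      proof -
        have "{u \<in> space borel. v ** u \<in> A} \<in> sets borel" by measurable
        then show ?thesis by simp
      qed
      have "emeasure (walk n) {u. v ** u \<in> A} = 0"
        using elim set AE_iff_null_sets[of "{u. v ** u \<in> A}" "walk n"] by auto
      with set show ?case by (rule O'(4))
    qed
    have nbhd: "\<exists>W. open W \<and> g \<in> W \<and> emeasure \<pi> (A \<inter> W) = 0" if g: "g \<in> unitary_group" for g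
    proof -
      have lin: "bounded_linear (\<lambda>v. cmat_adj v ** g)"
        using bounded_linear_compose[OF cmat_mult.bounded_linear_left bounded_linear_cmat_adj] .
      \<comment> \<open>These are the v with g in v O'. The open set contains g u0*, reachable in m
        steps, so it has positive mass and contains a v that is good for \<open>A\<close>.\<close>
      define V where "V = {v. cmat_adj v ** g \<in> O'}"
      have "open V"
        using open_vimage[OF O'(1) linear_continuous_on[OF lin]] by (simp add: V_def vimage_def)
      have "g ** cmat_adj u0 \<in> V"
        using O'(2,3) g by (simp add: V_def cmat_adj_mult flip: matrix_mul_assoc)
      moreover have "g ** cmat_adj u0 \<in> unitary_group" using g O'(3) by blast
      ultimately have pos: "emeasure (walk m) V > 0"
        using m(2) walk_open_pos[OF _ \<open>open V\<close>, of _ m] by metis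
      have "\<exists>v\<in>V. v \<in> unitary_group \<and> emeasure \<pi> ({u. v ** u \<in> A} \<inter> O') = 0"
      proof (rule ccontr)
        assume "\<not> ?thesis"
        then have *: "v \<notin> V" if "v \<in> unitary_group" "emeasure \<pi> ({u. v ** u \<in> A} \<inter> O') = 0" for v
          using that by blast
        have "AE v in walk m. v \<notin> V"
          using walk_unitary good by eventually_elim (rule *)
        then have "emeasure (walk m) V = 0"
          using AE_iff_null_sets[of V "walk m"] borel_open[OF \<open>open V\<close>] by auto
        then show False using pos by simp
      qed
      then obtain v where v: "v \<in> V" "v \<in> unitary_group" "emeasure \<pi> ({u. v ** u \<in> A} \<inter> O') = 0"
        by blast
      define W where "W = {w. cmat_adj v ** w \<in> O'}"
      have W: "open W"
        using open_vimage[OF O'(1) linear_continuous_on[OF cmat_mult.bounded_linear_right]]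
        by (simp add: W_def vimage_def)
      have "g \<in> W" using v(1) by (simp add: V_def W_def)
      have AW: "A \<inter> W \<in> sets borel" using W by (intro sets.Int A borel_open)
      have "emeasure \<pi> (A \<inter> W) = emeasure (distr \<pi> borel (\<lambda>u. v ** u)) (A \<inter> W)"
        using v(2) by (subst haar_left) auto
      also have "\<dots> = emeasure \<pi> ((\<lambda>u. v ** u) -` (A \<inter> W) \<inter> space \<pi>)"
        using AW by (intro emeasure_distr) auto
      also have "(\<lambda>u. v ** u) -` (A \<inter> W) \<inter> space \<pi> = {u. v ** u \<in> A} \<inter> O'"
        using v(2) by (auto simp: W_def)
      finally show ?thesis using W \<open>g \<in> W\<close> v(3) by auto
    qed
    \<comment> \<open>The neighbourhoods are indexed by uncountably many g; Lindelof reduces them to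
      countably many null sets.\<close>
    define \<F> where "\<F> = {W. open W \<and> emeasure \<pi> (A \<inter> W) = 0}"
    obtain \<F>' where \<F>': "\<F>' \<subseteq> \<F>" "countable \<F>'" "\<Union>\<F>' = \<Union>\<F>"
      by (rule Lindelof[of \<F>]) (auto simp: \<F>_def)
    have "AE w in \<pi>. \<forall>W\<in>\<F>'. w \<notin> A \<inter> W"
    proof (subst AE_ball_countable[OF \<F>'(2)], rule ballI)
      fix W assume "W \<in> \<F>'"
      then have "open W" "emeasure \<pi> (A \<inter> W) = 0" using \<F>'(1) by (auto simp: \<F>_def)
      then show "AE w in \<pi>. w \<notin> A \<inter> W"
        by (intro AE_I[of _ _ "A \<inter> W"]) (auto simp: sets_haar)
    qed
    then have "AE w in \<pi>. w \<notin> A"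
      using haar_unitary
    proof eventually_elim
      case (elim w)
      then obtain W where "W \<in> \<F>" "w \<in> W" using nbhd[of w] by (auto simp: \<F>_def)
      then obtain W' where "W' \<in> \<F>'" "w \<in> W'" using \<F>'(3) by blast
      then show ?case using elim(1) by blast
    qed
    then show "emeasure \<pi> A = 0"
      using AE_iff_null_sets[of A \<pi>] by (auto simp: sets_haar)
  qed
qed

end

section \<open>Uniform ergodicity\<close>

context controllable_walk_haar
begin

section \<open>Transition kernel and Doeblin condition\<close>

definition trans_prob :: "nat \<Rightarrow> 'n cmat set \<Rightarrow> 'n cmat \<Rightarrow> real" where
  "trans_prob n A g = measure (walk n) {u. u ** g \<in> A}"

lemma translate_borel:
  assumes "A \<in> sets borel"
  shows "{u :: 'n cmat. u ** g \<in> A} \<in> sets borel" "{u :: 'n cmat. g ** u \<in> A} \<in> sets borel"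
proof -
  have "{u \<in> space borel. u ** g \<in> A} \<in> sets (borel :: 'n cmat measure)"
    "{u \<in> space borel. g ** u \<in> A} \<in> sets (borel :: 'n cmat measure)"
    using assms by measurable
  then show "{u :: 'n cmat. u ** g \<in> A} \<in> sets borel" "{u :: 'n cmat. g ** u \<in> A} \<in> sets borel" by simp_all
qed

lemma translate_pair:
  assumes "A \<in> sets borel"
  shows "{p :: 'n cmat \<times> 'n cmat. fst p ** snd p ** (g :: 'n cmat) \<in> A} \<in> sets (borel \<Otimes>\<^sub>M borel)"
proof -
  have "{p \<in> space (borel \<Otimes>\<^sub>M borel). fst p ** snd p ** g \<in> A} \<in> sets ((borel :: 'n cmat measure) \<Otimes>\<^sub>M (borel :: 'n cmat measure))"
    using assms by measurable
  then show ?thesis by (simp add: space_pair_measure)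
qed

lemma ennreal_trans_prob: "ennreal (trans_prob n A g) = emeasure (walk n) {u. u ** g \<in> A}"
proof -
  interpret W: prob_space "walk n" by (rule prob_space_walk)
  show ?thesis by (simp add: trans_prob_def W.emeasure_eq_measure)
qed

lemma trans_prob_bounds: "0 \<le> trans_prob n A g" "trans_prob n A g \<le> 1"
proof -
  interpret W: prob_space "walk n" by (rule prob_space_walk)
  show "0 \<le> trans_prob n A g" "trans_prob n A g \<le> 1" by (simp_all add: trans_prob_def)
qed

lemma trans_prob_measurable [measurable]:
  assumes "A \<in> sets borel"
  shows "trans_prob n A \<in> borel_measurable borel"
proof -
  interpret W: prob_space "walk n" by (rule prob_space_walk)
  have "{p \<in> space (borel \<Otimes>\<^sub>M walk n). snd p ** fst p \<in> A} \<in> sets (borel \<Otimes>\<^sub>M walk n)"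
    using assms by measurable
  from W.measurable_emeasure_Pair[OF this]
  have "(\<lambda>g. emeasure (walk n) {u. u ** g \<in> A}) \<in> borel_measurable borel"
    by (simp add: space_pair_measure vimage_def)
  then have "(\<lambda>g. enn2real (emeasure (walk n) {u. u ** g \<in> A})) \<in> borel_measurable borel"
    by measurable
  then show ?thesis by (simp add: trans_prob_def[abs_def] measure_def)
qed

text \<open>Chapman-Kolmogorov, conditioned on the first m steps: the kernel of n + m steps is the
  m-step average of the n-step kernel, the form in which a contraction of oscillations can be
  iterated.\<close>

lemma trans_prob_add:
  assumes A: "A \<in> sets borel"
  shows "trans_prob (n + m) A g = (\<integral>u. trans_prob n A (u ** g) \<partial>walk m)"
proof -
  interpret Wn: prob_space "walk n" by (rule prob_space_walk)
  interpret Wm: prob_space "walk m" by (rule prob_space_walk)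
  interpret P: pair_sigma_finite "walk n" "walk m" ..
  let ?X = "{p. fst p ** snd p ** g \<in> A}"
  have X: "?X \<in> sets (walk n \<Otimes>\<^sub>M walk m)"
    using translate_pair[OF A, of g] by (simp cong: sets_pair_measure_cong)
  have mult: "(\<lambda>(v, u). v ** u) \<in> measurable (walk n \<Otimes>\<^sub>M walk m) borel"
    unfolding case_prod_beta by measurable
  have "ennreal (trans_prob (n + m) A g) = emeasure (walk (m + n)) {u. u ** g \<in> A}"
    by (simp add: ennreal_trans_prob add.commute)
  also have "\<dots> = emeasure (walk n \<Otimes>\<^sub>M walk m) ((\<lambda>(v, u). v ** u) -` {u. u ** g \<in> A} \<inter> space (walk n \<Otimes>\<^sub>M walk m))"
    unfolding walk_add by (rule emeasure_distr[OF mult translate_borel(1)[OF A]])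
  also have "(\<lambda>(v, u). v ** u) -` {u. u ** g \<in> A} \<inter> space (walk n \<Otimes>\<^sub>M walk m) = ?X"
    by (auto simp: space_pair_measure)
  also have "emeasure (walk n \<Otimes>\<^sub>M walk m) ?X = (\<integral>\<^sup>+ u. emeasure (walk n) ((\<lambda>v. (v, u)) -` ?X) \<partial>walk m)"
    by (rule P.emeasure_pair_measure_alt2[OF X])
  also have "\<dots> = (\<integral>\<^sup>+ u. ennreal (trans_prob n A (u ** g)) \<partial>walk m)"
    by (simp add: ennreal_trans_prob vimage_def matrix_mul_assoc)
  finally have *: "ennreal (trans_prob (n + m) A g) = (\<integral>\<^sup>+ u. ennreal (trans_prob n A (u ** g)) \<partial>walk m)" .
  have "(\<lambda>u. trans_prob n A (u ** g)) \<in> borel_measurable (walk m)"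
    using trans_prob_measurable[OF A] by measurable
  then have "(\<integral>u. trans_prob n A (u ** g) \<partial>walk m) = enn2real (\<integral>\<^sup>+ u. ennreal (trans_prob n A (u ** g)) \<partial>walk m)"
    by (intro integral_eq_nn_integral) (auto simp: trans_prob_bounds)
  then show ?thesis unfolding *[symmetric] by (simp add: trans_prob_bounds)
qed

text \<open>By Fubini the walk may be integrated last; for each fixed unitary u, left invariance
  gives \<pi>(A).\<close>

lemma haar_invariant:
  assumes A: "A \<in> sets borel"
  shows "(\<integral>g. trans_prob n A g \<partial>\<pi>) = measure \<pi> A"
proof -
  interpret W: prob_space "walk n" by (rule prob_space_walk)
  interpret P: pair_sigma_finite "walk n" \<pi> ..
  let ?X = "{p. fst p ** snd p \<in> A}"
  have X: "?X \<in> sets (walk n \<Otimes>\<^sub>M \<pi>)"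
    using translate_pair[OF A, of "mat 1"] by (simp add: sets_haar cong: sets_pair_measure_cong)
  have "(\<integral>\<^sup>+ g. ennreal (trans_prob n A g) \<partial>\<pi>) = (\<integral>\<^sup>+ g. emeasure (walk n) ((\<lambda>v. (v, g)) -` ?X) \<partial>\<pi>)"
    by (simp add: ennreal_trans_prob vimage_def)
  also have "\<dots> = emeasure (walk n \<Otimes>\<^sub>M \<pi>) ?X"
    by (rule P.emeasure_pair_measure_alt2[OF X, symmetric])
  also have "\<dots> = (\<integral>\<^sup>+ u. emeasure \<pi> (Pair u -` ?X) \<partial>walk n)"
    by (rule emeasure_pair_measure_alt[OF X])
  also have "\<dots> = (\<integral>\<^sup>+ u. emeasure \<pi> A \<partial>walk n)"
  proof (rule nn_integral_cong_AE, use walk_unitary in eventually_elim)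
    fix u :: "'n cmat" assume u: "u \<in> unitary_group"
    have "emeasure \<pi> A = emeasure (distr \<pi> borel (\<lambda>g. u ** g)) A" using u by (subst haar_left) auto
    also have "\<dots> = emeasure \<pi> (Pair u -` ?X)"
      using A by (subst emeasure_distr) (auto simp: vimage_def)
    finally show "emeasure \<pi> (Pair u -` ?X) = emeasure \<pi> A" by simp
  qed
  also have "\<dots> = emeasure \<pi> A" using W.emeasure_space_1 by simp
  finally have *: "(\<integral>\<^sup>+ g. ennreal (trans_prob n A g) \<partial>\<pi>) = emeasure \<pi> A" .
  have "trans_prob n A \<in> borel_measurable \<pi>"
    using trans_prob_measurable[OF A] by (simp cong: measurable_cong_sets add: sets_haar)
  then have "(\<integral>g. trans_prob n A g \<partial>\<pi>) = enn2real (\<integral>\<^sup>+ g. ennreal (trans_prob n A g) \<partial>\<pi>)"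
    by (intro integral_eq_nn_integral) (auto simp: trans_prob_bounds)
  then show ?thesis by (simp add: * measure_def)
qed

lemma doeblin_condition:
  obtains m \<delta> where "m > 0" "\<delta> > 0" "\<delta> \<le> 1"
    "\<And>A g. A \<in> sets borel \<Longrightarrow> measure \<pi> A \<ge> 1 / 2 \<Longrightarrow> g \<in> unitary_group \<Longrightarrow> trans_prob m A g \<ge> \<delta>"
proof -
  obtain m where m: "m > 0" "\<And>A. A \<in> sets borel \<Longrightarrow> emeasure (walk m) A = 0 \<Longrightarrow> emeasure \<pi> A = 0"
    by (rule haar_absolutely_continuous) blast
  interpret W: prob_space "walk m" by (rule prob_space_walk)
  obtain \<delta> where \<delta>: "\<delta> > 0"
    "\<And>A. A \<in> sets (walk m) \<Longrightarrow> measure \<pi> A \<ge> 1 / 2 \<Longrightarrow> measure (walk m) A \<ge> \<delta>"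
  proof (rule absolutely_continuous_epsilon_delta[of "walk m" \<pi> "1 / 2"])
    show "finite_measure (walk m)" "finite_measure \<pi>" by unfold_locales
  qed (use m in \<open>auto simp: sets_haar\<close>)
  show ?thesis
  proof (rule that[of m \<delta>])
    have "measure \<pi> UNIV = 1" using prob_space by simp
    \<comment> \<open>The whole space has Haar measure 1, so \<delta> bounds a probability; this
      keeps 1 - \<delta>/2 positive.\<close>
    then have "\<delta> \<le> measure (walk m) UNIV" by (intro \<delta>(2)) auto
    then show "\<delta> \<le> 1" using W.prob_le_1[of UNIV] by linarith
    fix A and g :: "'n cmat" assume A: "A \<in> sets borel" "measure \<pi> A \<ge> 1 / 2" and g: "g \<in> unitary_group"
    have "measure \<pi> A = measure (distr \<pi> borel (\<lambda>u. u ** g)) A" by (simp add: haar_right[OF g])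
    also have "\<dots> = measure \<pi> {u. u ** g \<in> A}"
      using A(1) by (subst measure_distr) (auto simp: vimage_def)
    finally show "trans_prob m A g \<ge> \<delta>"
      unfolding trans_prob_def using A translate_borel(1)[OF A(1)] by (intro \<delta>(2)) auto
  qed (use m \<delta> in auto)
qed

text \<open>
  One of the sets where h lies above and below its midrange has Haar measure at least 1/2, and it
  is charged uniformly by the Doeblin condition; this moves the corresponding bound.
\<close>

lemma oscillation_contracts:
  fixes h :: "'n cmat \<Rightarrow> real"
  assumes doeblin: "\<And>A g. A \<in> sets borel \<Longrightarrow> measure \<pi> A \<ge> 1 / 2 \<Longrightarrow> g \<in> unitary_group \<Longrightarrow> trans_prob m A g \<ge> \<delta>"
    and h [measurable]: "h \<in> borel_measurable borel" and bnd: "\<And>g. g \<in> unitary_group \<Longrightarrow> lo \<le> h g \<and> h g \<le> hi"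
  obtains lo' hi' where "hi' - lo' = (1 - \<delta> / 2) * (hi - lo)"
    "\<And>g. g \<in> unitary_group \<Longrightarrow> lo' \<le> (\<integral>u. h (u ** g) \<partial>walk m) \<and> (\<integral>u. h (u ** g) \<partial>walk m) \<le> hi'"
proof -
  interpret W: prob_space "walk m" by (rule prob_space_walk)
  have lohi: "lo \<le> hi" using bnd[OF unitary_mat_1] by linarith
  let ?mid = "(lo + hi) / 2"
  define A where "A = {x. h x \<ge> ?mid}"
  have A: "A \<in> sets borel"
  proof -
    have "{x \<in> space borel. h x \<ge> ?mid} \<in> sets borel" by measurable
    then show ?thesis by (simp add: A_def)
  qed
  have int: "integrable (walk m) (\<lambda>u. h (u ** g))" if g: "g \<in> unitary_group" for g
  proof (rule W.integrable_const_bound[of _ "max \<bar>lo\<bar> \<bar>hi\<bar>"])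
    show "AE u in walk m. norm (h (u ** g)) \<le> max \<bar>lo\<bar> \<bar>hi\<bar>"
      using walk_unitary
    proof eventually_elim
      case (elim u)
      then show ?case using bnd[OF unitary_mult[OF elim g]] by auto
    qed
  qed measurable
  have int_ind: "(\<integral>u. (indicator B (u ** g) :: real) \<partial>walk m) = trans_prob m B g" for B :: "'n cmat set" and g
  proof -
    have "(\<integral>u. (indicator B (u ** g) :: real) \<partial>walk m) = (\<integral>u. indicator {u. u ** g \<in> B} u \<partial>walk m)"
      by (intro Bochner_Integration.integral_cong) (auto simp: indicator_def)
    then show ?thesis by (simp add: trans_prob_def)
  qed
  have int_ind_i: "integrable (walk m) (\<lambda>u. indicator B (u ** g) :: real)" if "B \<in> sets borel" for B and g :: "'n cmat"
  proof (rule W.integrable_const_bound[of _ 1])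
    show "(\<lambda>u. indicator B (u ** g) :: real) \<in> borel_measurable (walk m)"
      using that by measurable
  qed (auto simp: indicator_def)
  show ?thesis
  proof (cases "measure \<pi> A \<ge> 1 / 2")
    case True
    \<comment> \<open>On A the function exceeds \<open>lo\<close> by at least half the range, and A
      is hit with probability at least \<delta>: the lower bound rises by \<delta>/2 of the
      range.\<close>
    show ?thesis
    proof (rule that[of hi "lo + \<delta> * (hi - lo) / 2"])
      show "hi - (lo + \<delta> * (hi - lo) / 2) = (1 - \<delta> / 2) * (hi - lo)" by (simp add: field_simps)
      fix g :: "'n cmat" assume g: "g \<in> unitary_group"
      have "lo + \<delta> * (hi - lo) / 2 \<le> lo + trans_prob m A g * (hi - lo) / 2"
        using doeblin[OF A True g] lohi by (simp add: mult_right_mono)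
      also have "\<dots> = (\<integral>u. lo + indicator A (u ** g) * ((hi - lo) / 2) \<partial>walk m)"
        using int_ind_i[OF A, of g] by (simp add: int_ind W.prob_space[unfolded space_walk])
      also have "\<dots> \<le> (\<integral>u. h (u ** g) \<partial>walk m)"
      proof (rule integral_mono_AE)
        show "AE u in walk m. lo + indicator A (u ** g) * ((hi - lo) / 2) \<le> h (u ** g)"
          using walk_unitary
        proof eventually_elim
          case (elim u)
          then show ?case using bnd[OF unitary_mult[OF elim g]]
            by (auto simp: indicator_def A_def field_simps)
        qed
      qed (use int_ind_i[OF A, of g] int[OF g] in auto)
      finally have 1: "lo + \<delta> * (hi - lo) / 2 \<le> (\<integral>u. h (u ** g) \<partial>walk m)" .
      have "(\<integral>u. h (u ** g) \<partial>walk m) \<le> (\<integral>u. hi \<partial>walk m)"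
      proof (rule integral_mono_AE)
        show "AE u in walk m. h (u ** g) \<le> hi"
          using walk_unitary by eventually_elim (use bnd g in blast)
      qed (use int[OF g] in auto)
      then show "lo + \<delta> * (hi - lo) / 2 \<le> (\<integral>u. h (u ** g) \<partial>walk m) \<and> (\<integral>u. h (u ** g) \<partial>walk m) \<le> hi"
        using 1 W.prob_space by simp
    qed
  next
    case False
    have A': "- A \<in> sets borel" using A by (rule borel_comp)
    have "measure \<pi> (- A) = 1 - measure \<pi> A"
      using prob_compl[of A] A by (simp add: sets_haar Compl_eq_Diff_UNIV)
    then have half: "measure \<pi> (- A) \<ge> 1 / 2" using False by simp
    \<comment> \<open>Symmetrically, below the midrange the function misses \<open>hi\<close> by at
      least half the range, which lowers the upper bound.\<close>
    show ?thesis
    proof (rule that[of "hi - \<delta> * (hi - lo) / 2" lo])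
      show "hi - \<delta> * (hi - lo) / 2 - lo = (1 - \<delta> / 2) * (hi - lo)" by (simp add: field_simps)
      fix g :: "'n cmat" assume g: "g \<in> unitary_group"
      have "(\<integral>u. h (u ** g) \<partial>walk m) \<le> (\<integral>u. hi - indicator (- A) (u ** g) * ((hi - lo) / 2) \<partial>walk m)"
      proof (rule integral_mono_AE)
        show "AE u in walk m. h (u ** g) \<le> hi - indicator (- A) (u ** g) * ((hi - lo) / 2)"
          using walk_unitary
        proof eventually_elim
          case (elim u)
          then show ?case using bnd[OF unitary_mult[OF elim g]]
            by (auto simp: indicator_def A_def field_simps)
        qed
      qed (use int_ind_i[OF A', of g] int[OF g] in auto)
      also have "\<dots> = hi - trans_prob m (- A) g * (hi - lo) / 2"
        using int_ind_i[OF A', of g] by (simp add: int_ind W.prob_space[unfolded space_walk])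
      also have "\<dots> \<le> hi - \<delta> * (hi - lo) / 2"
        using doeblin[OF A' half g] lohi by (simp add: mult_right_mono)
      finally have 1: "(\<integral>u. h (u ** g) \<partial>walk m) \<le> hi - \<delta> * (hi - lo) / 2" .
      have "(\<integral>u. lo \<partial>walk m) \<le> (\<integral>u. h (u ** g) \<partial>walk m)"
      proof (rule integral_mono_AE)
        show "AE u in walk m. lo \<le> h (u ** g)"
          using walk_unitary by eventually_elim (use bnd g in blast)
      qed (use int[OF g] in auto)
      then show "lo \<le> (\<integral>u. h (u ** g) \<partial>walk m) \<and> (\<integral>u. h (u ** g) \<partial>walk m) \<le> hi - \<delta> * (hi - lo) / 2"
        using 1 W.prob_space by simp
    qed
  qed
qed

lemma uniform_ergodicity:
  obtains c q where "c > 0" "0 < q" "q < 1"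
    "\<And>n g A. g \<in> unitary_group \<Longrightarrow> A \<in> sets borel \<Longrightarrow> \<bar>trans_prob n A g - measure \<pi> A\<bar> \<le> c * q ^ n"
proof -
  obtain m \<delta> where m: "m > 0" and \<delta>: "\<delta> > 0" "\<delta> \<le> 1"
    and doeblin: "\<And>A g. A \<in> sets borel \<Longrightarrow> measure \<pi> A \<ge> 1 / 2 \<Longrightarrow> g \<in> unitary_group \<Longrightarrow> trans_prob m A g \<ge> \<delta>"
    by (rule doeblin_condition) blast
  define \<theta> where "\<theta> = 1 - \<delta> / 2"
  have \<theta>: "0 < \<theta>" "\<theta> < 1" using \<delta> by (auto simp: \<theta>_def)
  \<comment> \<open>Contraction is available once per m steps, so a number of steps is written as r
    + k * m. The range of a probability, [0, 1], starts the induction for every r.\<close>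
  have osc: "\<exists>lo hi. hi - lo \<le> \<theta> ^ k \<and> (\<forall>g\<in>unitary_group. lo \<le> trans_prob (r + k * m) A g \<and> trans_prob (r + k * m) A g \<le> hi)"
    if A: "A \<in> sets borel" for A k r
  proof (induction k)
    case 0
    show ?case by (intro exI[of _ 0] exI[of _ 1]) (simp add: trans_prob_bounds)
  next
    case (Suc k)
    then obtain lo hi where lohi: "hi - lo \<le> \<theta> ^ k"
      "\<And>g. g \<in> unitary_group \<Longrightarrow> lo \<le> trans_prob (r + k * m) A g \<and> trans_prob (r + k * m) A g \<le> hi" by blast
    obtain lo' hi' where lohi': "hi' - lo' = (1 - \<delta> / 2) * (hi - lo)"
      "\<And>g. g \<in> unitary_group \<Longrightarrow> lo' \<le> (\<integral>u. trans_prob (r + k * m) A (u ** g) \<partial>walk m) \<and>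
          (\<integral>u. trans_prob (r + k * m) A (u ** g) \<partial>walk m) \<le> hi'"
      using oscillation_contracts[where m = m and \<delta> = \<delta> and h = "trans_prob (r + k * m) A" and lo = lo and hi = hi] doeblin trans_prob_measurable[OF A] lohi(2)
      by metis
    have eq: "trans_prob (r + Suc k * m) A g = (\<integral>u. trans_prob (r + k * m) A (u ** g) \<partial>walk m)" for g
      using trans_prob_add[OF A, of "r + k * m" m g] by (simp add: algebra_simps)
    have "hi' - lo' \<le> \<theta> ^ Suc k"
      using lohi(1) lohi'(1) \<theta>(1) by (simp add: \<theta>_def mult_left_mono)
    then show ?case using lohi'(2) eq by (intro exI[of _ lo'] exI[of _ hi']) auto
  qed
  have bound: "\<bar>trans_prob n A g - measure \<pi> A\<bar> \<le> \<theta> ^ (n div m)" if A: "A \<in> sets borel" and g: "g \<in> unitary_group" for A n g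
  proof -
    obtain lo hi where lohi: "hi - lo \<le> \<theta> ^ (n div m)"
      "\<And>g. g \<in> unitary_group \<Longrightarrow> lo \<le> trans_prob n A g \<and> trans_prob n A g \<le> hi"
      using osc[OF A, of "n div m" "n mod m"] by auto
    have int: "integrable \<pi> (trans_prob n A)"
    proof (rule integrable_const_bound[of _ 1])
      show "trans_prob n A \<in> borel_measurable \<pi>"
        using trans_prob_measurable[OF A] by (simp cong: measurable_cong_sets add: sets_haar)
    qed (simp add: trans_prob_bounds)
    have "(\<integral>g. lo \<partial>\<pi>) \<le> (\<integral>g. trans_prob n A g \<partial>\<pi>)"
    proof (rule integral_mono_AE)
      show "AE g in \<pi>. lo \<le> trans_prob n A g" using haar_unitary by eventually_elim (use lohi in blast)
    qed (use int in auto)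
    moreover have "(\<integral>g. trans_prob n A g \<partial>\<pi>) \<le> (\<integral>g. hi \<partial>\<pi>)"
    proof (rule integral_mono_AE)
      show "AE g in \<pi>. trans_prob n A g \<le> hi" using haar_unitary by eventually_elim (use lohi in blast)
    qed (use int in auto)
    \<comment> \<open>By invariance \<pi>(A) is an average of the n-step probabilities, so it lies
      in the same interval as each of them.\<close>
    ultimately have "lo \<le> measure \<pi> A" "measure \<pi> A \<le> hi"
      using prob_space by (simp_all add: haar_invariant[OF A])
    then show ?thesis using lohi(1) lohi(2)[OF g] by linarith
  qed
  \<comment> \<open>With q^m = \<theta>, the power of \<theta> with exponent n div m is 1/\<theta>
    times q^(m * (n div m + 1)), and m * (n div m + 1) is at least n. Hence the constant
    1/\<theta>.\<close>
  define q where "q = root m \<theta>"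
  have q: "0 < q" "q < 1" "q ^ m = \<theta>"
    using m \<theta> by (auto simp: q_def real_root_lt_1_iff)
  show ?thesis
  proof (rule that[of "1 / \<theta>" q])
    fix n and A :: "'n cmat set" and g :: "'n cmat" assume "g \<in> unitary_group" "A \<in> sets borel"
    then have "\<bar>trans_prob n A g - measure \<pi> A\<bar> \<le> \<theta> ^ (n div m)" by (intro bound)
    also have "\<dots> = 1 / \<theta> * q ^ (m * (n div m + 1))"
      unfolding power_mult q(3) using \<theta> by simp
    also have "\<dots> \<le> 1 / \<theta> * q ^ n"
    proof (intro mult_left_mono power_decreasing)
      show "n \<le> m * (n div m + 1)"
        using dividend_less_times_div[OF m, of n] by simp
    qed (use q \<theta> in auto)
    finally show "\<bar>trans_prob n A g - measure \<pi> A\<bar> \<le> 1 / \<theta> * q ^ n" .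
  qed (use \<theta> q in auto)
qed

end

section \<open>Transfer to the given chain and Haar measure\<close>

lemma chain_eq_Jprod: "chain H1 H2 \<tau> g n \<omega> = Jprod H1 H2 (2 * n) (\<lambda>i. \<tau> i \<omega>) ** g"
  by (induction n) (simp_all add: ham_def matrix_mul_assoc)

text \<open>Pushing forward along the inclusion extends the measure to all matrices. Invariance is
  given for images of sets, whereas \<open>distr\<close> uses preimages; left multiplication by g is
  a bijection of U(N), so the image of the preimage of A within U(N) is A restricted to
  U(N).\<close>

lemma left_haar_of_haar_measure:
  fixes \<pi> :: "'n::finite cmat measure"
  assumes "haar_measure \<pi>"
  shows "left_haar (distr \<pi> borel (\<lambda>x. x))"
proof -
  let ?U = "unitary_group :: 'n cmat set"
  have sets: "sets \<pi> = sets (restrict_space borel ?U)" and prob: "prob_space \<pi>"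
    and inv: "\<And>g A. g \<in> ?U \<Longrightarrow> A \<in> sets \<pi> \<Longrightarrow> emeasure \<pi> ((\<lambda>x. g ** x) ` A) = emeasure \<pi> A"
    using assms by (auto simp: haar_measure_def)
  have space: "space \<pi> = ?U" using sets_eq_imp_space_eq[OF sets] by simp
  have id [measurable]: "(\<lambda>x. x) \<in> measurable \<pi> borel"
    unfolding measurable_cong_sets[OF sets refl] by (rule measurable_restrict_space1) simp
  have inU: "A \<inter> ?U \<in> sets \<pi>" if "A \<in> sets borel" for A
    unfolding sets using that by (auto simp: sets_restrict_space_iff)
  have em: "emeasure (distr \<pi> borel (\<lambda>x. x)) A = emeasure \<pi> (A \<inter> ?U)" if "A \<in> sets borel" for A
    using that by (subst emeasure_distr) (auto simp: space)
  show ?thesis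
    unfolding left_haar_def left_haar_axioms_def
  proof (intro conjI allI impI)
    show "prob_space (distr \<pi> borel (\<lambda>x. x))" using prob by (intro prob_space.prob_space_distr) auto
    show "AE u in distr \<pi> borel (\<lambda>x. x). u \<in> ?U"
      using AE_space[of \<pi>] by (subst AE_distr_iff) (simp_all add: space)
    fix g :: "'n cmat" assume g: "g \<in> ?U"
    show "distr (distr \<pi> borel (\<lambda>x. x)) borel (\<lambda>u. g ** u) = distr \<pi> borel (\<lambda>x. x)"
    proof (rule measure_eqI)
      fix A assume "A \<in> sets (distr (distr \<pi> borel (\<lambda>x. x)) borel (\<lambda>u. g ** u))"
      then have A: "A \<in> sets borel" by simp
      have mult: "(\<lambda>u. g ** u) \<in> measurable borel (borel :: 'n cmat measure)" by measurable
      have pre: "(\<lambda>u. g ** u) -` A \<in> sets borel" using measurable_sets[OF mult A] by simp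
      have "emeasure (distr (distr \<pi> borel (\<lambda>x. x)) borel (\<lambda>u. g ** u)) A = emeasure \<pi> ((\<lambda>u. g ** u) -` A \<inter> ?U)"
        using A pre by (subst emeasure_distr) (auto simp: em)
      also have "\<dots> = emeasure \<pi> ((\<lambda>x. g ** x) ` ((\<lambda>u. g ** u) -` A \<inter> ?U))"
        using inv[OF g inU[OF pre]] by simp
      also have "(\<lambda>x. g ** x) ` ((\<lambda>u. g ** u) -` A \<inter> ?U) = A \<inter> ?U"
      proof safe
        fix x assume "x \<in> A" "x \<in> ?U"
        moreover have "cmat_adj g ** x \<in> ?U" using g \<open>x \<in> ?U\<close> by blast
        ultimately show "x \<in> (\<lambda>x. g ** x) ` ((\<lambda>u. g ** u) -` A \<inter> ?U)"
          using g by (intro image_eqI[of _ _ "cmat_adj g ** x"]) auto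
      qed (use g in blast)
      also have "emeasure \<pi> (A \<inter> ?U) = emeasure (distr \<pi> borel (\<lambda>x. x)) A" using em[OF A] by simp
      finally show "emeasure (distr (distr \<pi> borel (\<lambda>x. x)) borel (\<lambda>u. g ** u)) A = emeasure (distr \<pi> borel (\<lambda>x. x)) A" .
    qed simp
  qed simp
qed

theorem mainTheorem11:
  fixes H1 H2 :: "'n::finite cmat"
    and M :: "'a measure"
    and \<tau> :: "nat \<Rightarrow> 'a \<Rightarrow> real"
    and f :: "real \<Rightarrow> real"
    and \<pi> :: "'n cmat measure"
  assumes N: "CARD('n) > 1"
    and herm1: "hermitian H1" and herm2: "hermitian H2"
    and P: "prob_space M"
    and indep: "prob_space.indep_vars M (\<lambda>_. borel) \<tau> {1..}"
    and distr: "\<And>i. i \<ge> 1 \<Longrightarrow> distributed M lborel (\<tau> i) f"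
    and pos: "\<And>i. i \<ge> 1 \<Longrightarrow> AE \<omega> in M. \<tau> i \<omega> > 0"
    and fpos: "\<And>x. x \<ge> 0 \<Longrightarrow> f x > 0"
    and integ: "integrable M (\<tau> 1)"
    and ctrl: "U_controllable H1 H2"
    and haar: "haar_measure \<pi>"
  shows "\<exists>c q. c > 0 \<and> 0 < q \<and> q < 1 \<and>
           (\<forall>g\<in>unitary_group. \<forall>A. A \<in> sets borel \<longrightarrow> A \<subseteq> unitary_group \<longrightarrow>
              (\<forall>n\<ge>1. \<bar>Pn M H1 H2 \<tau> n g A - measure \<pi> A\<bar> \<le> c * q ^ n))"
proof -
  interpret M: prob_space M by (rule P)
  let ?F = "\<lambda>x. ennreal (f x)" and ?\<pi> = "distr \<pi> borel (\<lambda>x. x)"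
  have rv: "\<tau> i \<in> borel_measurable M" and law: "distr M borel (\<tau> i) = density lborel ?F" if "i \<ge> 1" for i
    using distr[OF that] by (auto simp: distributed_def cong: distr_cong)
  have F: "?F \<in> borel_measurable borel"
    using distr[of 1] by (auto simp: distributed_def)
  interpret controllable_walk_haar H1 H2 ?F ?\<pi>
  proof (intro controllable_walk_haar.intro controllable_walk.intro left_haar_of_haar_measure haar herm1 herm2 ctrl F)
    show "0 < ennreal (f x)" if "0 \<le> x" for x using fpos[OF that] by simp
    show "prob_space (density lborel ?F)"
      using M.prob_space_distr[OF rv[of 1]] law[of 1] by simp
  qed
  have Pn: "Pn M H1 H2 \<tau> n g A = trans_prob n A g"
    if "n \<ge> 1" "A \<in> sets borel" for n g A
  proof -
    let ?J = "{1..2 * n}" and ?T = "\<lambda>\<omega>. \<lambda>i\<in>{1..2 * n}. \<tau> i \<omega>"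
    have "M.indep_vars (\<lambda>_. borel) \<tau> ?J"
      by (rule M.indep_vars_subset[OF indep]) auto
    then have "distr M (Pi\<^sub>M ?J (\<lambda>_. borel)) ?T = Pi\<^sub>M ?J (\<lambda>i. distr M borel (\<tau> i))"
      using rv \<open>n \<ge> 1\<close> by (subst (asm) M.indep_vars_iff_distr_eq_PiM') auto
    also have "\<dots> = time_law ?J" using law by (intro PiM_cong) auto
    finally have joint: "distr M (Pi\<^sub>M ?J (\<lambda>_. borel)) ?T = time_law ?J" .
    have T: "?T \<in> measurable M (Pi\<^sub>M ?J (\<lambda>_. borel))" using rv by (intro measurable_restrict) auto
    have J: "Jprod H1 H2 (2 * n) \<in> borel_measurable (Pi\<^sub>M ?J (\<lambda>_. borel))"
      using Jprod_measurable[of "2 * n" ?J] by (simp cong: measurable_cong_sets sets_PiM_cong)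
    have "walk n = distr M borel (\<lambda>\<omega>. Jprod H1 H2 (2 * n) (?T \<omega>))"
      unfolding walk_def joint[symmetric] distr_distr[OF J T] by (simp add: o_def)
    moreover have cong: "Jprod H1 H2 (2 * n) (?T \<omega>) = Jprod H1 H2 (2 * n) (\<lambda>i. \<tau> i \<omega>)" for \<omega>
      by (rule Jprod_cong) auto
    ultimately have walk: "walk n = distr M borel (\<lambda>\<omega>. Jprod H1 H2 (2 * n) (\<lambda>i. \<tau> i \<omega>))" by simp
    have "(\<lambda>\<omega>. Jprod H1 H2 (2 * n) (\<lambda>i. \<tau> i \<omega>)) \<in> borel_measurable M"
      using measurable_compose[OF T J] by (simp only: cong)
    then show ?thesis
      unfolding Pn_def trans_prob_def walk
      using translate_borel(1)[OF that(2), of g]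
      by (subst measure_distr) (auto simp: chain_eq_Jprod intro!: arg_cong[where f = "measure M"])
  qed
  have pi: "measure ?\<pi> A = measure \<pi> A" if "A \<in> sets borel" "A \<subseteq> unitary_group" for A
  proof -
    have sets: "sets \<pi> = sets (restrict_space borel unitary_group)"
      using haar by (simp add: haar_measure_def)
    have "(\<lambda>x. x) \<in> measurable \<pi> borel"
      unfolding measurable_cong_sets[OF sets refl] by (rule measurable_restrict_space1) simp
    moreover have "space \<pi> = unitary_group" using sets_eq_imp_space_eq[OF sets] by simp
    ultimately show ?thesis using that by (subst measure_distr) (auto simp: Int_absorb2)
  qed
  obtain c q where cq: "c > 0" "0 < q" "q < 1"
    "\<And>n g A. g \<in> unitary_group \<Longrightarrow> A \<in> sets borel \<Longrightarrow> \<bar>trans_prob n A g - measure ?\<pi> A\<bar> \<le> c * q ^ n"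
    by (rule uniform_ergodicity) blast
  show ?thesis
  proof (rule exI[of _ c], rule exI[of _ q], intro conjI ballI allI impI cq(1-3))
    fix g :: "'n cmat" and A :: "'n cmat set" and n :: nat
    assume "g \<in> unitary_group" "A \<in> sets borel" "A \<subseteq> unitary_group" "n \<ge> 1"
    then show "\<bar>Pn M H1 H2 \<tau> n g A - measure \<pi> A\<bar> \<le> c * q ^ n"
      using cq(4)[of g A n] by (simp add: Pn pi)
  qed
qed

end
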